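(* Let $K:[0,T]^2\to\mathbb{R}$ be a Volterra kernel (square-integrable with $K(t,s)=0$ for $s\ge t$) for which there are $C<\infty$ and $\alpha\in[0,\frac14)$ such that, for all $0<s<t\le T$, $|K(t,s)|\le Cs^{-\alpha}(t-s)^{-\alpha}$, $\frac{\partial K(t,s)}{\partial t}$ exists and $|\frac{\partial K(t,s)}{\partial t}|\le C(t-s)^{-(\alpha+1)}$. Let $\psi:[0,T]^2\to\mathbb{R}^d\otimes\mathbb{R}^d$ be of the form $\psi(u,v)=\mathbf{1}_{[0,v)}(u)\tilde\psi(u,v)$, where $\tilde\psi$ is strongly $\lambda$-Hölder bi-continuous. If $\lambda>\alpha$, then $\psi$ is an element of $\mathcal{H}_1^d\otimes\mathcal{H}_1^d$, with norm given by $$\|\psi\|^2_{\mathcal{H}_1^d\otimes\mathcal{H}_1^d}=\int_{[0,T]^2}\left|(\mathcal{K}^*\otimes\mathcal{K}^* )\psi(s,t)\right|^2_{\mathbb{R}^d\otimes\mathbb{R}^d}\,\mathrm{d}s\,\mathrm{d}t,$$ and, with $\psi^\pi(s,t):=\sum_j\psi(s,r_j)\mathbf{1}_{[r_j,r_{j+1})}(t)$ for a partition $\pi=\{r_j\}$ of $[0,T]$, $$\|\psi^\pi-\psi\|_{\mathcal{H}_1^d\otimes\mathcal{H}_1^d}\to0\quad\text{as }\|\pi\|\to0.$$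
   Context: Let $R(s,t)=\int_0^{s\wedge t}K(t,r)K(s,r)\,\mathrm{d}r$. $\mathcal{H}_1^d$ is the completion of the linear span of $\mathbf{1}_{[0,t)}e_u$, $t\in[0,T]$, $u=1,\dots,d$, under $\langle\mathbf{1}_{[0,t)}e_u,\mathbf{1}_{[0,s)}e_v\rangle_{\mathcal{H}_1^d}=\delta_{uv}R(t,s)$; $\mathcal{H}_1^d\otimes\mathcal{H}_1^d$ is the Hilbert space tensor product. A piecewise $\lambda$-Hölder path $f:[0,T]\to\mathbb{R}^d$ with $\lambda>\alpha$ is regarded as an element of $\mathcal{H}_1^d$ by identifying it with the limit in $\mathcal{H}_1^d$ of its step approximations $\sum_if(r_i)\mathbf{1}_{[r_i,r_{i+1})}$ as the mesh tends to $0$. A function of the form $A(s)\mathbf{1}_{[a,b)}(t)$ with $A=(A_{kj}):[0,T]\to\mathbb{R}^d\otimes\mathbb{R}^d$ is identified with $\sum_{j=1}^d\big(\sum_{k=1}^dA_{kj}(\cdot)e_k\big)\otimes\mathbf{1}_{[a,b)}e_j$; in this way $\psi^\pi$ is an element of $\mathcal{H}_1^d\otimes\mathcal{H}_1^d$, and $\psi$ is identified with the limit of $\psi^\pi$ in $\mathcal{H}_1^d\otimes\mathcal{H}_1^d$ as $\|\pi\|\to0$. For a Banach space $E$ and $0<\lambda\le1$, $\phi:[0,T]^2\to E$ is strongly $\lambda$-Hölder bi-continuous if for some $C$ and all $u_1,u_2,v_1,v_2\in[0,T]$: $\sup_v\|\phi(u_2,v)-\phi(u_1,v)\|_E\le C|u_2-u_1|^\lambda$,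 $\sup_u\|\phi(u,v_2)-\phi(u,v_1)\|_E\le C|v_2-v_1|^\lambda$, and $\left\|\phi\begin{pmatrix} u_1 & u_2 \\ v_1 & v_2 \end{pmatrix}\right\|_E\le C|u_2-u_1|^\lambda|v_2-v_1|^\lambda$, with rectangular increment $\phi\begin{pmatrix} a & b \\ c & e \end{pmatrix}=\phi(a,c)+\phi(b,e)-\phi(a,e)-\phi(b,c)$. With $K(\mathrm{d}r,s):=\frac{\partial K(r,s)}{\partial r}\,\mathrm{d}r$, the operator $\mathcal{K}^*\otimes\mathcal{K}^*$ is $$(\mathcal{K}^*\otimes\mathcal{K}^* )\psi(u,v):=\psi(u,v)K(T,v)K(T,u)+K(T,v)A^K(\psi(\cdot,v))(u)+K(T,u)A^K(\psi(u,\cdot))(v)+B^K(\psi)(u,v),$$ $A^K(\phi)(s):=\int_s^T[\phi(r)-\phi(s)]K(\mathrm{d}r,s)$, $B^K(\psi)(u,v):=\int_v^T\int_u^T\psi\begin{pmatrix} u & r_1 \\ v & r_2 \end{pmatrix}K(\mathrm{d}r_1,u)K(\mathrm{d}r_2,v)$. *)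

theory Defs
  imports "HOL-Analysis.Analysis"
begin

definition volterra_kernel :: "real \<Rightarrow> (real \<Rightarrow> real \<Rightarrow> real) \<Rightarrow> bool" where
  "volterra_kernel T K \<longleftrightarrow>
     set_borel_measurable lebesgue ({0..T} \<times> {0..T}) (\<lambda>(t, s). K t s) \<and>
     set_integrable lebesgue ({0..T} \<times> {0..T}) (\<lambda>(t, s). (K t s)\<^sup>2) \<and>
     (\<forall>t\<in>{0..T}. \<forall>s\<in>{0..T}. t \<le> s \<longrightarrow> K t s = 0)"

definition cov :: "(real \<Rightarrow> real \<Rightarrow> real) \<Rightarrow> real \<Rightarrow> real \<Rightarrow> real" where
  "cov K s t = (LINT r:{0..min s t}|lebesgue. K t r * K s r)"

text \<open>
  The partial derivative of \<open>K\<close> in its first argument, that is the density of \<open>K(dr, s)\<close>.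
  It is taken within \<open>{0..T}\<close>, so that it is one-sided at \<open>r = T\<close> and does not see values of
  \<open>K\<close> outside the square.
\<close>

definition dK :: "real \<Rightarrow> (real \<Rightarrow> real \<Rightarrow> real) \<Rightarrow> real \<Rightarrow> real \<Rightarrow> real" where
  "dK T K r s = vector_derivative (\<lambda>x. K x s) (at r within {0..T})"

definition rect_incr ::
    "(real \<Rightarrow> real \<Rightarrow> 'e::real_normed_vector) \<Rightarrow> real \<Rightarrow> real \<Rightarrow> real \<Rightarrow> real \<Rightarrow> 'e" where
  "rect_incr \<phi> a b c e = \<phi> a c + \<phi> b e - \<phi> a e - \<phi> b c"

definition strongly_hoelder_bicont ::
    "real \<Rightarrow> real \<Rightarrow> (real \<Rightarrow> real \<Rightarrow> 'e::banach) \<Rightarrow> bool" where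
  "strongly_hoelder_bicont T l \<phi> \<longleftrightarrow>
     (\<exists>C. \<forall>u1\<in>{0..T}. \<forall>u2\<in>{0..T}. \<forall>v1\<in>{0..T}. \<forall>v2\<in>{0..T}.
        (\<forall>v\<in>{0..T}. norm (\<phi> u2 v - \<phi> u1 v) \<le> C * \<bar>u2 - u1\<bar> powr l) \<and>
        (\<forall>u\<in>{0..T}. norm (\<phi> u v2 - \<phi> u v1) \<le> C * \<bar>v2 - v1\<bar> powr l) \<and>
        norm (rect_incr \<phi> u1 u2 v1 v2) \<le> C * \<bar>u2 - u1\<bar> powr l * \<bar>v2 - v1\<bar> powr l)"

definition AK ::
    "real \<Rightarrow> (real \<Rightarrow> real \<Rightarrow> real) \<Rightarrow> (real \<Rightarrow> 'e::euclidean_space) \<Rightarrow> real \<Rightarrow> 'e" where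
  "AK T K \<phi> s = (LINT r:{s..T}|lebesgue. dK T K r s *\<^sub>R (\<phi> r - \<phi> s))"

definition BK ::
    "real \<Rightarrow> (real \<Rightarrow> real \<Rightarrow> real) \<Rightarrow> (real \<Rightarrow> real \<Rightarrow> 'e::euclidean_space)
       \<Rightarrow> real \<Rightarrow> real \<Rightarrow> 'e" where
  "BK T K \<psi> u v =
     (LINT r2:{v..T}|lebesgue. dK T K r2 v *\<^sub>R
        (LINT r1:{u..T}|lebesgue. dK T K r1 u *\<^sub>R rect_incr \<psi> u r1 v r2))"

definition Kstar2 ::
    "real \<Rightarrow> (real \<Rightarrow> real \<Rightarrow> real) \<Rightarrow> (real \<Rightarrow> real \<Rightarrow> 'e::euclidean_space)
       \<Rightarrow> real \<Rightarrow> real \<Rightarrow> 'e" where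
  "Kstar2 T K \<psi> u v =
     (K T v * K T u) *\<^sub>R \<psi> u v
     + K T v *\<^sub>R AK T K (\<lambda>r. \<psi> r v) u
     + K T u *\<^sub>R AK T K (\<lambda>r. \<psi> u r) v
     + BK T K \<psi> u v"

definition is_partition :: "real \<Rightarrow> real list \<Rightarrow> bool" where
  "is_partition T \<pi> \<longleftrightarrow> \<pi> \<noteq> [] \<and> sorted_wrt (<) \<pi> \<and> hd \<pi> = 0 \<and> last \<pi> = T"

definition mesh :: "real list \<Rightarrow> real" where
  "mesh \<pi> = Max ((\<lambda>i. \<pi> ! Suc i - \<pi> ! i) ` {..<length \<pi> - 1})"

definition mesh_to_0 :: "real \<Rightarrow> real list filter" where
  "mesh_to_0 T = (INF \<delta>\<in>{0<..}. principal {\<pi>. is_partition T \<pi> \<and> mesh \<pi> < \<delta>})"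

lemma eventually_mesh_to_0:
  "eventually P (mesh_to_0 T) \<longleftrightarrow>
     (\<exists>\<delta>>0. \<forall>\<pi>. is_partition T \<pi> \<longrightarrow> mesh \<pi> < \<delta> \<longrightarrow> P \<pi>)"
proof -
  have "eventually P (mesh_to_0 T) \<longleftrightarrow>
      (\<exists>\<delta>\<in>{0<..}. eventually P (principal {\<pi>. is_partition T \<pi> \<and> mesh \<pi> < \<delta>}))"
    unfolding mesh_to_0_def
  proof (rule eventually_INF_base)
    fix a b :: real assume "a \<in> {0<..}" "b \<in> {0<..}"
    then show "\<exists>x\<in>{0<..}. principal {\<pi>. is_partition T \<pi> \<and> mesh \<pi> < x}
        \<le> inf (principal {\<pi>. is_partition T \<pi> \<and> mesh \<pi> < a})
              (principal {\<pi>. is_partition T \<pi> \<and> mesh \<pi> < b})"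
      by (intro bexI[of _ "min a b"]) auto
  qed auto
  then show ?thesis
    by (auto simp: eventually_principal)
qed

lemma mesh_to_0_neq_bot:
  assumes "T > 0"
  shows "mesh_to_0 T \<noteq> bot"
proof -
  have "\<exists>\<pi>. is_partition T \<pi> \<and> mesh \<pi> < \<delta>" if "\<delta> > 0" for \<delta> :: real
  proof -
    obtain n :: nat where n: "T / \<delta> < real n"
      using reals_Archimedean2 by blast
    then have n0: "n > 0"
      using assms that by (cases n) (auto simp: field_simps)
    define \<pi> where "\<pi> = map (\<lambda>i. T * real i / real n) [0..<Suc n]"
    have nth: "\<pi> ! i = T * real i / real n" if "i \<le> n" for i
      using that unfolding \<pi>_def by (subst nth_map) (auto simp del: upt_Suc)
    have len: "length \<pi> = Suc n"
      by (simp add: \<pi>_def)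
    have "is_partition T \<pi>"
      unfolding is_partition_def
    proof (intro conjI)
      show ne: "\<pi> \<noteq> []" using len by auto
      show "sorted_wrt (<) \<pi>"
        unfolding sorted_wrt_iff_nth_less using assms n0
        by (auto simp: len nth intro!: divide_strict_right_mono)
      show "hd \<pi> = 0" using ne by (simp add: hd_conv_nth nth)
      show "last \<pi> = T" using ne n0 by (simp add: last_conv_nth nth len)
    qed
    moreover have "mesh \<pi> < \<delta>"
      unfolding mesh_def using n n0 that
      by (subst Max_less_iff) (auto simp: len nth lessThan_empty_iff field_simps)
    ultimately show ?thesis by blast
  qed
  then show ?thesis
    unfolding trivial_limit_def eventually_mesh_to_0 by auto
qed

text \<open>
  The inner product on the linear span of the functions \<open>1\<^bsub>[0,t)\<^esub> e\<^sub>u\<close> depends on \<open>K\<close> and \<open>T\<close>,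
  so its completion cannot be a type; it is given through an arbitrary realization inside a
  Hilbert space \<open>'h\<close>.  A linear isometric map of the span into \<open>'h\<close> is the same as a family
  \<open>ind t u\<close> (the image of \<open>1\<^bsub>[0,t)\<^esub> e\<^sub>u\<close>) with the prescribed Gram matrix: these functions
  are linearly independent for \<open>t > 0\<close>, and \<open>ind 0 u = 0\<close> is forced.  The completion is then
  the closure of the image.
\<close>

definition H1_embedding ::
    "real \<Rightarrow> (real \<Rightarrow> real \<Rightarrow> real) \<Rightarrow> (real \<Rightarrow> 'd::finite \<Rightarrow> 'h::{real_inner,banach}) \<Rightarrow> bool" where
  "H1_embedding T K ind \<longleftrightarrow>
     (\<forall>t\<in>{0..T}. \<forall>s\<in>{0..T}. \<forall>u v.
        inner (ind t u) (ind s v) = (if u = v then cov K t s else 0))"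

definition H1_space :: "real \<Rightarrow> (real \<Rightarrow> 'd::finite \<Rightarrow> 'h::{real_inner,banach}) \<Rightarrow> 'h set" where
  "H1_space T ind = closure (span {ind t u |t u. t \<in> {0..T}})"

text \<open>
  Likewise, the Hilbert space tensor product of a Hilbert space \<open>H\<close> with itself is realized in a
  Hilbert space \<open>'g\<close>: the algebraic tensor product is the span of the elementary tensors, and the
  Hilbert space tensor product is its closure.  The inner product identity already makes \<open>tens\<close>
  bilinear on \<open>H\<close>.
\<close>

definition tensor_embedding ::
    "'h::{real_inner,banach} set \<Rightarrow> ('h \<Rightarrow> 'h \<Rightarrow> 'g::{real_inner,banach}) \<Rightarrow> bool" where
  "tensor_embedding H tens \<longleftrightarrow>
     (\<forall>a\<in>H. \<forall>b\<in>H. \<forall>c\<in>H. \<forall>d\<in>H. inner (tens a b) (tens c d) = inner a c * inner b d)"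

definition tensor_space ::
    "'h::{real_inner,banach} set \<Rightarrow> ('h \<Rightarrow> 'h \<Rightarrow> 'g::{real_inner,banach}) \<Rightarrow> 'g set" where
  "tensor_space H tens = closure (span {tens a b |a b. a \<in> H \<and> b \<in> H})"

lemma tensor_embedding_bilinear:
  assumes tens: "tensor_embedding H tens" and H: "subspace H"
    and abc: "a \<in> H" "b \<in> H" "c \<in> H"
  shows "tens (a + b) c = tens a c + tens b c" and "tens c (a + b) = tens c a + tens c b"
    and "tens (r *\<^sub>R a) c = r *\<^sub>R tens a c" and "tens c (r *\<^sub>R a) = r *\<^sub>R tens c a"
proof -
  note [simp] = tens[unfolded tensor_embedding_def, rule_format]
  note [simp] = abc subspace_add[OF H] subspace_scale[OF H]
  have eq: "x = y" if "inner (x - y) (x - y) = 0" for x y :: 'b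
    using that by simp
  show "tens (a + b) c = tens a c + tens b c" "tens c (a + b) = tens c a + tens c b"
    "tens (r *\<^sub>R a) c = r *\<^sub>R tens a c" "tens c (r *\<^sub>R a) = r *\<^sub>R tens c a"
    by (rule eq, simp add: inner_diff inner_add algebra_simps inner_commute)+
qed

text \<open>The image of \<open>1\<^bsub>[a,b)\<^esub> e\<^sub>u = 1\<^bsub>[0,b)\<^esub> e\<^sub>u - 1\<^bsub>[0,a)\<^esub> e\<^sub>u\<close>.\<close>

definition ind_elem :: "(real \<Rightarrow> 'd::finite \<Rightarrow> 'h::{real_inner,banach}) \<Rightarrow> real \<Rightarrow> real \<Rightarrow> 'd \<Rightarrow> 'h" where
  "ind_elem ind a b u = ind b u - ind a u"

definition step_approx ::
    "(real \<Rightarrow> 'd::finite \<Rightarrow> 'h::{real_inner,banach}) \<Rightarrow> (real \<Rightarrow> real ^ 'd) \<Rightarrow> real list \<Rightarrow> 'h" where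
  "step_approx ind f \<pi> =
     (\<Sum>i<length \<pi> - 1. \<Sum>k\<in>UNIV. (f (\<pi> ! i) $ k) *\<^sub>R ind_elem ind (\<pi> ! i) (\<pi> ! Suc i) k)"

text \<open>\<open>Lim\<close> is a definite description: meaningful only when the step approximations converge.\<close>

definition path_elem ::
    "real \<Rightarrow> (real \<Rightarrow> 'd::finite \<Rightarrow> 'h::{real_inner,banach}) \<Rightarrow> (real \<Rightarrow> real ^ 'd) \<Rightarrow> 'h" where
  "path_elem T ind f = Lim (mesh_to_0 T) (step_approx ind f)"

text \<open>The element identified with the function \<open>(s, t) \<mapsto> A(s) 1\<^bsub>[a,b)\<^esub>(t)\<close>.\<close>

definition strip_elem ::
    "real \<Rightarrow> (real \<Rightarrow> 'd::finite \<Rightarrow> 'h::{real_inner,banach}) \<Rightarrow> ('h \<Rightarrow> 'h \<Rightarrow> 'g::{real_inner,banach})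
       \<Rightarrow> (real \<Rightarrow> real ^ 'd ^ 'd) \<Rightarrow> real \<Rightarrow> real \<Rightarrow> 'g" where
  "strip_elem T ind tens A a b =
     (\<Sum>j\<in>UNIV. tens (path_elem T ind (\<lambda>s. column j (A s))) (ind_elem ind a b j))"

text \<open>
  The element identified with the function
  \<open>(s, t) \<mapsto> \<Sum>\<^sub>j \<psi>(s, r\<^sub>j) 1\<^bsub>[r\<^sub>j, r\<^sub>j\<^sub>+\<^sub>1)\<^esub>(t)\<close>.
\<close>

definition psi_partition ::
    "real \<Rightarrow> (real \<Rightarrow> 'd::finite \<Rightarrow> 'h::{real_inner,banach}) \<Rightarrow> ('h \<Rightarrow> 'h \<Rightarrow> 'g::{real_inner,banach})
       \<Rightarrow> (real \<Rightarrow> real \<Rightarrow> real ^ 'd ^ 'd) \<Rightarrow> real list \<Rightarrow> 'g" where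
  "psi_partition T ind tens \<psi> \<pi> =
     (\<Sum>j<length \<pi> - 1. strip_elem T ind tens (\<lambda>s. \<psi> s (\<pi> ! j)) (\<pi> ! j) (\<pi> ! Suc j))"

end

theory Submission
  imports Defs
begin

text \<open>
  On step functions, \<open>K*\<close> maps \<open>1\<^bsub>[0,t)\<^esub>\<close> to \<open>K t\<close> and is isometric into \<open>L\<^sup>2\<close>, so everything reduces
  to \<open>L\<^sup>2\<close> convergence of \<open>K* g\<^sup>\<pi>\<close> to \<open>K* g\<close> for step approximations \<open>g\<^sup>\<pi>\<close> of \<open>g\<close>. Applying \<open>K*\<close> in the
  first variable turns \<open>\<psi>\<close> into \<open>G s v = K*(\<psi>(_, v))(s)\<close>, and \<open>v \<mapsto> G _ v\<close> is, up to a weight at \<open>0\<close>,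
  Hoelder continuous with exponent \<open>\<theta> > \<alpha>\<close> as an \<open>L\<^sup>2\<close>-valued path; this is where \<open>4 \<alpha> < 1\<close> is used.
  The one-dimensional convergence estimate, for paths with values in an \<open>L\<^sup>2\<close> space, then
  applies to the second variable as well, with Minkowski's inequality in place of the
  triangle inequality.
\<close>

section \<open>Power integrals\<close>

text \<open>The obstacle is the indicator in \<open>\<psi>\<close>: sections of
  \<open>\<psi>\<close> jump at the diagonal and are not Hoelder. The jump is moved into the
  operator. \<open>Kstar v\<close> is \<open>K*\<close> of a function cut off at \<open>v\<close>,
  written with the boundary factor \<open>K v\<close> and an integral that stops at
  \<open>v\<close>, so that it acts on the Hoelder function behind the indicator. In the second
  variable the cut-off reappears as the fact that \<open>G s v\<close> vanishes for
  \<open>v \<le> s\<close>; this singular behaviour at the diagonal is smoothed by taking the L2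
  norm in \<open>s\<close>. Squaring \<open>(v - s) powr (- \<alpha> - \<theta>)\<close> asks for
  \<open>2 * \<alpha> + 2 * \<theta> < 1\<close>, whereas integrability of Hoelder increments
  against \<open>k\<close> asks for \<open>\<theta> > \<alpha>\<close>; such a
  \<open>\<theta>\<close> exists exactly when \<open>4 * \<alpha> < 1\<close>. No map between the
  abstract Hilbert spaces and L2 is constructed: step elements and kernel sums have the same Gram
  matrices, and this is enough to transfer Cauchy properties and norms.\<close>

lemma nn_integral_powr_right:
  fixes p u v :: real
  assumes "p < 1" "u \<le> v"
  shows "(\<integral>\<^sup>+s\<in>{u..v}. ennreal ((s - u) powr - p) \<partial>lborel) = ennreal ((v - u) powr (1 - p) / (1 - p))"
proof -
  have "((\<lambda>x. x powr - p) has_integral ((v - u) powr (- p + 1) / (- p + 1))) {0..v - u}"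
    using assms by (intro has_integral_powr_from_0) auto
  then have *: "(\<integral>\<^sup>+x. ennreal (indicator {0..v-u} x * x powr - p) \<partial>lborel) = ennreal ((v - u) powr (1 - p) / (1 - p))"
    by (subst nn_integral_has_integral_lebesgue[where I = "(v - u) powr (- p + 1) / (- p + 1)"]) auto
  have "(\<integral>\<^sup>+s\<in>{u..v}. ennreal ((s - u) powr - p) \<partial>lborel)
     = (\<integral>\<^sup>+x. ennreal ((u + 1 * x - u) powr - p) * indicator {u..v} (u + 1 * x) \<partial>lborel)"
    by (subst nn_integral_real_affine[where c = 1 and t = u]) auto
  also have "\<dots> = (\<integral>\<^sup>+x. ennreal (indicator {0..v-u} x * x powr - p) \<partial>lborel)"
    by (intro nn_integral_cong) (auto simp: indicator_def)
  finally show ?thesis using * by simp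
qed

lemma nn_integral_powr_left:
  fixes p u v :: real
  assumes "p < 1" "u \<le> v"
  shows "(\<integral>\<^sup>+s\<in>{u..v}. ennreal ((v - s) powr - p) \<partial>lborel) = ennreal ((v - u) powr (1 - p) / (1 - p))"
proof -
  have "(\<integral>\<^sup>+s\<in>{u..v}. ennreal ((v - s) powr - p) \<partial>lborel)
     = (\<integral>\<^sup>+x. ennreal ((v - (u + v + (-1) * x)) powr - p) * indicator {u..v} (u + v + (-1) * x) \<partial>lborel)"
    by (subst nn_integral_real_affine[where c = "-1" and t = "u + v"]) auto
  also have "\<dots> = (\<integral>\<^sup>+s\<in>{u..v}. ennreal ((s - u) powr - p) \<partial>lborel)"
    by (intro nn_integral_cong) (auto simp: indicator_def)
  finally show ?thesis using nn_integral_powr_right[OF assms] by simp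
qed

lemma nn_integral_powr_tail:
  fixes a b t T :: real
  assumes "0 < a" "t < b" "b \<le> T"
  shows "(\<integral>\<^sup>+r\<in>{b..T}. ennreal ((r - t) powr (- a - 1)) \<partial>lborel) \<le> ennreal ((b - t) powr (- a) / a)"
proof -
  have "((\<lambda>r. (r - t) powr (- a - 1)) has_integral
      (- ((T - t) powr (- a) / a) - - ((b - t) powr (- a) / a))) {b..T}"
  proof (rule fundamental_theorem_of_calculus[OF assms(3)])
    fix x assume "x \<in> {b..T}"
    then have "x - t > 0" using assms by auto
    then have "((\<lambda>r. - ((r - t) powr (- a) / a)) has_field_derivative (x - t) powr (- a - 1)) (at x within {b..T})"
      using assms(1) by (auto intro!: derivative_eq_intros simp: field_simps)
    then show "((\<lambda>r. - ((r - t) powr (- a) / a)) has_vector_derivative (x - t) powr (- a - 1)) (at x within {b..T})"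
      by (simp add: has_real_derivative_iff_has_vector_derivative)
  qed
  then have "(\<integral>\<^sup>+r. ennreal (indicator {b..T} r * (r - t) powr (- a - 1)) \<partial>lborel)
     = ennreal ((b - t) powr (- a) / a - (T - t) powr (- a) / a)"
    by (subst nn_integral_has_integral_lebesgue[where I = "- ((T - t) powr (- a) / a) - - ((b - t) powr (- a) / a)"]) auto
  also have "\<dots> \<le> ennreal ((b - t) powr (- a) / a)"
    using assms by (intro ennreal_leI) auto
  finally show ?thesis
    by (simp add: indicator_mult_ennreal mult.commute)
qed

text \<open>The midpoint \<open>v / 2\<close> separates the two singularities. On the right half
  \<open>s powr - p\<close> is at most \<open>2 * v powr - p\<close>, and the other factor
  integrates to the power of \<open>v - u\<close>. The left half is met only if
  \<open>u < v / 2\<close>, and then \<open>v - u\<close> is comparable with \<open>v\<close>. The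
  power of \<open>v - u\<close> in the bound is what makes integrals over short cells small.\<close>

lemma nn_integral_powr_beta_le:
  fixes p q u v :: real
  assumes "0 \<le> p" "p < 1" "0 \<le> q" "q < 1" "0 \<le> u" "u < v"
  shows "(\<integral>\<^sup>+s\<in>{u..v}. ennreal (s powr - p * (v - s) powr - q) \<partial>lborel)
    \<le> ennreal ((2 / (1 - q) + 2 / (1 - p)) * v powr - p * (v - u) powr (1 - q))"
proof -
  have near: "s powr - p * (v - s) powr - q \<le> 2 * v powr - p * (v - s) powr - q" if "v / 2 \<le> s" for s
  proof -
    have "s powr - p \<le> (v / 2) powr - p"
      using that assms by (intro powr_mono2') auto
    also have "\<dots> = 2 powr p * v powr - p"
      using assms by (simp add: powr_divide powr_minus field_simps)
    also have "\<dots> \<le> 2 powr 1 * v powr - p"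
      using assms by (intro mult_right_mono powr_mono) auto
    finally show ?thesis by (auto intro!: mult_right_mono)
  qed
  have I1: "(\<integral>\<^sup>+s\<in>{u..v}. ennreal (2 * v powr - p * (v - s) powr - q) \<partial>lborel)
     = ennreal (2 / (1 - q) * v powr - p * (v - u) powr (1 - q))"
  proof -
    have "(\<integral>\<^sup>+s\<in>{u..v}. ennreal (2 * v powr - p * (v - s) powr - q) \<partial>lborel)
      = (\<integral>\<^sup>+s. ennreal (2 * v powr - p) * (ennreal ((v - s) powr - q) * indicator {u..v} s) \<partial>lborel)"
      by (intro nn_integral_cong) (auto simp: ennreal_mult' mult.assoc)
    also have "\<dots> = ennreal (2 * v powr - p) * ennreal ((v - u) powr (1 - q) / (1 - q))"
      using assms by (subst nn_integral_cmult) (auto simp: nn_integral_powr_left)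
    finally show ?thesis using assms by (simp add: ennreal_mult'[symmetric])
  qed
  show ?thesis
  proof (cases "v / 2 \<le> u")
    case True
    have "(\<integral>\<^sup>+s\<in>{u..v}. ennreal (s powr - p * (v - s) powr - q) \<partial>lborel)
      \<le> (\<integral>\<^sup>+s\<in>{u..v}. ennreal (2 * v powr - p * (v - s) powr - q) \<partial>lborel)"
      using True near by (intro nn_integral_mono) (auto simp: indicator_def intro!: ennreal_leI)
    also have "\<dots> \<le> ennreal ((2 / (1 - q) + 2 / (1 - p)) * v powr - p * (v - u) powr (1 - q))"
      unfolding I1 using assms by (intro ennreal_leI mult_right_mono) auto
    finally show ?thesis .
  next
    case False
    have far: "s powr - p * (v - s) powr - q \<le> (v / 2) powr - q * s powr - p" if "s < v / 2" for s
      using that assms by (subst mult.commute) (intro mult_right_mono powr_mono2', auto)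
    have I2: "(\<integral>\<^sup>+s\<in>{0..v}. ennreal ((v / 2) powr - q * s powr - p) \<partial>lborel)
       \<le> ennreal (2 / (1 - p) * v powr - p * (v - u) powr (1 - q))"
    proof -
      have "(\<integral>\<^sup>+s\<in>{0..v}. ennreal ((v / 2) powr - q * s powr - p) \<partial>lborel)
        = (\<integral>\<^sup>+s. ennreal ((v / 2) powr - q) * (ennreal ((s - 0) powr - p) * indicator {0..v} s) \<partial>lborel)"
        by (intro nn_integral_cong) (auto simp: ennreal_mult' mult.assoc)
      also have "\<dots> = ennreal ((v / 2) powr - q) * ennreal ((v - 0) powr (1 - p) / (1 - p))"
        using assms by (subst nn_integral_cmult, measurable) (subst nn_integral_powr_right, auto)
      also have "\<dots> = ennreal ((v / 2) powr - q * (v powr (1 - p) / (1 - p)))"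
        using assms by (simp add: ennreal_mult'[symmetric])
      \<comment> \<open>A factor \<open>v = 2 * (v / 2)\<close> passes from one power to the other;
        afterwards \<open>v / 2\<close> may be enlarged to \<open>v - u\<close> because
        \<open>u < v / 2\<close>.\<close>
      also have "(v / 2) powr - q * (v powr (1 - p) / (1 - p)) = 2 / (1 - p) * v powr - p * (v / 2) powr (1 - q)"
        using assms by (simp add: powr_diff powr_minus powr_divide field_simps)
      also have "ennreal \<dots> \<le> ennreal (2 / (1 - p) * v powr - p * (v - u) powr (1 - q))"
        using assms False by (intro ennreal_leI mult_left_mono powr_mono2) auto
      finally show ?thesis .
    qed
    have "(\<integral>\<^sup>+s\<in>{u..v}. ennreal (s powr - p * (v - s) powr - q) \<partial>lborel)
      \<le> (\<integral>\<^sup>+s. (ennreal (2 * v powr - p * (v - s) powr - q) * indicator {u..v} s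
               + ennreal ((v / 2) powr - q * s powr - p) * indicator {0..v} s) \<partial>lborel)"
    proof (intro nn_integral_mono)
      fix s
      show "ennreal (s powr - p * (v - s) powr - q) * indicator {u..v} s
        \<le> ennreal (2 * v powr - p * (v - s) powr - q) * indicator {u..v} s
               + ennreal ((v / 2) powr - q * s powr - p) * indicator {0..v} s"
      proof (cases "s \<in> {u..v}")
        case s: True
        show ?thesis
        proof (cases "v / 2 \<le> s")
          case True
          then show ?thesis using s assms near[of s]
            by (auto intro!: add_increasing2 ennreal_leI)
        next
          case False
          then show ?thesis using s assms far[of s]
            by (auto intro!: add_increasing ennreal_leI)
        qed
      qed auto
    qed
    also have "\<dots> = (\<integral>\<^sup>+s\<in>{u..v}. ennreal (2 * v powr - p * (v - s) powr - q) \<partial>lborel)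
       + (\<integral>\<^sup>+s\<in>{0..v}. ennreal ((v / 2) powr - q * s powr - p) \<partial>lborel)"
      by (rule nn_integral_add) auto
    also have "\<dots> \<le> ennreal (2 / (1 - q) * v powr - p * (v - u) powr (1 - q))
        + ennreal (2 / (1 - p) * v powr - p * (v - u) powr (1 - q))"
      unfolding I1 by (rule add_left_mono) (rule I2)
    also have "\<dots> = ennreal ((2 / (1 - q) + 2 / (1 - p)) * v powr - p * (v - u) powr (1 - q))"
      using assms by (subst ennreal_plus[symmetric]) (auto simp: algebra_simps)
    finally show ?thesis .
  qed
qed

text \<open>Minkowski's integral inequality; the majorant \<open>D\<close> allows a proof by Cauchy--Schwarz with weight \<open>w / D\<close>.\<close>

lemma nn_integral_Minkowski_envelope:
  fixes f :: "'a \<Rightarrow> 'b \<Rightarrow> real" and w D :: "'b \<Rightarrow> real"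
  assumes "sigma_finite_measure M" "sigma_finite_measure N"
    and f[measurable]: "case_prod f \<in> borel_measurable (M \<Otimes>\<^sub>M N)"
    and w[measurable]: "w \<in> borel_measurable N" and D[measurable]: "D \<in> borel_measurable N"
    and nonneg: "\<And>s r. 0 \<le> f s r" "\<And>r. 0 \<le> w r"
    and le: "\<And>r. r \<in> space N \<Longrightarrow> w r \<noteq> 0 \<Longrightarrow> 0 < D r \<and> (\<integral>\<^sup>+s. ennreal ((f s r)\<^sup>2) \<partial>M) \<le> ennreal ((D r)\<^sup>2)"
  shows "(\<integral>\<^sup>+s. (\<integral>\<^sup>+r. ennreal (w r * f s r) \<partial>N)\<^sup>2 \<partial>M) \<le> (\<integral>\<^sup>+r. ennreal (w r * D r) \<partial>N)\<^sup>2"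
proof -
  interpret M: sigma_finite_measure M by fact
  interpret N: sigma_finite_measure N by fact
  interpret pair_sigma_finite M N ..
  define I where "I = (\<integral>\<^sup>+r. ennreal (w r * D r) \<partial>N)"
  have "(\<integral>\<^sup>+r. ennreal (w r * f s r) \<partial>N)\<^sup>2 \<le> I * (\<integral>\<^sup>+r. ennreal (w r / D r * (f s r)\<^sup>2) \<partial>N)"
    if s: "s \<in> space M" for s
  proof -
    have [measurable]: "f s \<in> borel_measurable N"
      using measurable_Pair2[OF f s] by simp
    have "(\<integral>\<^sup>+r. ennreal (w r * f s r) \<partial>N)
       = (\<integral>\<^sup>+r. ennreal (sqrt (w r * D r)) * ennreal (sqrt (w r / D r) * f s r) \<partial>N)"
    proof (intro nn_integral_cong)
      fix r assume r: "r \<in> space N"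
      show "ennreal (w r * f s r) = ennreal (sqrt (w r * D r)) * ennreal (sqrt (w r / D r) * f s r)"
      proof (cases "w r = 0")
        case False
        then have "D r > 0" "w r > 0" using le[OF r] nonneg(2)[of r] by auto
        then have "sqrt (w r * D r) * sqrt (w r / D r) = w r"
          by (simp add: real_sqrt_mult real_sqrt_divide)
        then show ?thesis using nonneg \<open>D r > 0\<close>
          by (subst ennreal_mult[symmetric]) (auto simp: mult.assoc[symmetric])
      qed simp
    qed
    also have "(\<dots>)\<^sup>2 \<le> (\<integral>\<^sup>+r. (ennreal (sqrt (w r * D r)))\<^sup>2 \<partial>N) * (\<integral>\<^sup>+r. (ennreal (sqrt (w r / D r) * f s r))\<^sup>2 \<partial>N)"
      by (rule Cauchy_Schwarz_nn_integral) auto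
    also have "(\<integral>\<^sup>+r. (ennreal (sqrt (w r * D r)))\<^sup>2 \<partial>N) = I"
      unfolding I_def
    proof (intro nn_integral_cong)
      fix r assume r: "r \<in> space N"
      have "0 \<le> w r * D r" using le[OF r] nonneg(2)[of r] by (cases "w r = 0") auto
      then show "(ennreal (sqrt (w r * D r)))\<^sup>2 = ennreal (w r * D r)"
        by (simp add: ennreal_power)
    qed
    also have "(\<integral>\<^sup>+r. (ennreal (sqrt (w r / D r) * f s r))\<^sup>2 \<partial>N) = (\<integral>\<^sup>+r. ennreal (w r / D r * (f s r)\<^sup>2) \<partial>N)"
    proof (intro nn_integral_cong)
      fix r assume r: "r \<in> space N"
      have "0 \<le> w r / D r" using le[OF r] nonneg(2)[of r] by (cases "w r = 0") auto
      then show "(ennreal (sqrt (w r / D r) * f s r))\<^sup>2 = ennreal (w r / D r * (f s r)\<^sup>2)"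
        using nonneg by (simp add: ennreal_power power_mult_distrib)
    qed
    finally show ?thesis .
  qed
  then have "(\<integral>\<^sup>+s. (\<integral>\<^sup>+r. ennreal (w r * f s r) \<partial>N)\<^sup>2 \<partial>M)
      \<le> (\<integral>\<^sup>+s. I * (\<integral>\<^sup>+r. ennreal (w r / D r * (f s r)\<^sup>2) \<partial>N) \<partial>M)"
    by (intro nn_integral_mono) auto
  also have "\<dots> = I * (\<integral>\<^sup>+s. (\<integral>\<^sup>+r. ennreal (w r / D r * (f s r)\<^sup>2) \<partial>N) \<partial>M)"
    by (intro nn_integral_cmult) measurable
  also have "(\<integral>\<^sup>+s. (\<integral>\<^sup>+r. ennreal (w r / D r * (f s r)\<^sup>2) \<partial>N) \<partial>M)
      = (\<integral>\<^sup>+r. (\<integral>\<^sup>+s. ennreal (w r / D r * (f s r)\<^sup>2) \<partial>M) \<partial>N)"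
    by (rule Fubini'[symmetric]) measurable
  also have "\<dots> \<le> I"
    unfolding I_def
  proof (intro nn_integral_mono)
    fix r assume r: "r \<in> space N"
    have [measurable]: "(\<lambda>s. f s r) \<in> borel_measurable M"
      using measurable_Pair1[OF f r] by simp
    show "(\<integral>\<^sup>+s. ennreal (w r / D r * (f s r)\<^sup>2) \<partial>M) \<le> ennreal (w r * D r)"
    proof (cases "w r = 0")
      case False
      then have Dr: "D r > 0" "w r > 0" and le': "(\<integral>\<^sup>+s. ennreal ((f s r)\<^sup>2) \<partial>M) \<le> ennreal ((D r)\<^sup>2)"
        using le[OF r] nonneg(2)[of r] by auto
      have "(\<integral>\<^sup>+s. ennreal (w r / D r * (f s r)\<^sup>2) \<partial>M) = ennreal (w r / D r) * (\<integral>\<^sup>+s. ennreal ((f s r)\<^sup>2) \<partial>M)"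
        using Dr by (subst nn_integral_cmult[symmetric]) (auto simp: ennreal_mult'[symmetric])
      also have "\<dots> \<le> ennreal (w r / D r) * ennreal ((D r)\<^sup>2)"
        by (rule mult_left_mono[OF le']) simp
      also have "\<dots> = ennreal (w r * D r)"
        using Dr by (simp add: ennreal_mult'[symmetric] power2_eq_square)
      finally show ?thesis .
    qed simp
  qed
  finally show ?thesis
    unfolding I_def power2_eq_square by (meson mult_left_mono zero_le)
qed

lemma integrable_indicator_bounded:
  fixes g :: "real \<Rightarrow> real"
  assumes [measurable]: "g \<in> borel_measurable borel" and g: "\<And>r. r \<in> {a..b} \<Longrightarrow> \<bar>g r\<bar> \<le> c"
  shows "integrable lborel (\<lambda>r. indicator {a..b} r * g r)"
proof (rule Bochner_Integration.integrable_bound)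
  show "integrable lborel (\<lambda>r. c * indicator {a..b} r :: real)"
    by (intro integrable_mult_right integrable_real_indicator) (auto simp: emeasure_lborel_Icc_eq)
  show "AE r in lborel. norm (indicator {a..b} r * g r) \<le> norm (c * indicator {a..b} r)"
    using g by (intro AE_I2) (fastforce simp: indicator_def)
qed measurable

section \<open>Singular Volterra kernels\<close>

lemma powr_square: "(x powr a)\<^sup>2 = x powr (2 * a)" for x a :: real
  unfolding power2_eq_square powr_add[symmetric] by simp

section \<open>Partitions and step functions\<close>

locale interval_partition =
  fixes T :: real and p :: "nat \<Rightarrow> real" and n :: nat
  assumes p_0: "p 0 = 0" and p_n: "p n = T" and p_less: "\<And>i. i < n \<Longrightarrow> p i < p (Suc i)"
begin

lemma p_mono: "i \<le> j \<Longrightarrow> j \<le> n \<Longrightarrow> p i \<le> p j"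
proof (induction j)
  case (Suc j)
  then show ?case using p_less[of j] by (cases "i = Suc j") auto
qed auto

lemma p_range: "i \<le> n \<Longrightarrow> 0 \<le> p i \<and> p i \<le> T"
  using p_mono[of 0 i] p_mono[of i n] p_0 p_n by auto

lemma cell_exists:
  assumes "0 \<le> t" "t < T"
  obtains i where "i < n" "p i \<le> t" "t < p (Suc i)"
proof -
  define j where "j = (LEAST j. t < p j)"
  have j: "t < p j" unfolding j_def by (rule LeastI[of _ n]) (simp add: p_n assms)
  have jn: "j \<le> n" unfolding j_def by (rule Least_le) (simp add: p_n assms)
  have "j \<noteq> 0" using j assms p_0 by (metis not_less)
  then obtain i where i: "j = Suc i" by (cases j) auto
  have "\<not> t < p i" using not_less_Least[of i "\<lambda>j. t < p j"] i unfolding j_def by auto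
  then show ?thesis using that[of i] i j jn by auto
qed

lemma cell_disjoint:
  assumes "i < n" "j < n" "i \<noteq> j" "p i \<le> t" "t < p (Suc i)"
  shows "t \<notin> {p j..<p (Suc j)}"
  using assms p_mono[of "Suc i" j] p_mono[of "Suc j" i] by (cases "i < j") auto

text \<open>With half-open cells \<open>step f\<close> is 0 at \<open>T\<close> rather than a value
  of \<open>f\<close>; estimates of increments therefore leave out the single point
  \<open>T\<close>.\<close>

definition step :: "(real \<Rightarrow> 'e::real_vector) \<Rightarrow> real \<Rightarrow> 'e" where
  "step f r = (\<Sum>i<n. indicator {p i..<p (Suc i)} r *\<^sub>R f (p i))"

lemma step_cell:
  assumes "i < n" "p i \<le> r" "r < p (Suc i)"
  shows "step f r = f (p i)"
proof -
  have "step f r = (\<Sum>j<n. if j = i then f (p i) else 0)"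
    unfolding step_def using assms cell_disjoint[OF assms(1) _ _ assms(2,3)]
    by (intro sum.cong) (auto simp: indicator_def)
  then show ?thesis using assms(1) by simp
qed

end

text \<open>
  \<open>k\<close> plays the role of \<open>\<partial>K(r, s)/\<partial>r\<close>. The assumption \<open>0 < \<alpha>\<close> (harmless, since the bounds
  persist for larger exponents) avoids logarithms, and \<open>\<theta>\<close> is a common Hoelder exponent for
  all paths.
\<close>

locale singular_kernel =
  fixes T \<alpha> C \<theta> :: real and K k :: "real \<Rightarrow> real \<Rightarrow> real"
  assumes T_pos: "0 < T" and alpha: "0 < \<alpha>" "\<alpha> < 1/4" and C_pos: "0 < C"
    and theta: "\<alpha> < \<theta>" "\<theta> < 1/2 - \<alpha>"
    and K_borel: "case_prod K \<in> borel_measurable borel"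
    and k_borel: "case_prod k \<in> borel_measurable borel"
    and K_eq_0: "\<And>t s. \<not> (0 < s \<and> s < t \<and> t \<le> T) \<Longrightarrow> K t s = 0"
    and k_eq_0: "\<And>t s. \<not> (0 < s \<and> s < t \<and> t \<le> T) \<Longrightarrow> k t s = 0"
    and K_le: "\<And>t s. 0 < s \<Longrightarrow> s < t \<Longrightarrow> t \<le> T \<Longrightarrow> \<bar>K t s\<bar> \<le> C * s powr - \<alpha> * (t - s) powr - \<alpha>"
    and k_le: "\<And>t s. 0 < s \<Longrightarrow> s < t \<Longrightarrow> t \<le> T \<Longrightarrow> \<bar>k t s\<bar> \<le> C * (t - s) powr (- \<alpha> - 1)"
    and K_diff_eq: "\<And>a b s. 0 < s \<Longrightarrow> s < a \<Longrightarrow> a \<le> b \<Longrightarrow> b \<le> T \<Longrightarrow>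
        (\<integral>r. indicator {a..b} r * k r s \<partial>lborel) = K b s - K a s"
begin

lemma K_measurable[measurable (raw)]:
  "f \<in> borel_measurable M \<Longrightarrow> g \<in> borel_measurable M \<Longrightarrow> (\<lambda>x. K (f x) (g x)) \<in> borel_measurable M"
  using measurable_compose[OF _ K_borel, of "\<lambda>x. (f x, g x)" M] by simp

lemma k_measurable[measurable (raw)]:
  "f \<in> borel_measurable M \<Longrightarrow> g \<in> borel_measurable M \<Longrightarrow> (\<lambda>x. k (f x) (g x)) \<in> borel_measurable M"
  using measurable_compose[OF _ k_borel, of "\<lambda>x. (f x, g x)" M] by simp

lemma k_ind_integrable:
  assumes "t < a"
  shows "integrable lborel (\<lambda>r. indicator {a..b} r * k r t)"
proof (rule integrable_indicator_bounded)
  fix r assume r: "r \<in> {a..b}"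
  show "\<bar>k r t\<bar> \<le> C * (a - t) powr (- \<alpha> - 1)"
  proof (cases "0 < t \<and> r \<le> T")
    case True
    then have "\<bar>k r t\<bar> \<le> C * (r - t) powr (- \<alpha> - 1)" using r assms by (intro k_le) auto
    also have "\<dots> \<le> C * (a - t) powr (- \<alpha> - 1)"
      using r assms C_pos alpha by (intro mult_left_mono powr_mono2') auto
    finally show ?thesis .
  qed (use k_eq_0[of t r] C_pos in auto)
qed measurable

text \<open>The exponent \<open>- \<alpha> - 1\<close> is split as
  \<open>(- \<alpha> - \<theta>) - (1 - \<theta>)\<close>. The first power is largest at
  \<open>r = a\<close>; in the second, \<open>r - s\<close> is decreased to \<open>r - a\<close>,
  whose power integrates to \<open>(b - a) powr \<theta> / \<theta>\<close>. A stronger singularity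
  in \<open>a - s\<close> is thus traded for a Hoelder rate in \<open>b - a\<close>.\<close>

lemma nn_integral_k_increment:
  assumes "s < a" "a \<le> b"
  shows "(\<integral>\<^sup>+r\<in>{a..b}. ennreal \<bar>k r s\<bar> \<partial>lborel) \<le> ennreal (C / \<theta> * (a - s) powr (- \<alpha> - \<theta>) * (b - a) powr \<theta>)"
proof -
  have "(\<integral>\<^sup>+r\<in>{a..b}. ennreal \<bar>k r s\<bar> \<partial>lborel)
     \<le> (\<integral>\<^sup>+r. ennreal (C * (a - s) powr (- \<alpha> - \<theta>)) * (ennreal ((r - a) powr - (1 - \<theta>)) * indicator {a..b} r) \<partial>lborel)"
  proof (rule nn_integral_mono_AE)
    show "AE r in lborel. ennreal \<bar>k r s\<bar> * indicator {a..b} r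
       \<le> ennreal (C * (a - s) powr (- \<alpha> - \<theta>)) * (ennreal ((r - a) powr - (1 - \<theta>)) * indicator {a..b} r)"
      using AE_lborel_singleton[of a]
    proof eventually_elim
      fix r assume "r \<noteq> a"
      show "ennreal \<bar>k r s\<bar> * indicator {a..b} r
       \<le> ennreal (C * (a - s) powr (- \<alpha> - \<theta>)) * (ennreal ((r - a) powr - (1 - \<theta>)) * indicator {a..b} r)"
      proof (cases "r \<in> {a..b} \<and> 0 < s \<and> s < r \<and> r \<le> T")
        case True
        then have "\<bar>k r s\<bar> \<le> C * (r - s) powr (- \<alpha> - 1)" by (intro k_le) auto
        also have "(r - s) powr (- \<alpha> - 1) = (r - s) powr (- \<alpha> - \<theta>) * (r - s) powr - (1 - \<theta>)"
          by (simp add: powr_add[symmetric])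
        also have "C * \<dots> \<le> C * ((a - s) powr (- \<alpha> - \<theta>) * (r - a) powr - (1 - \<theta>))"
          using True assms C_pos alpha theta \<open>r \<noteq> a\<close> by (intro mult_left_mono mult_mono powr_mono2') auto
        finally show ?thesis using True C_pos
          by (auto simp: ennreal_mult'[symmetric] mult.assoc intro!: ennreal_leI)
      qed (use k_eq_0[of s r] in \<open>auto simp: indicator_def\<close>)
    qed
  qed
  also have "\<dots> = ennreal (C * (a - s) powr (- \<alpha> - \<theta>)) * ennreal ((b - a) powr (1 - (1 - \<theta>)) / (1 - (1 - \<theta>)))"
    using assms theta alpha by (subst nn_integral_cmult) (auto simp: nn_integral_powr_right simp del: minus_diff_eq)
  also have "\<dots> = ennreal (C / \<theta> * (a - s) powr (- \<alpha> - \<theta>) * (b - a) powr \<theta>)"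
    using C_pos theta alpha by (simp add: ennreal_mult'[symmetric])
  finally show ?thesis .
qed

lemma nn_integral_k_tail:
  assumes "t < b" "b \<le> T"
  shows "(\<integral>\<^sup>+r\<in>{b..T}. ennreal \<bar>k r t\<bar> \<partial>lborel) \<le> ennreal (C / \<alpha> * (b - t) powr - \<alpha>)"
proof -
  have "(\<integral>\<^sup>+r\<in>{b..T}. ennreal \<bar>k r t\<bar> \<partial>lborel)
     \<le> (\<integral>\<^sup>+r. ennreal C * (ennreal ((r - t) powr (- \<alpha> - 1)) * indicator {b..T} r) \<partial>lborel)"
  proof (rule nn_integral_mono)
    fix r
    show "ennreal \<bar>k r t\<bar> * indicator {b..T} r \<le> ennreal C * (ennreal ((r - t) powr (- \<alpha> - 1)) * indicator {b..T} r)"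
      using k_le[of t r] k_eq_0[of t r] assms C_pos
      by (cases "0 < t") (auto simp: indicator_def ennreal_mult'[symmetric] intro!: ennreal_leI)
  qed
  also have "\<dots> = ennreal C * (\<integral>\<^sup>+r\<in>{b..T}. ennreal ((r - t) powr (- \<alpha> - 1)) \<partial>lborel)"
    by (rule nn_integral_cmult) measurable
  also have "\<dots> \<le> ennreal C * ennreal ((b - t) powr - \<alpha> / \<alpha>)"
    using assms alpha by (intro mult_left_mono nn_integral_powr_tail) auto
  also have "\<dots> = ennreal (C / \<alpha> * (b - t) powr - \<alpha>)"
    using C_pos alpha by (simp add: ennreal_mult'[symmetric])
  finally show ?thesis .
qed

text \<open>The singularity left after multiplication is
  \<open>(r - t) powr (- \<alpha> - 1 + \<eta>)\<close>, which is integrable at the diagonal because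
  \<open>\<eta> > \<alpha>\<close>. This is the origin of the condition that the Hoelder exponent
  exceed \<open>\<alpha>\<close>. The bound is uniform in \<open>t\<close>.\<close>

lemma nn_integral_k_diagonal:
  assumes "\<alpha> < \<eta>" "0 \<le> t"
  shows "(\<integral>\<^sup>+r. ennreal (\<bar>k r t\<bar> * (r - t) powr \<eta>) \<partial>lborel) \<le> ennreal (C * T powr (\<eta> - \<alpha>) / (\<eta> - \<alpha>))"
proof (cases "t \<le> T")
  case True
  have "(\<integral>\<^sup>+r. ennreal (\<bar>k r t\<bar> * (r - t) powr \<eta>) \<partial>lborel)
     \<le> (\<integral>\<^sup>+r. ennreal C * (ennreal ((r - t) powr - (1 + \<alpha> - \<eta>)) * indicator {t..T} r) \<partial>lborel)"
  proof (rule nn_integral_mono)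
    fix r
    show "ennreal (\<bar>k r t\<bar> * (r - t) powr \<eta>) \<le> ennreal C * (ennreal ((r - t) powr - (1 + \<alpha> - \<eta>)) * indicator {t..T} r)"
    proof (cases "0 < t \<and> t < r \<and> r \<le> T")
      case True
      then have "\<bar>k r t\<bar> * (r - t) powr \<eta> \<le> C * (r - t) powr (- \<alpha> - 1) * (r - t) powr \<eta>"
        by (intro mult_right_mono k_le) auto
      also have "\<dots> = C * (r - t) powr - (1 + \<alpha> - \<eta>)"
        by (simp add: mult.assoc powr_add[symmetric] algebra_simps)
      finally show ?thesis using True C_pos by (auto simp: ennreal_mult'[symmetric] intro!: ennreal_leI)
    qed (use k_eq_0[of t r] in auto)
  qed
  also have "\<dots> = ennreal C * ennreal ((T - t) powr (1 - (1 + \<alpha> - \<eta>)) / (1 - (1 + \<alpha> - \<eta>)))"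
    using assms True by (subst nn_integral_cmult) (auto simp: nn_integral_powr_right simp del: minus_diff_eq)
  also have "\<dots> = ennreal (C * ((T - t) powr (\<eta> - \<alpha>) / (\<eta> - \<alpha>)))"
    using C_pos by (simp add: ennreal_mult'[symmetric])
  also have "\<dots> \<le> ennreal (C * (T powr (\<eta> - \<alpha>) / (\<eta> - \<alpha>)))"
    using C_pos assms True by (intro ennreal_leI mult_left_mono divide_right_mono powr_mono2) auto
  finally show ?thesis by simp
next
  case False
  then have "k r t = 0" for r using k_eq_0[of t r] by auto
  then show ?thesis by simp
qed

lemma K_increment_le:
  assumes "0 < s" "s < a" "a \<le> b" "b \<le> T"
  shows "\<bar>K b s - K a s\<bar> \<le> C / \<theta> * (a - s) powr (- \<alpha> - \<theta>) * (b - a) powr \<theta>"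
proof -
  have "ennreal \<bar>K b s - K a s\<bar> = ennreal (norm (\<integral>r. indicator {a..b} r * k r s \<partial>lborel))"
    using K_diff_eq[OF assms] by simp
  also have "\<dots> \<le> (\<integral>\<^sup>+r. ennreal (norm (indicator {a..b} r * k r s)) \<partial>lborel)"
    by (rule integral_norm_bound_ennreal[OF k_ind_integrable[OF assms(2)]])
  also have "\<dots> = (\<integral>\<^sup>+r\<in>{a..b}. ennreal \<bar>k r s\<bar> \<partial>lborel)"
    by (intro nn_integral_cong) (auto simp: indicator_def)
  also have "\<dots> \<le> ennreal (C / \<theta> * (a - s) powr (- \<alpha> - \<theta>) * (b - a) powr \<theta>)"
    by (rule nn_integral_k_increment) (use assms in auto)
  finally show ?thesis using C_pos theta alpha by (subst (asm) ennreal_le_iff) auto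
qed

lemma nn_integral_K_square:
  assumes "0 \<le> u" "u < v" "v \<le> T"
  shows "(\<integral>\<^sup>+t\<in>{u..v}. ennreal ((K v t)\<^sup>2) \<partial>lborel)
    \<le> ennreal (C\<^sup>2 * ((2 / (1 - 2 * \<alpha>) + 2 / (1 - 2 * \<alpha>)) * v powr - (2 * \<alpha>) * (v - u) powr (1 - 2 * \<alpha>)))"
proof -
  have "(\<integral>\<^sup>+t\<in>{u..v}. ennreal ((K v t)\<^sup>2) \<partial>lborel)
    \<le> (\<integral>\<^sup>+t. ennreal (C\<^sup>2) * (ennreal (t powr - (2 * \<alpha>) * (v - t) powr - (2 * \<alpha>)) * indicator {u..v} t) \<partial>lborel)"
  proof (rule nn_integral_mono)
    fix t
    show "ennreal ((K v t)\<^sup>2) * indicator {u..v} t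
      \<le> ennreal (C\<^sup>2) * (ennreal (t powr - (2 * \<alpha>) * (v - t) powr - (2 * \<alpha>)) * indicator {u..v} t)"
    proof (cases "t \<in> {u..v} \<and> 0 < t \<and> t < v")
      case True
      then have "\<bar>K v t\<bar>\<^sup>2 \<le> (C * t powr - \<alpha> * (v - t) powr - \<alpha>)\<^sup>2"
        using assms by (intro power_mono K_le) auto
      also have "\<dots> = C\<^sup>2 * (t powr - (2 * \<alpha>) * (v - t) powr - (2 * \<alpha>))"
        by (simp add: power_mult_distrib powr_square)
      finally show ?thesis using True by (auto simp: ennreal_mult'[symmetric] intro!: ennreal_leI)
    qed (use K_eq_0[of t v] in \<open>auto simp: indicator_def\<close>)
  qed
  also have "\<dots> = ennreal (C\<^sup>2) * (\<integral>\<^sup>+t\<in>{u..v}. ennreal (t powr - (2 * \<alpha>) * (v - t) powr - (2 * \<alpha>)) \<partial>lborel)"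
    by (rule nn_integral_cmult) measurable
  also have "\<dots> \<le> ennreal (C\<^sup>2) * ennreal ((2 / (1 - 2 * \<alpha>) + 2 / (1 - 2 * \<alpha>)) * v powr - (2 * \<alpha>) * (v - u) powr (1 - 2 * \<alpha>))"
    using assms alpha by (intro mult_left_mono nn_integral_powr_beta_le) auto
  finally show ?thesis by (simp add: ennreal_mult'[symmetric])
qed

text \<open>This is \<open>K*(1\<^bsub>[0,v)\<^esub> f)\<close> at \<open>t\<close>; it vanishes for \<open>t \<ge> v\<close>.\<close>

definition Kstar :: "real \<Rightarrow> (real \<Rightarrow> 'e::euclidean_space) \<Rightarrow> real \<Rightarrow> 'e" where
  "Kstar v f t = K v t *\<^sub>R f t + (\<integral>r. (indicator {..v} r * k r t) *\<^sub>R (f r - f t) \<partial>lborel)"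

text \<open>For \<open>t\<close> to the left of the interval this is the fundamental theorem on the
  part of the interval below \<open>v\<close>. For \<open>t\<close> inside, with
  \<open>b \<le> v\<close>, the integrand is minus \<open>k\<close> on the range from
  \<open>b\<close> to \<open>v\<close>, and subtracting \<open>K v t - K b t\<close> from
  \<open>K v t\<close> leaves \<open>K b t\<close>. In the remaining positions the integral vanishes
  and at most the boundary term is left.\<close>

lemma indicator_transform:
  assumes "0 \<le> a" "a < b" "b \<le> T" "v \<le> T"
  shows "integrable lborel (\<lambda>r. indicator {..v} r * k r t * (indicator {a..<b} r - indicator {a..<b} t))" (is ?int)
    and "K v t * indicator {a..<b} t + (\<integral>r. indicator {..v} r * k r t * (indicator {a..<b} r - indicator {a..<b} t) \<partial>lborel)
       = K (min v b) t - K (min v a) t" (is ?eq)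
proof -
  have "?int \<and> ?eq"
  proof (cases "0 < t")
    case False
    then have "k r t = 0" "K r t = 0" for r using k_eq_0[of t r] K_eq_0[of t r] by auto
    then show ?thesis by simp
  next
    case t: True
    consider "t < a" "v < a" | "t < a" "a \<le> v" | "a \<le> t" "t < b" "v < b" | "a \<le> t" "t < b" "b \<le> v" | "b \<le> t"
      by linarith
    then show ?thesis
    proof cases
      case 1
      then have z: "(\<lambda>r. indicator {..v} r * k r t * (indicator {a..<b} r - indicator {a..<b} t)) = (\<lambda>_. 0)"
        by (auto simp: indicator_def)
      show ?thesis unfolding z using 1 assms by simp
    next
      case 2
      have eq: "AE r in lborel. indicator {..v} r * k r t * (indicator {a..<b} r - indicator {a..<b} t)
        = indicator {a..min v b} r * k r t"
        using AE_lborel_singleton[of b] by eventually_elim (use 2 in \<open>auto simp: indicator_def\<close>)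
      have int: "integrable lborel (\<lambda>r. indicator {a..min v b} r * k r t)"
        using k_ind_integrable 2 by auto
      have eq': "AE r in lborel. indicator {a..min v b} r * k r t
        = indicator {..v} r * k r t * (indicator {a..<b} r - indicator {a..<b} t)"
        using eq by eventually_elim (rule sym)
      have ?int by (rule integrable_cong_AE_imp[OF int _ eq']) measurable
      moreover have "(\<integral>r. indicator {..v} r * k r t * (indicator {a..<b} r - indicator {a..<b} t) \<partial>lborel)
        = (\<integral>r. indicator {a..min v b} r * k r t \<partial>lborel)"
        using eq by (intro integral_cong_AE) auto
      ultimately show ?thesis
        using 2 assms t by (subst (asm) K_diff_eq) (auto simp: min_absorb2)
    next
      case 3
      then have z: "(\<lambda>r. indicator {..v} r * k r t * (indicator {a..<b} r - indicator {a..<b} t)) = (\<lambda>_. 0)"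
        using k_eq_0[of t] by (auto simp: indicator_def fun_eq_iff)
      have "K (min v a) t = 0" using 3 by (intro K_eq_0) auto
      then show ?thesis unfolding z using 3 by (simp add: min_def)
    next
      case 4
      then have eq: "indicator {..v} r * k r t * (indicator {a..<b} r - indicator {a..<b} t)
        = - (indicator {b..v} r * k r t)" for r
        using k_eq_0[of t r] by (cases "t < r") (auto simp: indicator_def)
      have "K (min v a) t = 0" using 4 by (intro K_eq_0) auto
      then show ?thesis unfolding eq using k_ind_integrable[of t b v] K_diff_eq[of t b v] 4 t assms
        by (auto simp: min_def)
    next
      case 5
      then have z: "(\<lambda>r. indicator {..v} r * k r t * (indicator {a..<b} r - indicator {a..<b} t)) = (\<lambda>_. 0)"
        using k_eq_0[of t] assms by (auto simp: indicator_def fun_eq_iff)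
      have "K (min v b) t = 0" "K (min v a) t = 0" using 5 assms by (auto intro!: K_eq_0)
      then show ?thesis unfolding z using 5 assms by simp
    qed
  qed
  then show ?int ?eq by auto
qed

end

locale kernel_partition = singular_kernel T \<alpha> C \<theta> K k + interval_partition T p n
  for T \<alpha> C \<theta> K k p n
begin

text \<open>This is the left-point Riemann-Stieltjes sum of \<open>f\<close> against
  \<open>K _ t\<close>, with the partition stopped at \<open>v\<close>: cells beyond
  \<open>v\<close> get coefficient 0.\<close>

definition step_sum :: "real \<Rightarrow> (real \<Rightarrow> 'e::real_vector) \<Rightarrow> real \<Rightarrow> 'e" where
  "step_sum v f t = (\<Sum>i<n. (K (min v (p (Suc i))) t - K (min v (p i)) t) *\<^sub>R f (p i))"

lemma step_transform:
  fixes f :: "real \<Rightarrow> 'e::euclidean_space"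
  assumes "v \<le> T"
  shows "integrable lborel (\<lambda>r. (indicator {..v} r * k r t) *\<^sub>R (step f r - step f t))"
    and "Kstar v (step f) t = step_sum v f t"
proof -
  define c where "c i r = indicator {..v} r * k r t * (indicator {p i..<p (Suc i)} r - indicator {p i..<p (Suc i)} t :: real)" for i r
  have tr: "integrable lborel (c i)"
     "K v t * indicator {p i..<p (Suc i)} t + integral\<^sup>L lborel (c i) = K (min v (p (Suc i))) t - K (min v (p i)) t"
    if "i < n" for i
    unfolding c_def using indicator_transform[of "p i" "p (Suc i)" v t] p_range[of i] p_range[of "Suc i"] p_less[OF that] that assms
    by auto
  have eq: "(indicator {..v} r * k r t) *\<^sub>R (step f r - step f t) = (\<Sum>i<n. c i r *\<^sub>R f (p i))" for r
    unfolding step_def c_def sum_subtractf[symmetric] scaleR_sum_right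
    by (intro sum.cong) (auto simp: algebra_simps)
  show "integrable lborel (\<lambda>r. (indicator {..v} r * k r t) *\<^sub>R (step f r - step f t))"
    unfolding eq using tr(1) by auto
  have "Kstar v (step f) t = K v t *\<^sub>R step f t + (\<Sum>i<n. integral\<^sup>L lborel (c i) *\<^sub>R f (p i))"
    unfolding Kstar_def eq using tr(1) by (subst Bochner_Integration.integral_sum) auto
  also have "\<dots> = (\<Sum>i<n. (K v t * indicator {p i..<p (Suc i)} t + integral\<^sup>L lborel (c i)) *\<^sub>R f (p i))"
    unfolding step_def scaleR_sum_right by (simp add: sum.distrib scaleR_add_left)
  also have "\<dots> = step_sum v f t"
    unfolding step_sum_def using tr(2) by (intro sum.cong) auto
  finally show "Kstar v (step f) t = step_sum v f t" .
qed

end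

section \<open>Step approximations of Hoelder families\<close>

lemma ennreal_add_square_le: "(x + y)\<^sup>2 \<le> 2 * x\<^sup>2 + 2 * y\<^sup>2" for x y :: ennreal
proof (cases x; cases y)
  fix a b assume ab: "x = ennreal a" "0 \<le> a" "y = ennreal b" "0 \<le> b"
  have "(x + y)\<^sup>2 = ennreal ((a + b)\<^sup>2)" using ab by (simp add: ennreal_power flip: ennreal_plus)
  also have "\<dots> \<le> ennreal (2 * a\<^sup>2 + 2 * b\<^sup>2)"
    using sum_squares_bound[of a b] by (intro ennreal_leI) (simp add: power2_sum)
  also have "\<dots> = 2 * x\<^sup>2 + 2 * y\<^sup>2" using ab by (simp add: ennreal_power ennreal_mult')
  finally show ?thesis .
qed (auto simp: power2_eq_square ennreal_mult_top ennreal_top_mult)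

lemma square_sum_le: "(x + y)\<^sup>2 \<le> 2 * x\<^sup>2 + 2 * y\<^sup>2" for x y :: real
  using sum_squares_bound[of x y] by (simp add: power2_sum)

lemma norm_diff_square_le: "(norm (x - y))\<^sup>2 \<le> 2 * (norm x)\<^sup>2 + 2 * (norm y)\<^sup>2"
proof -
  have "(norm (x - y))\<^sup>2 \<le> (norm x + norm y)\<^sup>2"
    by (intro power_mono norm_triangle_ineq4) auto
  also have "\<dots> \<le> 2 * (norm x)\<^sup>2 + 2 * (norm y)\<^sup>2" by (rule square_sum_le)
  finally show ?thesis .
qed

text \<open>By the mean value theorem the right-hand side is \<open>(b - a) * z powr - q\<close> for
  some \<open>z < b\<close>, and the power is decreasing. The purpose is to replace cell lengths,
  weighted at the right end of the cell, by a telescoping sum whose total does not depend on the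
  partition. The case \<open>a = 0\<close> is separate because the power need not be differentiable
  there.\<close>

lemma powr_mult_diff_le:
  fixes a b q :: real
  assumes "0 \<le> a" "a < b" "0 \<le> q" "q < 1"
  shows "b powr - q * (b - a) \<le> (b powr (1 - q) - a powr (1 - q)) / (1 - q)"
proof (cases "a = 0")
  case True
  have "b powr (1 - q) * (1 - q) \<le> b powr (1 - q)"
    using assms by (simp add: mult_left_le)
  then show ?thesis using True assms
    by (simp add: field_simps powr_diff powr_minus)
next
  case False
  have "\<exists>z>a. z < b \<and> b powr (1 - q) - a powr (1 - q) = (b - a) * ((1 - q) * z powr (1 - q - 1))"
    using assms False by (intro MVT2[where f = "\<lambda>x. x powr (1 - q)"]) (auto intro!: has_real_derivative_powr[THEN DERIV_cong])
  then obtain z where z: "a < z" "z < b" "b powr (1 - q) - a powr (1 - q) = (b - a) * ((1 - q) * z powr - q)"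
    by auto
  then have "(b powr (1 - q) - a powr (1 - q)) / (1 - q) = (b - a) * z powr - q"
    using assms by simp
  also have "\<dots> \<ge> (b - a) * b powr - q"
    using z assms by (intro mult_left_mono powr_mono2') auto
  finally show ?thesis by (simp add: mult.commute)
qed

section \<open>Constants and rates of the approximation error\<close>

context singular_kernel
begin

text \<open>Half of the surplus \<open>\<theta> - \<alpha>\<close>. The power
  \<open>\<theta>\<close> of a short length splits into \<open>\<epsilon>\<close>, which yields
  smallness in the mesh, and \<open>\<alpha> + \<epsilon>\<close>, which still beats the singularity
  of the kernel.\<close>

abbreviation "\<epsilon> \<equiv> (\<theta> - \<alpha>) / 2"

text \<open>\<open>c1\<close> is the constant of \<open>nn_integral_k_diagonal\<close> at
  \<open>\<eta> = \<alpha> + \<epsilon>\<close>, and \<open>c2\<close> is that of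
  \<open>nn_integral_k_tail\<close>.\<close>

definition "c1 = C * T powr \<epsilon> / \<epsilon>"
definition "c2 = C / \<alpha>"
text \<open>The three summands belong to the boundary term with \<open>K v\<close>, to the regular
  part of the integral, and to the jumps at cell ends. The three powers in \<open>mesh_mod\<close>
  are the corresponding rates.\<close>

definition "err_const v = 2 * (C\<^sup>2 * ((2 / (1 - 2 * \<alpha>) + 2 / (1 - 4 * \<alpha>)) * v powr - (4 * \<alpha>) * v powr (1 - 2 * \<alpha>)))
  + 16 * c1\<^sup>2 * (T powr (1 - 2 * \<alpha>) / (1 - 2 * \<alpha>))
  + 16 * c2\<^sup>2 * ((4 / (1 - 2 * \<alpha>)) * (T powr (1 - 2 * \<alpha>) / (1 - 2 * \<alpha>)))"
definition "mesh_mod \<delta> = \<delta> powr (2 * \<theta>) + \<delta> powr (\<theta> - \<alpha>) + \<delta> powr (2 * \<theta> - 2 * \<alpha>)"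

lemma mesh_mod_tendsto: "(mesh_mod \<longlongrightarrow> 0) (at_right 0)"
proof -
  have "((\<lambda>x. x powr a) \<longlongrightarrow> 0) (at_right 0)" if "0 < a" for a :: real
    using that by (intro tendsto_eq_intros) (auto intro!: eventually_mono[OF eventually_at_right_less])
  then have "((\<lambda>\<delta>. \<delta> powr (2 * \<theta>) + \<delta> powr (\<theta> - \<alpha>) + \<delta> powr (2 * \<theta> - 2 * \<alpha>)) \<longlongrightarrow> 0 + 0 + 0) (at_right 0)"
    using alpha theta by (intro tendsto_add) auto
  then show ?thesis unfolding mesh_mod_def by simp
qed

text \<open>The squared kernel and the squared weight of a Hoelder family each contribute
  \<open>t powr - (2 * \<alpha>)\<close>. The total singularity
  \<open>t powr - (4 * \<alpha>)\<close> is integrable at 0 because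
  \<open>\<alpha> < 1/4\<close>.\<close>

lemma nn_integral_K_square_weighted:
  assumes "0 < v" "v \<le> T"
  shows "(\<integral>\<^sup>+t. ennreal ((K v t)\<^sup>2 * t powr - (2 * \<alpha>)) \<partial>lborel)
    \<le> ennreal (C\<^sup>2 * ((2 / (1 - 2 * \<alpha>) + 2 / (1 - 4 * \<alpha>)) * v powr - (4 * \<alpha>) * v powr (1 - 2 * \<alpha>)))"
proof -
  have "(\<integral>\<^sup>+t. ennreal ((K v t)\<^sup>2 * t powr - (2 * \<alpha>)) \<partial>lborel)
    \<le> (\<integral>\<^sup>+t. ennreal (C\<^sup>2) * (ennreal (t powr - (4 * \<alpha>) * (v - t) powr - (2 * \<alpha>)) * indicator {0..v} t) \<partial>lborel)"
  proof (rule nn_integral_mono)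
    fix t
    show "ennreal ((K v t)\<^sup>2 * t powr - (2 * \<alpha>))
      \<le> ennreal (C\<^sup>2) * (ennreal (t powr - (4 * \<alpha>) * (v - t) powr - (2 * \<alpha>)) * indicator {0..v} t)"
    proof (cases "0 < t \<and> t < v")
      case True
      then have "\<bar>K v t\<bar>\<^sup>2 \<le> (C * t powr - \<alpha> * (v - t) powr - \<alpha>)\<^sup>2"
        using assms by (intro power_mono K_le) auto
      then have "(K v t)\<^sup>2 * t powr - (2 * \<alpha>) \<le> (C * t powr - \<alpha> * (v - t) powr - \<alpha>)\<^sup>2 * t powr - (2 * \<alpha>)"
        by (intro mult_right_mono) auto
      also have "\<dots> = C\<^sup>2 * ((t powr - (2 * \<alpha>) * t powr - (2 * \<alpha>)) * (v - t) powr - (2 * \<alpha>))"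
        by (simp add: power_mult_distrib powr_square)
      also have "t powr - (2 * \<alpha>) * t powr - (2 * \<alpha>) = t powr - (4 * \<alpha>)"
        unfolding powr_add[symmetric] by simp
      finally show ?thesis using True by (auto simp: ennreal_mult'[symmetric] intro!: ennreal_leI)
    qed (use K_eq_0[of t v] in auto)
  qed
  also have "\<dots> = ennreal (C\<^sup>2) * (\<integral>\<^sup>+t\<in>{0..v}. ennreal (t powr - (4 * \<alpha>) * (v - t) powr - (2 * \<alpha>)) \<partial>lborel)"
    by (rule nn_integral_cmult) measurable
  also have "\<dots> \<le> ennreal (C\<^sup>2) * ennreal ((2 / (1 - 2 * \<alpha>) + 2 / (1 - 4 * \<alpha>)) * v powr - (4 * \<alpha>) * (v - 0) powr (1 - 2 * \<alpha>))"
    using assms alpha by (intro mult_left_mono nn_integral_powr_beta_le) auto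
  finally show ?thesis by (simp add: ennreal_mult'[symmetric])
qed

lemma nn_integral_weight: "(\<integral>\<^sup>+t\<in>{0..T}. ennreal (t powr - (2 * \<alpha>)) \<partial>lborel) = ennreal (T powr (1 - 2 * \<alpha>) / (1 - 2 * \<alpha>))"
  using nn_integral_powr_right[of "2 * \<alpha>" 0 T] alpha T_pos by simp

end

text \<open>
  The weight \<open>w powr - \<alpha>\<close> is needed for the family \<open>G\<close> below, which for \<open>\<alpha> \<ge> 1/6\<close> is not
  uniformly Hoelder near \<open>0\<close> with any exponent above \<open>\<alpha>\<close>.
\<close>

locale hoelder_family = singular_kernel T \<alpha> C \<theta> K k for T \<alpha> C \<theta> K k +
  fixes M :: "'a measure" and g :: "'a \<Rightarrow> real \<Rightarrow> 'e::euclidean_space" and A :: real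
  assumes sigma_finite: "sigma_finite_measure M"
    and g_borel: "case_prod g \<in> borel_measurable (M \<Otimes>\<^sub>M borel)"
    and A_pos: "0 < A"
    and g_hoelder: "\<And>u w. 0 \<le> u \<Longrightarrow> u < w \<Longrightarrow> w \<le> T \<Longrightarrow>
      (\<integral>\<^sup>+s. ennreal ((norm (g s w - g s u))\<^sup>2) \<partial>M) \<le> ennreal ((A * w powr - \<alpha> * (w - u) powr \<theta>)\<^sup>2)"
begin

lemma g_measurable[measurable (raw)]:
  "f \<in> measurable N M \<Longrightarrow> h \<in> borel_measurable N \<Longrightarrow> (\<lambda>x. g (f x) (h x)) \<in> borel_measurable N"
  using measurable_compose[OF measurable_Pair g_borel, of f N h] by simp

text \<open>Freezes the weight at \<open>t\<close>, the point at which the transform is evaluated,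
  so that it can be pulled out of integrals over \<open>r\<close>.\<close>

lemma g_hoelder':
  assumes "0 < t" "t \<le> r" "r \<le> T" "0 \<le> u" "u \<le> r" "r - u \<le> y"
  shows "(\<integral>\<^sup>+s. ennreal ((norm (g s r - g s u))\<^sup>2) \<partial>M) \<le> ennreal ((A * t powr - \<alpha> * y powr \<theta>)\<^sup>2)"
proof (cases "u = r")
  case False
  have "(\<integral>\<^sup>+s. ennreal ((norm (g s r - g s u))\<^sup>2) \<partial>M) \<le> ennreal ((A * r powr - \<alpha> * (r - u) powr \<theta>)\<^sup>2)"
    using assms False by (intro g_hoelder) auto
  also have "\<dots> \<le> ennreal ((A * t powr - \<alpha> * y powr \<theta>)\<^sup>2)"
    using assms A_pos alpha theta
    by (intro ennreal_leI power_mono mult_mono powr_mono2 powr_mono2') auto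
  finally show ?thesis .
qed simp

text \<open>Minkowski's inequality bounds the L2 norm in \<open>s\<close> of the absolute integral
  by the integral of the Hoelder bound, which is finite since \<open>\<theta> > \<alpha>\<close>. A
  single section \<open>g s\<close> need not be Hoelder, so integrability is only almost sure, with
  a null set that may depend on \<open>t\<close>.\<close>

lemma AE_integrable_kernel:
  assumes "0 < t"
  shows "AE s in M. integrable lborel (\<lambda>r. (indicator {..v} r * k r t) *\<^sub>R (g s r - g s t))"
proof -
  have "(\<integral>\<^sup>+s. (\<integral>\<^sup>+r. ennreal (\<bar>k r t\<bar> * norm (g s r - g s t)) \<partial>lborel)\<^sup>2 \<partial>M)
     \<le> (\<integral>\<^sup>+r. ennreal (\<bar>k r t\<bar> * (A * t powr - \<alpha> * (r - t) powr \<theta>)) \<partial>lborel)\<^sup>2"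
  proof (rule nn_integral_Minkowski_envelope[OF sigma_finite sigma_finite_lborel])
    fix r assume "\<bar>k r t\<bar> \<noteq> 0"
    then have "t < r" "r \<le> T" using k_eq_0[of t r] by auto
    then show "0 < A * t powr - \<alpha> * (r - t) powr \<theta> \<and>
      (\<integral>\<^sup>+s. ennreal ((norm (g s r - g s t))\<^sup>2) \<partial>M) \<le> ennreal ((A * t powr - \<alpha> * (r - t) powr \<theta>)\<^sup>2)"
      using assms A_pos by (auto intro!: g_hoelder')
  qed (measurable, auto)
  also have "(\<integral>\<^sup>+r. ennreal (\<bar>k r t\<bar> * (A * t powr - \<alpha> * (r - t) powr \<theta>)) \<partial>lborel)
    = (\<integral>\<^sup>+r. ennreal (A * t powr - \<alpha>) * ennreal (\<bar>k r t\<bar> * (r - t) powr \<theta>) \<partial>lborel)"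
    using A_pos by (intro nn_integral_cong) (simp add: ennreal_mult'[symmetric] ac_simps)
  also have "\<dots> = ennreal (A * t powr - \<alpha>) * (\<integral>\<^sup>+r. ennreal (\<bar>k r t\<bar> * (r - t) powr \<theta>) \<partial>lborel)"
    by (rule nn_integral_cmult) measurable
  also have "\<dots>\<^sup>2 \<le> (ennreal (A * t powr - \<alpha>) * ennreal (C * T powr (\<theta> - \<alpha>) / (\<theta> - \<alpha>)))\<^sup>2"
    using theta assms by (intro power_mono mult_left_mono nn_integral_k_diagonal) auto
  also have "\<dots> < \<infinity>"
    by (simp add: ennreal_mult_less_top power_less_top_ennreal)
  finally have "AE s in M. (\<integral>\<^sup>+r. ennreal (\<bar>k r t\<bar> * norm (g s r - g s t)) \<partial>lborel)\<^sup>2 \<noteq> \<infinity>"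
    by (intro nn_integral_noteq_infinite) auto
  then show ?thesis
  proof (rule AE_mp, intro AE_I2 impI)
    fix s assume s[measurable]: "s \<in> space M" and fin: "(\<integral>\<^sup>+r. ennreal (\<bar>k r t\<bar> * norm (g s r - g s t)) \<partial>lborel)\<^sup>2 \<noteq> \<infinity>"
    have "(\<integral>\<^sup>+r. ennreal (norm ((indicator {..v} r * k r t) *\<^sub>R (g s r - g s t))) \<partial>lborel)
       \<le> (\<integral>\<^sup>+r. ennreal (\<bar>k r t\<bar> * norm (g s r - g s t)) \<partial>lborel)"
      by (intro nn_integral_mono ennreal_leI) (auto simp: indicator_def)
    also have "\<dots> < \<infinity>" using fin by (auto simp: less_top[symmetric] power2_eq_square ennreal_top_mult)
    finally show "integrable lborel (\<lambda>r. (indicator {..v} r * k r t) *\<^sub>R (g s r - g s t))"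
      by (intro integrableI_bounded) auto
  qed
qed

end

locale hoelder_family_partition =
  hoelder_family T \<alpha> C \<theta> K k M g A + kernel_partition T \<alpha> C \<theta> K k p n
  for T \<alpha> C \<theta> K k and M :: "'a measure" and g :: "'a \<Rightarrow> real \<Rightarrow> 'e::euclidean_space" and A p n +
  fixes \<delta> :: real
  assumes delta: "0 < \<delta>" "\<And>i. i < n \<Longrightarrow> p (Suc i) - p i \<le> \<delta>"
begin

lemma step_measurable[measurable (raw)]:
  assumes [measurable]: "f \<in> measurable N M" "r \<in> borel_measurable N"
  shows "(\<lambda>x. step (g (f x)) (r x)) \<in> borel_measurable N"
  unfolding step_def by measurable

definition h :: "'a \<Rightarrow> real \<Rightarrow> 'e" where "h s r = step (g s) r - g s r"

lemma h_measurable[measurable (raw)]: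
  assumes [measurable]: "f \<in> measurable N M" "r \<in> borel_measurable N"
  shows "(\<lambda>x. h (f x) (r x)) \<in> borel_measurable N"
  unfolding h_def by measurable

text \<open>Inside a cell \<open>h\<close> is \<open>- g\<close> up to a constant, so the Hoelder
  bound applies with \<open>r - t \<le> \<delta>\<close>. Across cells, the error at
  \<open>r\<close> is governed by \<open>r - p j\<close>, which is at most both
  \<open>\<delta>\<close> and \<open>r - t\<close>. The error at \<open>t\<close> is governed by
  \<open>t - p i\<close>, which is not small compared with \<open>r - t\<close> when
  \<open>t\<close> is close to \<open>p (Suc i)\<close>; it survives as the indicator term.\<close>

lemma nn_integral_h_increment:
  assumes i: "i < n" and t: "0 < t" "p i \<le> t" "t < p (Suc i)" and r: "t < r" "r < T"
  shows "(\<integral>\<^sup>+s. ennreal ((norm (h s r - h s t))\<^sup>2) \<partial>M)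
    \<le> ennreal ((2 * A * t powr - \<alpha> * (\<delta> powr \<epsilon> * (r - t) powr (\<alpha> + \<epsilon>)
        + indicator {p (Suc i)..} r * (t - p i) powr \<theta>))\<^sup>2)"
proof -
  define x where "x = A * t powr - \<alpha> * (\<delta> powr \<epsilon> * (r - t) powr (\<alpha> + \<epsilon>))"
  have x: "0 \<le> x" unfolding x_def using A_pos by auto
  \<comment> \<open>Interpolation between the two bounds on \<open>y\<close>, using
    \<open>\<theta> = \<epsilon> + (\<alpha> + \<epsilon>)\<close>.\<close>
  have small: "A * t powr - \<alpha> * y powr \<theta> \<le> x" if "0 \<le> y" "y \<le> \<delta>" "y \<le> r - t" for y
  proof -
    have "y powr \<theta> = y powr \<epsilon> * y powr (\<alpha> + \<epsilon>)"
      by (simp add: powr_add[symmetric] field_simps)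
    also have "\<dots> \<le> \<delta> powr \<epsilon> * (r - t) powr (\<alpha> + \<epsilon>)"
      using that theta alpha by (intro mult_mono powr_mono2) (auto simp: field_simps)
    finally show ?thesis unfolding x_def using A_pos by (intro mult_left_mono) auto
  qed
  show ?thesis
  proof (cases "r < p (Suc i)")
    case True
    have "h s r - h s t = - (g s r - g s t)" for s
      unfolding h_def using step_cell[OF i, of r "g s"] step_cell[OF i, of t "g s"] True t r by simp
    then have "(\<integral>\<^sup>+s. ennreal ((norm (h s r - h s t))\<^sup>2) \<partial>M) = (\<integral>\<^sup>+s. ennreal ((norm (g s r - g s t))\<^sup>2) \<partial>M)"
      by (simp only: norm_minus_cancel)
    also have "\<dots> \<le> ennreal ((A * t powr - \<alpha> * (r - t) powr \<theta>)\<^sup>2)"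
      using t r by (intro g_hoelder') auto
    also have "\<dots> \<le> ennreal (x\<^sup>2)"
      using small[of "r - t"] delta(2)[OF i] True t r A_pos by (intro ennreal_leI power_mono) auto
    also have "\<dots> \<le> ennreal ((2 * x)\<^sup>2)"
      using x by (intro ennreal_leI power_mono) auto
    finally show ?thesis using True by (simp add: x_def mult.assoc)
  next
    case False
    obtain j where j: "j < n" "p j \<le> r" "r < p (Suc j)"
      using cell_exists[of r] t r by auto
    have "\<not> j < i" using p_mono[of "Suc j" i] i j t r by auto
    moreover have "j \<noteq> i" using False j by auto
    ultimately have pj: "p (Suc i) \<le> p j" using p_mono[of "Suc i" j] j by auto
    define z where "z = A * t powr - \<alpha> * (t - p i) powr \<theta>"
    have z: "0 \<le> z" unfolding z_def using A_pos by auto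
    have "h s r = - (g s r - g s (p j))" "h s t = - (g s t - g s (p i))" for s
      unfolding h_def using step_cell[OF i, of t "g s"] step_cell[OF j(1), of r "g s"] t j by auto
    then have "(\<integral>\<^sup>+s. ennreal ((norm (h s r - h s t))\<^sup>2) \<partial>M)
      \<le> (\<integral>\<^sup>+s. ennreal (2 * (norm (g s r - g s (p j)))\<^sup>2 + 2 * (norm (g s t - g s (p i)))\<^sup>2) \<partial>M)"
      by (intro nn_integral_mono ennreal_leI)
        (metis norm_diff_square_le norm_minus_cancel)
    also have "\<dots> = 2 * (\<integral>\<^sup>+s. ennreal ((norm (g s r - g s (p j)))\<^sup>2) \<partial>M) + 2 * (\<integral>\<^sup>+s. ennreal ((norm (g s t - g s (p i)))\<^sup>2) \<partial>M)"
      by (simp add: ennreal_mult' nn_integral_add nn_integral_cmult)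
    also have "\<dots> \<le> 2 * ennreal (x\<^sup>2) + 2 * ennreal (z\<^sup>2)"
    proof (intro add_mono mult_left_mono)
      have "(\<integral>\<^sup>+s. ennreal ((norm (g s r - g s (p j)))\<^sup>2) \<partial>M) \<le> ennreal ((A * t powr - \<alpha> * (r - p j) powr \<theta>)\<^sup>2)"
        using t r j p_range[of j] by (intro g_hoelder') auto
      also have "\<dots> \<le> ennreal (x\<^sup>2)"
        using small[of "r - p j"] delta(2)[OF j(1)] j t r pj A_pos by (intro ennreal_leI power_mono) auto
      finally show "(\<integral>\<^sup>+s. ennreal ((norm (g s r - g s (p j)))\<^sup>2) \<partial>M) \<le> ennreal (x\<^sup>2)" .
      show "(\<integral>\<^sup>+s. ennreal ((norm (g s t - g s (p i)))\<^sup>2) \<partial>M) \<le> ennreal (z\<^sup>2)"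
        unfolding z_def using t r p_range[of i] i by (intro g_hoelder') auto
    qed auto
    also have "\<dots> = ennreal (2 * x\<^sup>2 + 2 * z\<^sup>2)"
      by (simp add: ennreal_mult')
    also have "\<dots> \<le> ennreal ((2 * (x + z))\<^sup>2)"
      using x z by (intro ennreal_leI) (simp add: power2_eq_square algebra_simps)
    also have "2 * (x + z) = 2 * A * t powr - \<alpha> * (\<delta> powr \<epsilon> * (r - t) powr (\<alpha> + \<epsilon>)
        + indicator {p (Suc i)..} r * (t - p i) powr \<theta>)"
      using False unfolding x_def z_def by (simp add: algebra_simps)
    finally show ?thesis .
  qed
qed

text \<open>For \<open>t\<close> in cell \<open>i\<close>, the error of the transform is
  \<open>K v t\<close> times the error \<open>h s t\<close>, plus the integral of \<open>k\<close>
  against increments of \<open>h\<close>. The first part needs one Hoelder bound; the second is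
  treated by Minkowski's inequality with the majorant from
  \<open>nn_integral_h_increment\<close>.\<close>

lemma nn_integral_slice_le:
  assumes i: "i < n" and t: "0 < t" "p i \<le> t" "t < p (Suc i)" and v: "v \<le> T"
  shows "(\<integral>\<^sup>+s. ennreal ((norm (step_sum v (g s) t - Kstar v (g s) t))\<^sup>2) \<partial>M)
    \<le> ennreal (A\<^sup>2 * (2 * (K v t)\<^sup>2 * t powr - (2 * \<alpha>) * \<delta> powr (2 * \<theta>)
       + 16 * c1\<^sup>2 * \<delta> powr (\<theta> - \<alpha>) * t powr - (2 * \<alpha>)
       + 16 * c2\<^sup>2 * (t powr - (2 * \<alpha>) * (t - p i) powr (2 * \<theta>) * (p (Suc i) - t) powr - (2 * \<alpha>))))"
proof -
  \<comment> \<open>The point \<open>r = T\<close> is removed because \<open>step\<close> vanishes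
    there, and the increment bound for \<open>h\<close> is available only below
    \<open>T\<close>.\<close>
  define w where "w r = \<bar>k r t\<bar> * indicator {..<T} r" for r
  define D where "D r = 2 * A * t powr - \<alpha> * (\<delta> powr \<epsilon> * (r - t) powr (\<alpha> + \<epsilon>)
        + indicator {p (Suc i)..} r * (t - p i) powr \<theta>)" for r
  define J where "J s = (\<integral>\<^sup>+r. ennreal (w r * norm (h s r - h s t)) \<partial>lborel)" for s
  have [measurable]: "w \<in> borel_measurable borel" "D \<in> borel_measurable borel"
    unfolding w_def D_def by measurable
  have tT: "t < T" using t p_range[of "Suc i"] i by auto
  have J_measurable[measurable]: "J \<in> borel_measurable M"
    unfolding J_def by measurable
  have bound: "AE s in M. ennreal ((norm (step_sum v (g s) t - Kstar v (g s) t))\<^sup>2)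
    \<le> 2 * (ennreal ((K v t)\<^sup>2) * ennreal ((norm (g s t - g s (p i)))\<^sup>2)) + 2 * (J s)\<^sup>2"
    using AE_integrable_kernel[OF t(1), of v]
  proof eventually_elim
    fix s assume int: "integrable lborel (\<lambda>r. (indicator {..v} r * k r t) *\<^sub>R (g s r - g s t))"
    have ht: "h s t = - (g s t - g s (p i))"
      unfolding h_def using step_cell[OF i, of t "g s"] t by simp
    define I where "I = (\<integral>r. (indicator {..v} r * k r t) *\<^sub>R (h s r - h s t) \<partial>lborel)"
    have diff: "(indicator {..v} r * k r t) *\<^sub>R (h s r - h s t)
       = (indicator {..v} r * k r t) *\<^sub>R (step (g s) r - step (g s) t) - (indicator {..v} r * k r t) *\<^sub>R (g s r - g s t)" for r
      unfolding h_def by (simp add: algebra_simps)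
    have int': "integrable lborel (\<lambda>r. (indicator {..v} r * k r t) *\<^sub>R (h s r - h s t))"
      unfolding diff by (intro Bochner_Integration.integrable_diff step_transform int v)
    have "I = (\<integral>r. (indicator {..v} r * k r t) *\<^sub>R (step (g s) r - step (g s) t) \<partial>lborel)
        - (\<integral>r. (indicator {..v} r * k r t) *\<^sub>R (g s r - g s t) \<partial>lborel)"
      unfolding I_def diff by (intro Bochner_Integration.integral_diff step_transform int v)
    then have eq: "step_sum v (g s) t - Kstar v (g s) t = K v t *\<^sub>R h s t + I"
      unfolding step_transform(2)[OF v, symmetric] Kstar_def h_def by (simp add: algebra_simps)
    have "ennreal (norm I) \<le> (\<integral>\<^sup>+r. ennreal (norm ((indicator {..v} r * k r t) *\<^sub>R (h s r - h s t))) \<partial>lborel)"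
      unfolding I_def by (rule integral_norm_bound_ennreal[OF int'])
    also have "\<dots> \<le> J s"
      unfolding J_def
    proof (rule nn_integral_mono_AE)
      show "AE r in lborel. ennreal (norm ((indicator {..v} r * k r t) *\<^sub>R (h s r - h s t))) \<le> ennreal (w r * norm (h s r - h s t))"
        using AE_lborel_singleton[of T]
      proof eventually_elim
        fix r assume "r \<noteq> T"
        then show "ennreal (norm ((indicator {..v} r * k r t) *\<^sub>R (h s r - h s t))) \<le> ennreal (w r * norm (h s r - h s t))"
          using k_eq_0[of t r] by (cases "r < T") (auto simp: w_def indicator_def)
      qed
    qed
    finally have I: "ennreal (norm I) \<le> J s" .
    have "ennreal ((norm (step_sum v (g s) t - Kstar v (g s) t))\<^sup>2) = (ennreal (norm (K v t *\<^sub>R h s t + I)))\<^sup>2"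
      by (simp add: eq ennreal_power)
    also have "\<dots> \<le> (ennreal (norm (K v t *\<^sub>R h s t)) + J s)\<^sup>2"
    proof (intro power_mono)
      have "ennreal (norm (K v t *\<^sub>R h s t + I)) \<le> ennreal (norm (K v t *\<^sub>R h s t) + norm I)"
        by (intro ennreal_leI norm_triangle_ineq)
      also have "\<dots> \<le> ennreal (norm (K v t *\<^sub>R h s t)) + J s"
        using I by (simp add: add_left_mono)
      finally show "ennreal (norm (K v t *\<^sub>R h s t + I)) \<le> ennreal (norm (K v t *\<^sub>R h s t)) + J s" .
    qed auto
    also have "\<dots> \<le> 2 * (ennreal (norm (K v t *\<^sub>R h s t)))\<^sup>2 + 2 * (J s)\<^sup>2"
      by (rule ennreal_add_square_le)
    also have "(ennreal (norm (K v t *\<^sub>R h s t)))\<^sup>2 = ennreal ((K v t)\<^sup>2) * ennreal ((norm (g s t - g s (p i)))\<^sup>2)"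
      unfolding ht norm_scaleR norm_minus_cancel
      by (simp add: ennreal_power power_mult_distrib ennreal_mult'[symmetric])
    finally show "ennreal ((norm (step_sum v (g s) t - Kstar v (g s) t))\<^sup>2)
      \<le> 2 * (ennreal ((K v t)\<^sup>2) * ennreal ((norm (g s t - g s (p i)))\<^sup>2)) + 2 * (J s)\<^sup>2" .
  qed
  \<comment> \<open>\<open>q\<close> bounds the integral of \<open>D\<close> against the kernel, up
    to the common factor \<open>2 * A * t powr - \<alpha>\<close>. The regular part gives
    \<open>c1\<close>; the jump, integrated from the cell end to \<open>T\<close>, gives
    \<open>c2\<close> together with a singularity at the right end of the cell.\<close>
  define q where "q = \<delta> powr \<epsilon> * c1 + c2 * ((t - p i) powr \<theta> * (p (Suc i) - t) powr - \<alpha>)"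
  have c_nonneg: "0 \<le> c1" "0 \<le> c2"
    unfolding c1_def c2_def using C_pos alpha theta by auto
  have wD: "(\<integral>\<^sup>+r. ennreal (w r * D r) \<partial>lborel) \<le> ennreal (2 * A * t powr - \<alpha> * q)"
  proof -
    have "(\<integral>\<^sup>+r. ennreal (w r * D r) \<partial>lborel)
       \<le> (\<integral>\<^sup>+r. ennreal (2 * A * t powr - \<alpha>) * (ennreal (\<delta> powr \<epsilon>) * ennreal (\<bar>k r t\<bar> * (r - t) powr (\<alpha> + \<epsilon>))
           + ennreal ((t - p i) powr \<theta>) * (ennreal \<bar>k r t\<bar> * indicator {p (Suc i)..T} r)) \<partial>lborel)"
    proof (rule nn_integral_mono)
      fix r
      have "w r * D r \<le> 2 * A * t powr - \<alpha> * (\<delta> powr \<epsilon> * (\<bar>k r t\<bar> * (r - t) powr (\<alpha> + \<epsilon>))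
           + (t - p i) powr \<theta> * (\<bar>k r t\<bar> * indicator {p (Suc i)..T} r))"
        unfolding w_def D_def using A_pos by (auto simp: indicator_def algebra_simps)
      then show "ennreal (w r * D r) \<le> ennreal (2 * A * t powr - \<alpha>) * (ennreal (\<delta> powr \<epsilon>) * ennreal (\<bar>k r t\<bar> * (r - t) powr (\<alpha> + \<epsilon>))
           + ennreal ((t - p i) powr \<theta>) * (ennreal \<bar>k r t\<bar> * indicator {p (Suc i)..T} r))"
        using A_pos
        by (subst ennreal_indicator[symmetric])
          (simp add: ennreal_mult'[symmetric] ennreal_plus[symmetric] ennreal_leI del: ennreal_plus)
    qed
    also have "\<dots> = ennreal (2 * A * t powr - \<alpha>) * (ennreal (\<delta> powr \<epsilon>) * (\<integral>\<^sup>+r. ennreal (\<bar>k r t\<bar> * (r - t) powr (\<alpha> + \<epsilon>)) \<partial>lborel)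
           + ennreal ((t - p i) powr \<theta>) * (\<integral>\<^sup>+r. ennreal \<bar>k r t\<bar> * indicator {p (Suc i)..T} r \<partial>lborel))"
      by (simp add: nn_integral_cmult nn_integral_add)
    also have "\<dots> \<le> ennreal (2 * A * t powr - \<alpha>) * (ennreal (\<delta> powr \<epsilon>) * ennreal (C * T powr (\<alpha> + \<epsilon> - \<alpha>) / (\<alpha> + \<epsilon> - \<alpha>))
           + ennreal ((t - p i) powr \<theta>) * ennreal (C / \<alpha> * (p (Suc i) - t) powr - \<alpha>))"
      using theta t p_range[of "Suc i"] i
      by (intro mult_left_mono add_mono nn_integral_k_diagonal nn_integral_k_tail) auto
    also have "\<dots> = ennreal (2 * A * t powr - \<alpha> * q)"
      using A_pos C_pos alpha theta c_nonneg unfolding q_def c1_def c2_def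
      by (simp add: ennreal_mult'[symmetric] ennreal_plus[symmetric] ac_simps del: ennreal_plus)
    finally show ?thesis .
  qed
  have JJ: "(\<integral>\<^sup>+s. (J s)\<^sup>2 \<partial>M) \<le> ennreal ((2 * A * t powr - \<alpha> * q)\<^sup>2)"
  proof -
    have "(\<integral>\<^sup>+s. (J s)\<^sup>2 \<partial>M) \<le> (\<integral>\<^sup>+r. ennreal (w r * D r) \<partial>lborel)\<^sup>2"
      unfolding J_def
    proof (rule nn_integral_Minkowski_envelope[OF sigma_finite sigma_finite_lborel])
      fix r assume "w r \<noteq> 0"
      then have r: "t < r" "r < T" using k_eq_0[of t r] by (auto simp: w_def indicator_def split: if_splits)
      have "0 < \<delta> powr \<epsilon> * (r - t) powr (\<alpha> + \<epsilon>)" using r delta(1) by auto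
      then have "0 < D r" unfolding D_def using A_pos t
        by (intro mult_pos_pos add_pos_nonneg) auto
      then show "0 < D r \<and> (\<integral>\<^sup>+s. ennreal ((norm (h s r - h s t))\<^sup>2) \<partial>M) \<le> ennreal ((D r)\<^sup>2)"
        unfolding D_def using nn_integral_h_increment[OF i t r] by simp
    qed (measurable, auto simp: w_def)
    also have "\<dots> \<le> (ennreal (2 * A * t powr - \<alpha> * q))\<^sup>2"
      by (intro power_mono wD) auto
    also have "\<dots> = ennreal ((2 * A * t powr - \<alpha> * q)\<^sup>2)"
      using A_pos c_nonneg unfolding q_def by (intro ennreal_power) auto
    finally show ?thesis .
  qed
  have "(\<integral>\<^sup>+s. ennreal ((norm (step_sum v (g s) t - Kstar v (g s) t))\<^sup>2) \<partial>M)
    \<le> (\<integral>\<^sup>+s. 2 * (ennreal ((K v t)\<^sup>2) * ennreal ((norm (g s t - g s (p i)))\<^sup>2)) + 2 * (J s)\<^sup>2 \<partial>M)"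
    by (rule nn_integral_mono_AE[OF bound])
  also have "\<dots> = 2 * (ennreal ((K v t)\<^sup>2) * (\<integral>\<^sup>+s. ennreal ((norm (g s t - g s (p i)))\<^sup>2) \<partial>M)) + 2 * (\<integral>\<^sup>+s. (J s)\<^sup>2 \<partial>M)"
    by (simp add: nn_integral_cmult nn_integral_add)
  also have "\<dots> \<le> 2 * (ennreal ((K v t)\<^sup>2) * ennreal ((A * t powr - \<alpha> * \<delta> powr \<theta>)\<^sup>2)) + 2 * ennreal ((2 * A * t powr - \<alpha> * q)\<^sup>2)"
    using t tT p_range[of i] i delta(2)[OF i] by (intro add_mono mult_left_mono JJ g_hoelder') auto
  also have "\<dots> = ennreal (2 * (K v t)\<^sup>2 * (A * t powr - \<alpha> * \<delta> powr \<theta>)\<^sup>2 + 2 * (2 * A * t powr - \<alpha> * q)\<^sup>2)"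
    by (simp add: ennreal_mult' mult.assoc)
  also have "\<dots> \<le> ennreal (A\<^sup>2 * (2 * (K v t)\<^sup>2 * t powr - (2 * \<alpha>) * \<delta> powr (2 * \<theta>)
       + 16 * c1\<^sup>2 * \<delta> powr (\<theta> - \<alpha>) * t powr - (2 * \<alpha>)
       + 16 * c2\<^sup>2 * (t powr - (2 * \<alpha>) * (t - p i) powr (2 * \<theta>) * (p (Suc i) - t) powr - (2 * \<alpha>))))"
  proof (rule ennreal_leI)
    have d: "\<delta> powr (2 * \<epsilon>) = \<delta> powr (\<theta> - \<alpha>)"
      by (simp only: mult_2 field_sum_of_halves)
    \<comment> \<open>The final factor 16 is 2 * 4 * 2: from squaring the sum of two error terms,
      from the factor 2 in \<open>D\<close>, and from squaring the sum in \<open>q\<close>.\<close>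
    have "q\<^sup>2 \<le> 2 * (\<delta> powr \<epsilon> * c1)\<^sup>2 + 2 * (c2 * ((t - p i) powr \<theta> * (p (Suc i) - t) powr - \<alpha>))\<^sup>2"
      unfolding q_def by (rule square_sum_le)
    also have "\<dots> = 2 * c1\<^sup>2 * \<delta> powr (\<theta> - \<alpha>) + 2 * c2\<^sup>2 * ((t - p i) powr (2 * \<theta>) * (p (Suc i) - t) powr - (2 * \<alpha>))"
      unfolding power_mult_distrib powr_square d by simp
    finally have q: "q\<^sup>2 \<le> \<dots>" .
    have "2 * (K v t)\<^sup>2 * (A * t powr - \<alpha> * \<delta> powr \<theta>)\<^sup>2 + 2 * (2 * A * t powr - \<alpha> * q)\<^sup>2
       = A\<^sup>2 * (2 * (K v t)\<^sup>2 * t powr - (2 * \<alpha>) * \<delta> powr (2 * \<theta>) + 8 * t powr - (2 * \<alpha>) * q\<^sup>2)"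
      by (simp add: power_mult_distrib powr_square algebra_simps)
    also have "\<dots> \<le> A\<^sup>2 * (2 * (K v t)\<^sup>2 * t powr - (2 * \<alpha>) * \<delta> powr (2 * \<theta>) + 8 * t powr - (2 * \<alpha>) *
        (2 * c1\<^sup>2 * \<delta> powr (\<theta> - \<alpha>) + 2 * c2\<^sup>2 * ((t - p i) powr (2 * \<theta>) * (p (Suc i) - t) powr - (2 * \<alpha>))))"
      by (intro mult_left_mono add_left_mono q) auto
    also have "\<dots> = A\<^sup>2 * (2 * (K v t)\<^sup>2 * t powr - (2 * \<alpha>) * \<delta> powr (2 * \<theta>)
       + 16 * c1\<^sup>2 * \<delta> powr (\<theta> - \<alpha>) * t powr - (2 * \<alpha>)
       + 16 * c2\<^sup>2 * (t powr - (2 * \<alpha>) * (t - p i) powr (2 * \<theta>) * (p (Suc i) - t) powr - (2 * \<alpha>)))"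
      by (simp add: algebra_simps)
    finally show "2 * (K v t)\<^sup>2 * (A * t powr - \<alpha> * \<delta> powr \<theta>)\<^sup>2 + 2 * (2 * A * t powr - \<alpha> * q)\<^sup>2 \<le> \<dots>" .
  qed
  finally show ?thesis .
qed

text \<open>
  The jump of the step function at the end of the cell of \<open>t\<close> has no integrable majorant that is
  independent of the partition, so its contribution is summed over the cells.
\<close>

lemma nn_integral_cells_le:
  "(\<Sum>i<n. \<integral>\<^sup>+t\<in>{p i..p (Suc i)}. ennreal (t powr - (2 * \<alpha>) * (t - p i) powr (2 * \<theta>) * (p (Suc i) - t) powr - (2 * \<alpha>)) \<partial>lborel)
    \<le> ennreal ((4 / (1 - 2 * \<alpha>)) * (T powr (1 - 2 * \<alpha>) / (1 - 2 * \<alpha>)) * \<delta> powr (2 * \<theta> - 2 * \<alpha>))"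
proof -
  define c where "c = 4 / (1 - 2 * \<alpha>)"
  have c: "2 / (1 - 2 * \<alpha>) + 2 / (1 - 2 * \<alpha>) = c" "0 \<le> c" unfolding c_def using alpha by auto
  define d where "d i = c * \<delta> powr (2 * \<theta> - 2 * \<alpha>) / (1 - 2 * \<alpha>) * (p (Suc i) powr (1 - 2 * \<alpha>) - p i powr (1 - 2 * \<alpha>))" for i
  have "(\<Sum>i<n. \<integral>\<^sup>+t\<in>{p i..p (Suc i)}. ennreal (t powr - (2 * \<alpha>) * (t - p i) powr (2 * \<theta>) * (p (Suc i) - t) powr - (2 * \<alpha>)) \<partial>lborel)
     \<le> (\<Sum>i<n. ennreal (d i))"
  proof (rule sum_mono)
    fix i assume "i \<in> {..<n}"
    then have i: "i < n" by simp
    define y where "y = p (Suc i) - p i"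
    have y: "0 < y" "y \<le> \<delta>" unfolding y_def using p_less[OF i] delta(2)[OF i] by auto
    have pi: "0 \<le> p i" "p i < p (Suc i)" using p_range[of i] p_less[OF i] i by auto
    have "(\<integral>\<^sup>+t\<in>{p i..p (Suc i)}. ennreal (t powr - (2 * \<alpha>) * (t - p i) powr (2 * \<theta>) * (p (Suc i) - t) powr - (2 * \<alpha>)) \<partial>lborel)
      \<le> (\<integral>\<^sup>+t. ennreal (y powr (2 * \<theta>)) * (ennreal (t powr - (2 * \<alpha>) * (p (Suc i) - t) powr - (2 * \<alpha>)) * indicator {p i..p (Suc i)} t) \<partial>lborel)"
    proof (rule nn_integral_mono)
      fix t
      show "ennreal (t powr - (2 * \<alpha>) * (t - p i) powr (2 * \<theta>) * (p (Suc i) - t) powr - (2 * \<alpha>)) * indicator {p i..p (Suc i)} t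
        \<le> ennreal (y powr (2 * \<theta>)) * (ennreal (t powr - (2 * \<alpha>) * (p (Suc i) - t) powr - (2 * \<alpha>)) * indicator {p i..p (Suc i)} t)"
      proof (cases "t \<in> {p i..p (Suc i)}")
        case True
        have "(t - p i) powr (2 * \<theta>) * (t powr - (2 * \<alpha>) * (p (Suc i) - t) powr - (2 * \<alpha>))
          \<le> y powr (2 * \<theta>) * (t powr - (2 * \<alpha>) * (p (Suc i) - t) powr - (2 * \<alpha>))"
          using True alpha theta unfolding y_def by (intro mult_right_mono powr_mono2) auto
        then show ?thesis using True by (auto simp: ennreal_mult'[symmetric] ac_simps intro!: ennreal_leI)
      qed auto
    qed
    also have "\<dots> = ennreal (y powr (2 * \<theta>)) * (\<integral>\<^sup>+t\<in>{p i..p (Suc i)}. ennreal (t powr - (2 * \<alpha>) * (p (Suc i) - t) powr - (2 * \<alpha>)) \<partial>lborel)"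
      by (rule nn_integral_cmult) measurable
    also have "\<dots> \<le> ennreal (y powr (2 * \<theta>)) * ennreal (c * p (Suc i) powr - (2 * \<alpha>) * y powr (1 - 2 * \<alpha>))"
      unfolding c(1)[symmetric] y_def using alpha pi by (intro mult_left_mono nn_integral_powr_beta_le) auto
    also have "\<dots> = ennreal (c * (y powr (2 * \<theta>) * y powr (1 - 2 * \<alpha>)) * p (Suc i) powr - (2 * \<alpha>))"
      using c by (simp add: ennreal_mult'[symmetric] ac_simps)
    \<comment> \<open>Exactly one power of the cell length is kept for the summation over cells. The
      excess exponent \<open>2 * \<theta> - 2 * \<alpha>\<close> is positive and becomes a power of
      the mesh.\<close>
    also have "y powr (2 * \<theta>) * y powr (1 - 2 * \<alpha>) = y powr (2 * \<theta> - 2 * \<alpha>) * y"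
      using y by (simp add: powr_add[symmetric] powr_mult_base[symmetric] powr_diff)
    also have "ennreal (c * (y powr (2 * \<theta> - 2 * \<alpha>) * y) * p (Suc i) powr - (2 * \<alpha>)) \<le> ennreal (d i)"
    proof (rule ennreal_leI)
      have "c * (y powr (2 * \<theta> - 2 * \<alpha>) * y) * p (Suc i) powr - (2 * \<alpha>)
        \<le> c * \<delta> powr (2 * \<theta> - 2 * \<alpha>) * (p (Suc i) powr - (2 * \<alpha>) * y)"
        using c y theta by (simp add: ac_simps) (intro mult_left_mono mult_right_mono powr_mono2, auto)
      also have "\<dots> \<le> c * \<delta> powr (2 * \<theta> - 2 * \<alpha>) * ((p (Suc i) powr (1 - 2 * \<alpha>) - p i powr (1 - 2 * \<alpha>)) / (1 - 2 * \<alpha>))"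
        unfolding y_def using c alpha pi by (intro mult_left_mono powr_mult_diff_le) auto
      finally show "c * (y powr (2 * \<theta> - 2 * \<alpha>) * y) * p (Suc i) powr - (2 * \<alpha>) \<le> d i"
        unfolding d_def by simp
    qed
    finally show "(\<integral>\<^sup>+t\<in>{p i..p (Suc i)}. ennreal (t powr - (2 * \<alpha>) * (t - p i) powr (2 * \<theta>) * (p (Suc i) - t) powr - (2 * \<alpha>)) \<partial>lborel) \<le> ennreal (d i)" .
  qed
  also have "\<dots> = ennreal (\<Sum>i<n. d i)"
  proof (rule sum_ennreal)
    fix i assume "i \<in> {..<n}"
    then show "0 \<le> d i" unfolding d_def using alpha c p_less[of i] p_range[of i]
      by (intro mult_nonneg_nonneg divide_nonneg_nonneg) (auto intro!: powr_mono2)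
  qed
  also have "(\<Sum>i<n. d i) = c * \<delta> powr (2 * \<theta> - 2 * \<alpha>) / (1 - 2 * \<alpha>) * (T powr (1 - 2 * \<alpha>))"
    unfolding d_def sum_distrib_left[symmetric]
    using sum_lessThan_telescope[of "\<lambda>i. p i powr (1 - 2 * \<alpha>)" n] by (simp add: p_0 p_n)
  finally show ?thesis unfolding c_def by (simp add: ac_simps)
qed

text \<open>As the measure \<open>M\<close> is left general, this covers a single path, with a
  one-point space for \<open>M\<close>, as well as \<open>G\<close> with Lebesgue measure. The slice
  bounds are integrated in \<open>t\<close>; the jump term, which depends on the cell of
  \<open>t\<close>, is first majorized by the sum over all cells.\<close>

theorem L2_error:
  assumes v: "0 < v" "v \<le> T"
  shows "(\<integral>\<^sup>+t. \<integral>\<^sup>+s. ennreal ((norm (step_sum v (g s) t - Kstar v (g s) t))\<^sup>2) \<partial>M \<partial>lborel)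
    \<le> ennreal (A\<^sup>2 * err_const v * mesh_mod \<delta>)"
proof -
  define F where "F t = (\<integral>\<^sup>+s. ennreal ((norm (step_sum v (g s) t - Kstar v (g s) t))\<^sup>2) \<partial>M)" for t
  define a0 where "a0 = A\<^sup>2 * 2 * \<delta> powr (2 * \<theta>)"
  define a1 where "a1 = A\<^sup>2 * 16 * c1\<^sup>2 * \<delta> powr (\<theta> - \<alpha>)"
  define a2 where "a2 = A\<^sup>2 * 16 * c2\<^sup>2"
  have a: "0 \<le> a0" "0 \<le> a1" "0 \<le> a2" unfolding a0_def a1_def a2_def by auto
  define u0 where "u0 t = (K v t)\<^sup>2 * t powr - (2 * \<alpha>)" for t
  define u1 where "u1 t = t powr - (2 * \<alpha>)" for t
  define u2 where "u2 i t = t powr - (2 * \<alpha>) * (t - p i) powr (2 * \<theta>) * (p (Suc i) - t) powr - (2 * \<alpha>)" for i t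
  have u_nonneg: "0 \<le> u0 t" "0 \<le> u1 t" "0 \<le> u2 i t" for i t unfolding u0_def u1_def u2_def by auto
  have [measurable]: "u0 \<in> borel_measurable borel" "u1 \<in> borel_measurable borel" "u2 i \<in> borel_measurable borel" for i
    unfolding u0_def u1_def u2_def by measurable
  define w2 where "w2 i t = ennreal (u2 i t) * indicator {p i..p (Suc i)} t" for i t
  have w2_measurable[measurable]: "w2 i \<in> borel_measurable lborel" for i
    unfolding w2_def by measurable
  have le: "F t \<le> ennreal a0 * ennreal (u0 t) + (ennreal a1 * (ennreal (u1 t) * indicator {0..T} t)
      + ennreal a2 * (\<Sum>i<n. w2 i t))" for t
  proof (cases "0 < t \<and> t < T")
    case True
    then obtain i where i: "i < n" "p i \<le> t" "t < p (Suc i)" using cell_exists[of t] by auto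
    have "F t \<le> ennreal (a0 * u0 t + (a1 * u1 t + a2 * u2 i t))"
      unfolding F_def using nn_integral_slice_le[OF i(1) _ i(2,3) v(2)] True
      unfolding a0_def a1_def a2_def u0_def u1_def u2_def by (simp add: algebra_simps)
    also have "\<dots> = ennreal a0 * ennreal (u0 t) + (ennreal a1 * ennreal (u1 t) + ennreal a2 * ennreal (u2 i t))"
      using a u_nonneg by (simp add: ennreal_mult')
    also have "ennreal (u2 i t) \<le> (\<Sum>i<n. w2 i t)"
      using member_le_sum[of i "{..<n}" "\<lambda>i. w2 i t"] i by (auto simp: w2_def)
    finally show ?thesis using True by (auto simp: add_left_mono mult_left_mono)
  next
    case False
    then have "K r t = 0" "k r t = 0" for r using K_eq_0[of t r] k_eq_0[of t r] by auto
    then show ?thesis unfolding F_def step_sum_def Kstar_def by simp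
  qed
  have "(\<integral>\<^sup>+t. F t \<partial>lborel) \<le> (\<integral>\<^sup>+t. ennreal a0 * ennreal (u0 t) + (ennreal a1 * (ennreal (u1 t) * indicator {0..T} t)
      + ennreal a2 * (\<Sum>i<n. w2 i t)) \<partial>lborel)"
    by (intro nn_integral_mono le)
  also have "\<dots> = ennreal a0 * (\<integral>\<^sup>+t. ennreal (u0 t) \<partial>lborel) + (ennreal a1 * (\<integral>\<^sup>+t\<in>{0..T}. ennreal (u1 t) \<partial>lborel)
      + ennreal a2 * (\<Sum>i<n. integral\<^sup>N lborel (w2 i)))"
    by (simp add: nn_integral_cmult nn_integral_add nn_integral_sum)
  also have "\<dots> \<le> ennreal a0 * ennreal (C\<^sup>2 * ((2 / (1 - 2 * \<alpha>) + 2 / (1 - 4 * \<alpha>)) * v powr - (4 * \<alpha>) * v powr (1 - 2 * \<alpha>)))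
      + (ennreal a1 * ennreal (T powr (1 - 2 * \<alpha>) / (1 - 2 * \<alpha>))
      + ennreal a2 * ennreal ((4 / (1 - 2 * \<alpha>)) * (T powr (1 - 2 * \<alpha>) / (1 - 2 * \<alpha>)) * \<delta> powr (2 * \<theta> - 2 * \<alpha>)))"
    unfolding u0_def u1_def w2_def u2_def nn_integral_weight
    by (intro add_mono mult_left_mono nn_integral_K_square_weighted nn_integral_cells_le v) auto
  also have "\<dots> = ennreal (a0 * (C\<^sup>2 * ((2 / (1 - 2 * \<alpha>) + 2 / (1 - 4 * \<alpha>)) * v powr - (4 * \<alpha>) * v powr (1 - 2 * \<alpha>)))
      + (a1 * (T powr (1 - 2 * \<alpha>) / (1 - 2 * \<alpha>))
      + a2 * ((4 / (1 - 2 * \<alpha>)) * (T powr (1 - 2 * \<alpha>) / (1 - 2 * \<alpha>)) * \<delta> powr (2 * \<theta> - 2 * \<alpha>))))"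
    (is "_ = ennreal (_ * ?y0 + (_ * ?y1 + _ * (?y2 * _)))")
    using a alpha by (simp add: ennreal_mult'[symmetric] ennreal_plus[symmetric] del: ennreal_plus)
  also have "\<dots> \<le> ennreal (A\<^sup>2 * err_const v * mesh_mod \<delta>)"
  proof (rule ennreal_leI)
    have expand: "x * p1 + y * p2 + z * p3 \<le> (x + y + z) * (p1 + p2 + p3)"
      if "0 \<le> x" "0 \<le> y" "0 \<le> z" "0 \<le> p1" "0 \<le> p2" "0 \<le> p3" for x y z p1 p2 p3 :: real
      using that by (simp add: algebra_simps add_increasing add_increasing2)
    have "2 * ?y0 * \<delta> powr (2 * \<theta>) + 16 * c1\<^sup>2 * ?y1 * \<delta> powr (\<theta> - \<alpha>) + 16 * c2\<^sup>2 * ?y2 * \<delta> powr (2 * \<theta> - 2 * \<alpha>)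
      \<le> err_const v * mesh_mod \<delta>"
      unfolding err_const_def mesh_mod_def using alpha by (intro expand) auto
    then have "A\<^sup>2 * (2 * ?y0 * \<delta> powr (2 * \<theta>) + 16 * c1\<^sup>2 * ?y1 * \<delta> powr (\<theta> - \<alpha>) + 16 * c2\<^sup>2 * ?y2 * \<delta> powr (2 * \<theta> - 2 * \<alpha>))
      \<le> A\<^sup>2 * (err_const v * mesh_mod \<delta>)"
      by (intro mult_left_mono) auto
    then show "a0 * ?y0 + (a1 * ?y1 + a2 * (?y2 * \<delta> powr (2 * \<theta> - 2 * \<alpha>))) \<le> A\<^sup>2 * err_const v * mesh_mod \<delta>"
      unfolding a0_def a1_def a2_def by (simp add: algebra_simps)
  qed
  finally show ?thesis unfolding F_def .
qed

end

section \<open>The transform in the first variable\<close>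

text \<open>\<open>\<phi>\<close> is the integrand without its indicator. Its bounds are asked for
  on the whole plane, so that no domain conditions appear under the integrals; clamping both
  arguments to \<open>{0..T}\<close> produces such a function.\<close>

locale hoelder_integrand = singular_kernel T \<alpha> C \<theta> K k for T \<alpha> C \<theta> K k +
  fixes \<phi> :: "real \<Rightarrow> real \<Rightarrow> 'e::euclidean_space" and B :: real
  assumes B_pos: "0 < B"
    and phi_le: "\<And>u v. norm (\<phi> u v) \<le> B"
    and phi_hoelder_1: "\<And>u u' v. norm (\<phi> u' v - \<phi> u v) \<le> B * \<bar>u' - u\<bar> powr \<theta>"
    and phi_hoelder_2: "\<And>u v v'. norm (\<phi> u v' - \<phi> u v) \<le> B * \<bar>v' - v\<bar> powr \<theta>"
    and phi_hoelder_12: "\<And>u u' v v'. norm (\<phi> u v + \<phi> u' v' - \<phi> u v' - \<phi> u' v) \<le> B * \<bar>u' - u\<bar> powr \<theta> * \<bar>v' - v\<bar> powr \<theta>"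
begin

lemma phi_measurable[measurable (raw)]:
  assumes [measurable]: "f \<in> borel_measurable M" "g \<in> borel_measurable M"
  shows "(\<lambda>x. \<phi> (f x) (g x)) \<in> borel_measurable M"
proof -
  have "isCont (case_prod \<phi>) (u, v)" for u v
    unfolding isCont_def
  proof (rule Lim_null[THEN iffD2], rule tendsto_norm_zero_cancel, rule tendsto_sandwich[OF always_eventually always_eventually tendsto_const])
    show "((\<lambda>x. B * \<bar>fst x - u\<bar> powr \<theta> + B * \<bar>snd x - v\<bar> powr \<theta>) \<longlongrightarrow> 0) (at (u, v))"
      by (rule tendsto_eq_intros refl | (use alpha theta in simp; fail))+
    show "\<forall>x. norm (case_prod \<phi> x - case_prod \<phi> (u, v)) \<le> B * \<bar>fst x - u\<bar> powr \<theta> + B * \<bar>snd x - v\<bar> powr \<theta>"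
    proof
      fix x :: "real \<times> real"
      have "case_prod \<phi> x - case_prod \<phi> (u, v) = (\<phi> (fst x) (snd x) - \<phi> u (snd x)) + (\<phi> u (snd x) - \<phi> u v)"
        by (simp add: case_prod_beta)
      also have "norm \<dots> \<le> B * \<bar>fst x - u\<bar> powr \<theta> + B * \<bar>snd x - v\<bar> powr \<theta>"
        by (intro norm_triangle_le add_mono phi_hoelder_1 phi_hoelder_2)
      finally show "norm (case_prod \<phi> x - case_prod \<phi> (u, v)) \<le> B * \<bar>fst x - u\<bar> powr \<theta> + B * \<bar>snd x - v\<bar> powr \<theta>" .
    qed
  qed auto
  then have "case_prod \<phi> \<in> borel_measurable borel"
    by (intro borel_measurable_continuous_onI) (auto simp: continuous_on_eq_continuous_at)
  from measurable_compose[OF _ this, of "\<lambda>x. (f x, g x)" M] show ?thesis by simp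
qed

definition G :: "real \<Rightarrow> real \<Rightarrow> 'e" where
  "G s v = Kstar v (\<lambda>u. \<phi> u v) s"

lemma G_measurable[measurable (raw)]:
  assumes [measurable]: "f \<in> borel_measurable M" "g \<in> borel_measurable M"
  shows "(\<lambda>x. G (f x) (g x)) \<in> borel_measurable M"
proof -
  have "(\<lambda>x. (\<integral>r. ((if r \<le> g x then 1 else 0) * k r (f x)) *\<^sub>R (\<phi> r (g x) - \<phi> (f x) (g x)) \<partial>lborel)) \<in> borel_measurable M"
    by (rule lborel.borel_measurable_lebesgue_integral) measurable
  also have "(\<lambda>x. (\<integral>r. ((if r \<le> g x then 1 else 0) * k r (f x)) *\<^sub>R (\<phi> r (g x) - \<phi> (f x) (g x)) \<partial>lborel))
    = (\<lambda>x. (\<integral>r. (indicator {..g x} r * k r (f x)) *\<^sub>R (\<phi> r (g x) - \<phi> (f x) (g x)) \<partial>lborel))"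
    by (simp only: indicator_def of_bool_def atMost_iff)
  finally have [measurable]: "(\<lambda>x. (\<integral>r. (indicator {..g x} r * k r (f x)) *\<^sub>R (\<phi> r (g x) - \<phi> (f x) (g x)) \<partial>lborel)) \<in> borel_measurable M" .
  show ?thesis unfolding G_def Kstar_def by measurable
qed

lemma k_mult_integrable:
  fixes f :: "real \<Rightarrow> 'e"
  assumes [measurable]: "f \<in> borel_measurable borel" and f: "\<And>r. t < r \<Longrightarrow> norm (f r) \<le> E * (r - t) powr \<theta>" and "0 \<le> E" "0 \<le> t"
  shows "integrable lborel (\<lambda>r. k r t *\<^sub>R f r)" "norm (\<integral>r. k r t *\<^sub>R f r \<partial>lborel) \<le> E * (C * T powr (\<theta> - \<alpha>) / (\<theta> - \<alpha>))"
proof -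
  have "(\<integral>\<^sup>+r. ennreal (norm (k r t *\<^sub>R f r)) \<partial>lborel) \<le> (\<integral>\<^sup>+r. ennreal E * ennreal (\<bar>k r t\<bar> * (r - t) powr \<theta>) \<partial>lborel)"
  proof (rule nn_integral_mono)
    fix r
    show "ennreal (norm (k r t *\<^sub>R f r)) \<le> ennreal E * ennreal (\<bar>k r t\<bar> * (r - t) powr \<theta>)"
    proof (cases "t < r")
      case True
      have "\<bar>k r t\<bar> * norm (f r) \<le> \<bar>k r t\<bar> * (E * (r - t) powr \<theta>)"
        using f[OF True] by (intro mult_left_mono) auto
      then show ?thesis using assms(3) by (simp add: ennreal_mult'[symmetric] ennreal_leI ac_simps)
    qed (use k_eq_0[of t r] in auto)
  qed
  also have "\<dots> = ennreal E * (\<integral>\<^sup>+r. ennreal (\<bar>k r t\<bar> * (r - t) powr \<theta>) \<partial>lborel)"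
    by (rule nn_integral_cmult) measurable
  also have "\<dots> \<le> ennreal E * ennreal (C * T powr (\<theta> - \<alpha>) / (\<theta> - \<alpha>))"
    using theta assms by (intro mult_left_mono nn_integral_k_diagonal) auto
  finally have le: "(\<integral>\<^sup>+r. ennreal (norm (k r t *\<^sub>R f r)) \<partial>lborel) \<le> ennreal (E * (C * T powr (\<theta> - \<alpha>) / (\<theta> - \<alpha>)))"
    using assms(3) by (simp add: ennreal_mult'[symmetric])
  show int: "integrable lborel (\<lambda>r. k r t *\<^sub>R f r)"
    by (rule integrableI_bounded) (use le in \<open>auto intro: le_less_trans\<close>)
  have "ennreal (norm (\<integral>r. k r t *\<^sub>R f r \<partial>lborel)) \<le> ennreal (E * (C * T powr (\<theta> - \<alpha>) / (\<theta> - \<alpha>)))"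
    by (rule order_trans[OF integral_norm_bound_ennreal[OF int] le])
  moreover have "0 \<le> E * (C * T powr (\<theta> - \<alpha>) / (\<theta> - \<alpha>))" using assms(3) C_pos theta by auto
  ultimately show "norm (\<integral>r. k r t *\<^sub>R f r \<partial>lborel) \<le> E * (C * T powr (\<theta> - \<alpha>) / (\<theta> - \<alpha>))"
    by (subst (asm) ennreal_le_iff)
qed

lemma G_integrable:
  "integrable lborel (\<lambda>r. (indicator {..v} r * k r s) *\<^sub>R (\<phi> r w - \<phi> s w))"
proof (cases "0 < s")
  case True
  have "integrable lborel (\<lambda>r. k r s *\<^sub>R (indicator {..v} r *\<^sub>R (\<phi> r w - \<phi> s w)))"
  proof (rule k_mult_integrable(1))
    fix r assume "s < r"
    then show "norm (indicator {..v} r *\<^sub>R (\<phi> r w - \<phi> s w)) \<le> B * (r - s) powr \<theta>"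
      using phi_hoelder_1[of r w s] B_pos by (auto simp: indicator_def)
  qed (use B_pos True in auto)
  then show ?thesis by (simp add: mult.commute)
next
  case False
  then have "k r s = 0" for r using k_eq_0[of s r] by auto
  then show ?thesis by simp
qed

lemma G_eq_0: "v \<le> s \<Longrightarrow> G s v = 0"
proof -
  assume "v \<le> s"
  then have "(indicator {..v} r * k r s) *\<^sub>R (\<phi> r v - \<phi> s v) = 0" for r
    using k_eq_0[of s r] by (auto simp: indicator_def)
  moreover have "K v s = 0" using \<open>v \<le> s\<close> by (intro K_eq_0) auto
  ultimately show ?thesis unfolding G_def Kstar_def by (simp del: scaleR_eq_0_iff)
qed

lemma G_eq_0': "s \<le> 0 \<Longrightarrow> G s v = 0"
proof -
  assume "s \<le> 0"
  then have "k r s = 0" "K r s = 0" for r using k_eq_0[of s r] K_eq_0[of s r] by auto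
  then show ?thesis unfolding G_def Kstar_def by simp
qed

text \<open>\<open>c3\<close> is the constant of \<open>nn_integral_k_diagonal\<close> at
  \<open>\<eta> = \<theta>\<close>. The powers of \<open>T\<close> in \<open>D1\<close> and
  \<open>D2\<close> are the price for supplying missing singular factors through
  \<open>powr_minus_ge\<close>.\<close>

definition "c3 = C * T powr (\<theta> - \<alpha>) / (\<theta> - \<alpha>)"
definition "D1 = B * C + B * c3 * T powr (2 * \<alpha>)"
definition "D2 = B * C * T powr \<theta> + B * c3 * T powr (2 * \<alpha> + \<theta>) + B * (C / \<theta>) * T powr \<alpha>"

lemma c3_nonneg: "0 \<le> c3"
  unfolding c3_def using C_pos theta by simp

text \<open>Used to multiply terms without a singularity by the missing negative powers, so that all
  summands of an estimate take the same form.\<close>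

lemma powr_minus_ge:
  assumes "0 < x" "x \<le> T" "0 \<le> a"
  shows "1 \<le> T powr a * x powr - a"
  using assms T_pos by (simp add: powr_minus field_simps powr_mono2)

lemma norm_G_le:
  assumes "0 < s" "s < v" "v \<le> T"
  shows "norm (G s v) \<le> D1 * (s powr - \<alpha> * (v - s) powr - \<alpha>)"
proof -
  have "norm (K v s *\<^sub>R \<phi> s v) \<le> (C * s powr - \<alpha> * (v - s) powr - \<alpha>) * B"
    unfolding norm_scaleR using assms phi_le C_pos by (intro mult_mono K_le) auto
  moreover have "norm (\<integral>r. (indicator {..v} r * k r s) *\<^sub>R (\<phi> r v - \<phi> s v) \<partial>lborel) \<le> B * c3"
  proof -
    have "norm (\<integral>r. k r s *\<^sub>R (indicator {..v} r *\<^sub>R (\<phi> r v - \<phi> s v)) \<partial>lborel) \<le> B * (C * T powr (\<theta> - \<alpha>) / (\<theta> - \<alpha>))"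
    proof (rule k_mult_integrable(2))
      fix r assume "s < r"
      then show "norm (indicator {..v} r *\<^sub>R (\<phi> r v - \<phi> s v)) \<le> B * (r - s) powr \<theta>"
        using phi_hoelder_1[of r v s] B_pos by (auto simp: indicator_def)
    qed (use B_pos assms in auto)
    then show ?thesis unfolding c3_def by (simp add: mult.commute)
  qed
  moreover have "B * c3 \<le> B * c3 * (T powr (2 * \<alpha>) * (s powr - \<alpha> * (v - s) powr - \<alpha>))"
  proof -
    have "1 * 1 \<le> (T powr \<alpha> * s powr - \<alpha>) * (T powr \<alpha> * (v - s) powr - \<alpha>)"
      using assms alpha by (intro mult_mono powr_minus_ge) auto
    also have "\<dots> = (T powr \<alpha> * T powr \<alpha>) * (s powr - \<alpha> * (v - s) powr - \<alpha>)"
      by (simp add: ac_simps)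
    also have "T powr \<alpha> * T powr \<alpha> = T powr (2 * \<alpha>)"
      by (simp add: powr_add[symmetric])
    finally have "B * c3 * 1 \<le> B * c3 * (T powr (2 * \<alpha>) * (s powr - \<alpha> * (v - s) powr - \<alpha>))"
      using B_pos c3_nonneg by (intro mult_left_mono) auto
    then show ?thesis by simp
  qed
  ultimately show ?thesis
    unfolding G_def Kstar_def D1_def
    by (intro norm_triangle_le) (simp add: algebra_simps)
qed

text \<open>Passing from \<open>v\<close> to \<open>w\<close> changes the function on the old range
  and adds the range from \<open>v\<close> to \<open>w\<close>. The old range sees a rectangular
  increment of \<open>\<phi>\<close>, estimated in \<open>I1\<close> by the mixed Hoelder condition;
  this is where strong bi-continuity enters. On the new range \<open>\<phi> s w\<close> integrates
  to \<open>(K w s - K v s) *\<^sub>R \<phi> s w\<close>, which cancels against the change of the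
  boundary factor. Left over are \<open>I2\<close>, the integral of \<open>\<phi> r w\<close> over
  the short range, and \<open>K v s\<close> times an increment in the second argument.\<close>

lemma norm_G_diff_le:
  assumes "0 < s" "s < v" "v < w" "w \<le> T"
  shows "norm (G s w - G s v) \<le> D2 * (s powr - \<alpha> * (v - s) powr (- \<alpha> - \<theta>) * (w - v) powr \<theta>)"
proof -
  define y where "y = s powr - \<alpha> * (v - s) powr (- \<alpha> - \<theta>) * (w - v) powr \<theta>"
  define I1 where "I1 = (\<integral>r. k r s *\<^sub>R (indicator {..v} r *\<^sub>R (\<phi> s v + \<phi> r w - \<phi> s w - \<phi> r v)) \<partial>lborel)"
  define I2 where "I2 = (\<integral>r. (indicator {v..w} r * k r s) *\<^sub>R \<phi> r w \<partial>lborel)"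
  have near: "norm (indicator {..v} r *\<^sub>R (\<phi> s v + \<phi> r w - \<phi> s w - \<phi> r v)) \<le> B * (w - v) powr \<theta> * (r - s) powr \<theta>" if "s < r" for r
    using phi_hoelder_12[of s v r w] that assms B_pos by (auto simp: indicator_def ac_simps)
  have i1: "integrable lborel (\<lambda>r. k r s *\<^sub>R (indicator {..v} r *\<^sub>R (\<phi> s v + \<phi> r w - \<phi> s w - \<phi> r v)))"
    by (rule k_mult_integrable(1)[OF _ near]) (use assms B_pos in auto)
  have I1: "norm I1 \<le> B * (w - v) powr \<theta> * c3"
    unfolding I1_def c3_def by (rule k_mult_integrable(2)[OF _ near]) (use assms B_pos in auto)
  have i0: "integrable lborel (\<lambda>r. indicator {v..w} r * k r s)"
    using k_ind_integrable assms by auto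
  have I2': "(\<integral>\<^sup>+r. ennreal (norm ((indicator {v..w} r * k r s) *\<^sub>R \<phi> r w)) \<partial>lborel)
     \<le> ennreal (B * (C / \<theta> * (v - s) powr (- \<alpha> - \<theta>) * (w - v) powr \<theta>))"
  proof -
    have "(\<integral>\<^sup>+r. ennreal (norm ((indicator {v..w} r * k r s) *\<^sub>R \<phi> r w)) \<partial>lborel)
      \<le> (\<integral>\<^sup>+r. ennreal B * (ennreal \<bar>k r s\<bar> * indicator {v..w} r) \<partial>lborel)"
      using phi_le by (intro nn_integral_mono) (auto simp: indicator_def ennreal_mult''[symmetric] mult.commute[of B] intro!: ennreal_leI mult_left_mono)
    also have "\<dots> = ennreal B * (\<integral>\<^sup>+r\<in>{v..w}. ennreal \<bar>k r s\<bar> \<partial>lborel)"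
      by (rule nn_integral_cmult) measurable
    also have "\<dots> \<le> ennreal B * ennreal (C / \<theta> * (v - s) powr (- \<alpha> - \<theta>) * (w - v) powr \<theta>)"
      using assms by (intro mult_left_mono nn_integral_k_increment) auto
    finally show ?thesis using B_pos by (simp add: ennreal_mult'[symmetric])
  qed
  have i2: "integrable lborel (\<lambda>r. (indicator {v..w} r * k r s) *\<^sub>R \<phi> r w)"
    by (rule integrableI_bounded) (use I2' in \<open>auto intro: le_less_trans\<close>)
  have I2: "norm I2 \<le> B * (C / \<theta> * (v - s) powr (- \<alpha> - \<theta>) * (w - v) powr \<theta>)"
  proof -
    have "ennreal (norm I2) \<le> ennreal (B * (C / \<theta> * (v - s) powr (- \<alpha> - \<theta>) * (w - v) powr \<theta>))"
      unfolding I2_def by (rule order_trans[OF integral_norm_bound_ennreal[OF i2] I2'])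
    then show ?thesis using B_pos C_pos theta alpha by (subst (asm) ennreal_le_iff) auto
  qed
  have split: "(\<integral>r. (indicator {..w} r * k r s) *\<^sub>R (\<phi> r w - \<phi> s w) \<partial>lborel) - (\<integral>r. (indicator {..v} r * k r s) *\<^sub>R (\<phi> r v - \<phi> s v) \<partial>lborel)
    = I1 + (I2 - (K w s - K v s) *\<^sub>R \<phi> s w)"
  proof -
    have "(\<integral>r. (indicator {..w} r * k r s) *\<^sub>R (\<phi> r w - \<phi> s w) \<partial>lborel) - (\<integral>r. (indicator {..v} r * k r s) *\<^sub>R (\<phi> r v - \<phi> s v) \<partial>lborel)
      = (\<integral>r. (indicator {..w} r * k r s) *\<^sub>R (\<phi> r w - \<phi> s w) - (indicator {..v} r * k r s) *\<^sub>R (\<phi> r v - \<phi> s v) \<partial>lborel)"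
      by (rule Bochner_Integration.integral_diff[symmetric]) (rule G_integrable)+
    also have "\<dots> = (\<integral>r. k r s *\<^sub>R (indicator {..v} r *\<^sub>R (\<phi> s v + \<phi> r w - \<phi> s w - \<phi> r v))
         + ((indicator {v..w} r * k r s) *\<^sub>R \<phi> r w - (indicator {v..w} r * k r s) *\<^sub>R \<phi> s w) \<partial>lborel)"
    proof (rule integral_cong_AE)
      show "AE r in lborel. (indicator {..w} r * k r s) *\<^sub>R (\<phi> r w - \<phi> s w) - (indicator {..v} r * k r s) *\<^sub>R (\<phi> r v - \<phi> s v)
        = k r s *\<^sub>R (indicator {..v} r *\<^sub>R (\<phi> s v + \<phi> r w - \<phi> s w - \<phi> r v))
         + ((indicator {v..w} r * k r s) *\<^sub>R \<phi> r w - (indicator {v..w} r * k r s) *\<^sub>R \<phi> s w)"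
        using AE_lborel_singleton[of v]
        by eventually_elim (use assms in \<open>auto simp: indicator_def algebra_simps\<close>)
    qed measurable
    also have "\<dots> = I1 + (I2 - (\<integral>r. indicator {v..w} r * k r s \<partial>lborel) *\<^sub>R \<phi> s w)"
      unfolding I1_def I2_def using i0 i1 i2 by simp
    finally show ?thesis using assms by (simp add: K_diff_eq)
  qed
  have "G s w - G s v = K v s *\<^sub>R (\<phi> s w - \<phi> s v) + (I1 + I2)"
  proof -
    have "G s w - G s v = K w s *\<^sub>R \<phi> s w - K v s *\<^sub>R \<phi> s v + (I1 + (I2 - (K w s - K v s) *\<^sub>R \<phi> s w))"
      unfolding G_def Kstar_def split[symmetric] by (simp add: algebra_simps)
    then show ?thesis by (simp add: algebra_simps)
  qed
  moreover have "norm (K v s *\<^sub>R (\<phi> s w - \<phi> s v)) \<le> B * C * T powr \<theta> * y"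
  proof -
    have "norm (K v s *\<^sub>R (\<phi> s w - \<phi> s v)) \<le> (C * s powr - \<alpha> * (v - s) powr - \<alpha>) * (B * (w - v) powr \<theta>)"
      unfolding norm_scaleR using assms phi_hoelder_2[of s w v] C_pos by (intro mult_mono K_le) auto
    also have "\<dots> = (B * C * s powr - \<alpha> * (w - v) powr \<theta> * (v - s) powr - \<alpha>) * 1" by (simp add: ac_simps)
    also have "\<dots> \<le> (B * C * s powr - \<alpha> * (w - v) powr \<theta> * (v - s) powr - \<alpha>) * (T powr \<theta> * (v - s) powr - \<theta>)"
      using assms B_pos C_pos theta alpha by (intro mult_left_mono powr_minus_ge) auto
    also have "\<dots> = B * C * T powr \<theta> * y"
      unfolding y_def by (simp add: powr_diff powr_minus field_simps)
    finally show ?thesis .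
  qed
  moreover have "norm I1 \<le> B * c3 * T powr (2 * \<alpha> + \<theta>) * y"
  proof -
    have "1 * 1 \<le> (T powr \<alpha> * s powr - \<alpha>) * (T powr (\<alpha> + \<theta>) * (v - s) powr - (\<alpha> + \<theta>))"
      using assms alpha theta by (intro mult_mono powr_minus_ge) auto
    also have "\<dots> = (T powr \<alpha> * T powr (\<alpha> + \<theta>)) * (s powr - \<alpha> * (v - s) powr (- \<alpha> - \<theta>))"
      by (simp add: ac_simps)
    also have "T powr \<alpha> * T powr (\<alpha> + \<theta>) = T powr (2 * \<alpha> + \<theta>)"
      by (simp add: powr_add[symmetric] algebra_simps)
    finally have "B * (w - v) powr \<theta> * c3 * 1 \<le> B * (w - v) powr \<theta> * c3 * (T powr (2 * \<alpha> + \<theta>) * (s powr - \<alpha> * (v - s) powr (- \<alpha> - \<theta>)))"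
      using B_pos c3_nonneg by (intro mult_left_mono) auto
    then show ?thesis using I1 unfolding y_def by (simp add: ac_simps)
  qed
  moreover have "norm I2 \<le> B * (C / \<theta>) * T powr \<alpha> * y"
  proof -
    have "B * (C / \<theta> * (v - s) powr (- \<alpha> - \<theta>) * (w - v) powr \<theta>) * 1
       \<le> B * (C / \<theta> * (v - s) powr (- \<alpha> - \<theta>) * (w - v) powr \<theta>) * (T powr \<alpha> * s powr - \<alpha>)"
      using assms B_pos C_pos theta alpha by (intro mult_left_mono powr_minus_ge) auto
    then show ?thesis using I2 unfolding y_def by (simp add: ac_simps)
  qed
  ultimately have "norm (G s w - G s v) \<le> B * C * T powr \<theta> * y + (B * c3 * T powr (2 * \<alpha> + \<theta>) * y + B * (C / \<theta>) * T powr \<alpha> * y)"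
    by (auto intro!: norm_triangle_le add_mono)
  then show ?thesis unfolding D2_def y_def by (simp add: algebra_simps)
qed

section \<open>Hoelder continuity of \<open>G\<close> as a path in L2\<close>

definition "b1 = 2 / (1 - 2 * \<alpha>) + 2 / (1 - 2 * \<alpha>)"
definition "b2 = 2 / (1 - (2 * \<alpha> + 2 * \<theta>)) + 2 / (1 - 2 * \<alpha>)"

lemma b_nonneg: "0 \<le> b1" "0 \<le> b2"
  unfolding b1_def b2_def using alpha theta by auto

lemma nn_integral_G_square:
  assumes "0 \<le> u" "u < v" "v \<le> T"
  shows "(\<integral>\<^sup>+s\<in>{u..v}. ennreal ((norm (G s v))\<^sup>2) \<partial>lborel) \<le> ennreal (D1\<^sup>2 * (b1 * v powr - (2 * \<alpha>) * (v - u) powr (1 - 2 * \<alpha>)))"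
proof -
  have "(\<integral>\<^sup>+s\<in>{u..v}. ennreal ((norm (G s v))\<^sup>2) \<partial>lborel)
    \<le> (\<integral>\<^sup>+s. ennreal (D1\<^sup>2) * (ennreal (s powr - (2 * \<alpha>) * (v - s) powr - (2 * \<alpha>)) * indicator {u..v} s) \<partial>lborel)"
  proof (rule nn_integral_mono)
    fix s
    show "ennreal ((norm (G s v))\<^sup>2) * indicator {u..v} s
      \<le> ennreal (D1\<^sup>2) * (ennreal (s powr - (2 * \<alpha>) * (v - s) powr - (2 * \<alpha>)) * indicator {u..v} s)"
    proof (cases "0 < s \<and> s < v")
      case True
      then have "(norm (G s v))\<^sup>2 \<le> (D1 * (s powr - \<alpha> * (v - s) powr - \<alpha>))\<^sup>2"
        using assms by (intro power_mono norm_G_le) auto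
      also have "\<dots> = D1\<^sup>2 * (s powr - (2 * \<alpha>) * (v - s) powr - (2 * \<alpha>))"
        by (simp add: power_mult_distrib powr_square)
      finally show ?thesis by (auto simp: ennreal_mult'[symmetric] indicator_def intro!: ennreal_leI)
    qed (use G_eq_0[of v s] G_eq_0'[of s v] in \<open>auto simp: not_less\<close>)
  qed
  also have "\<dots> = ennreal (D1\<^sup>2) * (\<integral>\<^sup>+s\<in>{u..v}. ennreal (s powr - (2 * \<alpha>) * (v - s) powr - (2 * \<alpha>)) \<partial>lborel)"
    by (rule nn_integral_cmult) measurable
  also have "\<dots> \<le> ennreal (D1\<^sup>2) * ennreal (b1 * v powr - (2 * \<alpha>) * (v - u) powr (1 - 2 * \<alpha>))"
    unfolding b1_def using assms alpha by (intro mult_left_mono nn_integral_powr_beta_le) auto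
  finally show ?thesis by (simp add: ennreal_mult'[symmetric])
qed

lemma nn_integral_G_square_UNIV:
  assumes "0 \<le> v" "v \<le> T"
  shows "(\<integral>\<^sup>+s. ennreal ((norm (G s v))\<^sup>2) \<partial>lborel) \<le> ennreal (D1\<^sup>2 * (b1 * v powr (1 - 4 * \<alpha>)))"
proof (cases "v = 0")
  case True
  then have "G s v = 0" for s using G_eq_0[of v s] G_eq_0'[of s v] by (cases "s \<le> 0") auto
  then show ?thesis by simp
next
  case False
  have "(\<integral>\<^sup>+s. ennreal ((norm (G s v))\<^sup>2) \<partial>lborel) = (\<integral>\<^sup>+s\<in>{0..v}. ennreal ((norm (G s v))\<^sup>2) \<partial>lborel)"
    by (intro nn_integral_cong) (use G_eq_0[of v] G_eq_0' in \<open>auto simp: indicator_def\<close>)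
  also have "\<dots> \<le> ennreal (D1\<^sup>2 * (b1 * v powr - (2 * \<alpha>) * (v - 0) powr (1 - 2 * \<alpha>)))"
    using False assms by (intro nn_integral_G_square) auto
  also have "b1 * v powr - (2 * \<alpha>) * (v - 0) powr (1 - 2 * \<alpha>) = b1 * v powr (1 - 4 * \<alpha>)"
    by (simp add: mult.assoc powr_add[symmetric])
  finally show ?thesis .
qed

text \<open>In the two cases of the estimate below, \<open>D1\<^sup>2 * b1\<close> occurs with
  coefficient 1 and 8, so 9 serves both. The power of \<open>T\<close> absorbs the surplus exponent
  \<open>1 - 2 * \<alpha> - 2 * \<theta>\<close>, and the summand 1 makes the constant
  positive.\<close>

definition "hoelder_const = sqrt (T powr (1 - 2 * \<alpha> - 2 * \<theta>) * (2 * D2\<^sup>2 * b2 + 9 * D1\<^sup>2 * b1) + 1)"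

lemma hoelder_const:
  "0 < hoelder_const" "hoelder_const\<^sup>2 = T powr (1 - 2 * \<alpha> - 2 * \<theta>) * (2 * D2\<^sup>2 * b2 + 9 * D1\<^sup>2 * b1) + 1"
proof -
  have "0 < T powr (1 - 2 * \<alpha> - 2 * \<theta>) * (2 * D2\<^sup>2 * b2 + 9 * D1\<^sup>2 * b1) + 1"
    using b_nonneg by (intro add_nonneg_pos mult_nonneg_nonneg add_nonneg_nonneg) auto
  then show "0 < hoelder_const" "hoelder_const\<^sup>2 = T powr (1 - 2 * \<alpha> - 2 * \<theta>) * (2 * D2\<^sup>2 * b2 + 9 * D1\<^sup>2 * b1) + 1"
    unfolding hoelder_const_def by auto
qed

text \<open>If \<open>v\<close> is at least \<open>w / 2\<close>, the range of \<open>s\<close>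
  splits at \<open>v\<close>. Below \<open>v\<close> the pointwise increment bound is square
  integrable since \<open>2 * \<alpha> + 2 * \<theta> < 1\<close>; above it only
  \<open>G s w\<close> is left, on a short interval. If \<open>v\<close> is smaller,
  \<open>w - v\<close> is comparable with \<open>w\<close>, and the separate norms suffice: they are
  of order \<open>w powr (1 - 4 * \<alpha>)\<close>, which contains the weight
  \<open>w powr - (2 * \<alpha>)\<close>, the rate \<open>w powr (2 * \<theta>)\<close> and a
  bounded factor.\<close>

lemma nn_integral_G_diff_square:
  assumes "0 \<le> v" "v < w" "w \<le> T"
  shows "(\<integral>\<^sup>+s. ennreal ((norm (G s w - G s v))\<^sup>2) \<partial>lborel) \<le> ennreal ((hoelder_const * w powr - \<alpha> * (w - v) powr \<theta>)\<^sup>2)"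
proof -
  define Tc where "Tc = T powr (1 - 2 * \<alpha> - 2 * \<theta>)"
  define y where "y = w powr - (2 * \<alpha>) * (w - v) powr (2 * \<theta>)"
  have Tc: "0 \<le> Tc" and y: "0 \<le> y" unfolding Tc_def y_def by auto
  have target: "(hoelder_const * w powr - \<alpha> * (w - v) powr \<theta>)\<^sup>2 = (Tc * (2 * D2\<^sup>2 * b2 + 9 * D1\<^sup>2 * b1) + 1) * y"
    unfolding y_def Tc_def hoelder_const(2)[symmetric] by (simp add: power_mult_distrib powr_square)
  have Tc_ge: "x powr (1 - 2 * \<alpha> - 2 * \<theta>) \<le> Tc" if "0 \<le> x" "x \<le> T" for x
    unfolding Tc_def using that theta by (intro powr_mono2) auto
  show ?thesis
  proof (cases "w / 2 \<le> v")
    case True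
    then have v: "0 < v" using assms by auto
    have 1: "(\<integral>\<^sup>+s\<in>{0..v}. ennreal (D2\<^sup>2 * (w - v) powr (2 * \<theta>) * (s powr - (2 * \<alpha>) * (v - s) powr - (2 * \<alpha> + 2 * \<theta>))) \<partial>lborel)
      \<le> ennreal (2 * D2\<^sup>2 * b2 * Tc * y)"
    proof -
      have "(\<integral>\<^sup>+s\<in>{0..v}. ennreal (D2\<^sup>2 * (w - v) powr (2 * \<theta>) * (s powr - (2 * \<alpha>) * (v - s) powr - (2 * \<alpha> + 2 * \<theta>))) \<partial>lborel)
        = (\<integral>\<^sup>+s. ennreal (D2\<^sup>2 * (w - v) powr (2 * \<theta>)) * (ennreal (s powr - (2 * \<alpha>) * (v - s) powr - (2 * \<alpha> + 2 * \<theta>)) * indicator {0..v} s) \<partial>lborel)"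
        by (intro nn_integral_cong) (simp add: ennreal_mult' mult.assoc)
      also have "\<dots> = ennreal (D2\<^sup>2 * (w - v) powr (2 * \<theta>)) * (\<integral>\<^sup>+s\<in>{0..v}. ennreal (s powr - (2 * \<alpha>) * (v - s) powr - (2 * \<alpha> + 2 * \<theta>)) \<partial>lborel)"
        by (rule nn_integral_cmult) measurable
      also have "\<dots> \<le> ennreal (D2\<^sup>2 * (w - v) powr (2 * \<theta>)) * ennreal (b2 * v powr - (2 * \<alpha>) * (v - 0) powr (1 - (2 * \<alpha> + 2 * \<theta>)))"
        unfolding b2_def using alpha theta v by (intro mult_left_mono nn_integral_powr_beta_le) auto
      also have "\<dots> = ennreal (D2\<^sup>2 * (w - v) powr (2 * \<theta>) * (b2 * v powr - (2 * \<alpha>) * v powr (1 - 2 * \<alpha> - 2 * \<theta>)))"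
        by (simp add: ennreal_mult'[symmetric] algebra_simps)
      also have "\<dots> \<le> ennreal (D2\<^sup>2 * (w - v) powr (2 * \<theta>) * (b2 * (2 * w powr - (2 * \<alpha>)) * Tc))"
      proof (intro ennreal_leI mult_left_mono mult_mono)
        have "v powr - (2 * \<alpha>) \<le> (w / 2) powr - (2 * \<alpha>)"
          using True alpha assms by (intro powr_mono2') auto
        also have "\<dots> = 2 powr (2 * \<alpha>) * w powr - (2 * \<alpha>)"
          using assms by (simp add: powr_divide powr_minus field_simps)
        also have "\<dots> \<le> 2 powr 1 * w powr - (2 * \<alpha>)"
          using alpha by (intro mult_right_mono powr_mono) auto
        finally show "v powr - (2 * \<alpha>) \<le> 2 * w powr - (2 * \<alpha>)" by simp
      qed (use b_nonneg v assms Tc_ge[of v] in auto)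
      finally show ?thesis unfolding y_def by (simp add: ac_simps)
    qed
    have 2: "(\<integral>\<^sup>+s\<in>{v..w}. ennreal ((norm (G s w))\<^sup>2) \<partial>lborel) \<le> ennreal (D1\<^sup>2 * b1 * Tc * y)"
    proof -
      have "(\<integral>\<^sup>+s\<in>{v..w}. ennreal ((norm (G s w))\<^sup>2) \<partial>lborel) \<le> ennreal (D1\<^sup>2 * (b1 * w powr - (2 * \<alpha>) * (w - v) powr (1 - 2 * \<alpha>)))"
        using assms by (intro nn_integral_G_square) auto
      also have "(w - v) powr (1 - 2 * \<alpha>) = (w - v) powr (1 - 2 * \<alpha> - 2 * \<theta>) * (w - v) powr (2 * \<theta>)"
        by (simp add: powr_add[symmetric])
      also have "ennreal (D1\<^sup>2 * (b1 * w powr - (2 * \<alpha>) * \<dots>)) \<le> ennreal (D1\<^sup>2 * (b1 * w powr - (2 * \<alpha>) * (Tc * (w - v) powr (2 * \<theta>))))"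
        using assms b_nonneg Tc_ge[of "w - v"] by (intro ennreal_leI mult_left_mono mult_right_mono) auto
      finally show ?thesis unfolding y_def by (simp add: ac_simps)
    qed
    have "(\<integral>\<^sup>+s. ennreal ((norm (G s w - G s v))\<^sup>2) \<partial>lborel)
      \<le> (\<integral>\<^sup>+s. ennreal (D2\<^sup>2 * (w - v) powr (2 * \<theta>) * (s powr - (2 * \<alpha>) * (v - s) powr - (2 * \<alpha> + 2 * \<theta>))) * indicator {0..v} s
        + ennreal ((norm (G s w))\<^sup>2) * indicator {v..w} s \<partial>lborel)"
    proof (rule nn_integral_mono)
      fix s
      consider "s \<le> 0" | "0 < s" "s < v" | "v \<le> s" "s \<le> w" | "w < s" by linarith
      then show "ennreal ((norm (G s w - G s v))\<^sup>2)
        \<le> ennreal (D2\<^sup>2 * (w - v) powr (2 * \<theta>) * (s powr - (2 * \<alpha>) * (v - s) powr - (2 * \<alpha> + 2 * \<theta>))) * indicator {0..v} s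
        + ennreal ((norm (G s w))\<^sup>2) * indicator {v..w} s"
      proof cases
        case 2
        then have "(norm (G s w - G s v))\<^sup>2 \<le> (D2 * (s powr - \<alpha> * (v - s) powr (- \<alpha> - \<theta>) * (w - v) powr \<theta>))\<^sup>2"
          using assms by (intro power_mono norm_G_diff_le) auto
        also have "\<dots> = D2\<^sup>2 * (w - v) powr (2 * \<theta>) * (s powr - (2 * \<alpha>) * (v - s) powr - (2 * \<alpha> + 2 * \<theta>))"
          by (simp add: power_mult_distrib powr_square algebra_simps)
        finally show ?thesis using 2 by (auto intro!: add_increasing2 ennreal_leI)
      qed (use assms G_eq_0 G_eq_0' in \<open>auto intro!: add_increasing\<close>)
    qed
    also have "\<dots> = (\<integral>\<^sup>+s\<in>{0..v}. ennreal (D2\<^sup>2 * (w - v) powr (2 * \<theta>) * (s powr - (2 * \<alpha>) * (v - s) powr - (2 * \<alpha> + 2 * \<theta>))) \<partial>lborel)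
      + (\<integral>\<^sup>+s\<in>{v..w}. ennreal ((norm (G s w))\<^sup>2) \<partial>lborel)"
      by (rule nn_integral_add) measurable
    also have "\<dots> \<le> ennreal (2 * D2\<^sup>2 * b2 * Tc * y) + ennreal (D1\<^sup>2 * b1 * Tc * y)"
      by (intro add_mono 1 2)
    also have "\<dots> = ennreal (2 * D2\<^sup>2 * b2 * Tc * y + D1\<^sup>2 * b1 * Tc * y)"
      using Tc y b_nonneg by (simp add: ennreal_plus)
    also have "\<dots> \<le> ennreal ((Tc * (2 * D2\<^sup>2 * b2 + 9 * D1\<^sup>2 * b1) + 1) * y)"
      using Tc y b_nonneg by (intro ennreal_leI) (simp add: algebra_simps add_increasing2)
    finally show ?thesis unfolding target .
  next
    case False
    have G: "(\<integral>\<^sup>+s. ennreal ((norm (G s x))\<^sup>2) \<partial>lborel) \<le> ennreal (D1\<^sup>2 * b1 * (2 * Tc * y))" if "0 \<le> x" "x \<le> w" for x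
    proof -
      have "(\<integral>\<^sup>+s. ennreal ((norm (G s x))\<^sup>2) \<partial>lborel) \<le> ennreal (D1\<^sup>2 * (b1 * x powr (1 - 4 * \<alpha>)))"
        using that assms by (intro nn_integral_G_square_UNIV) auto
      also have "\<dots> \<le> ennreal (D1\<^sup>2 * (b1 * (2 * Tc * y)))"
      proof (intro ennreal_leI mult_left_mono)
        have "x powr (1 - 4 * \<alpha>) \<le> w powr (1 - 4 * \<alpha>)"
          using that alpha by (intro powr_mono2) auto
        also have "\<dots> = w powr (1 - 2 * \<alpha> - 2 * \<theta>) * (w powr - (2 * \<alpha>) * w powr (2 * \<theta>))"
          by (simp add: powr_add[symmetric])
        also have "\<dots> \<le> Tc * (w powr - (2 * \<alpha>) * (2 * (w - v) powr (2 * \<theta>)))"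
        proof (intro mult_mono)
          have "w powr (2 * \<theta>) \<le> (2 * (w - v)) powr (2 * \<theta>)"
            using False assms theta alpha by (intro powr_mono2) auto
          also have "\<dots> = 2 powr (2 * \<theta>) * (w - v) powr (2 * \<theta>)"
            using assms by (subst powr_mult) auto
          also have "\<dots> \<le> 2 powr 1 * (w - v) powr (2 * \<theta>)"
            using theta alpha by (intro mult_right_mono powr_mono) auto
          finally show "w powr (2 * \<theta>) \<le> 2 * (w - v) powr (2 * \<theta>)" by simp
        qed (use Tc_ge[of w] assms Tc in auto)
        finally show "x powr (1 - 4 * \<alpha>) \<le> 2 * Tc * y" unfolding y_def by (simp add: ac_simps)
      qed (use b_nonneg in auto)
      finally show ?thesis by (simp add: mult.assoc)
    qed
    have "(\<integral>\<^sup>+s. ennreal ((norm (G s w - G s v))\<^sup>2) \<partial>lborel)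
      \<le> (\<integral>\<^sup>+s. 2 * ennreal ((norm (G s w))\<^sup>2) + 2 * ennreal ((norm (G s v))\<^sup>2) \<partial>lborel)"
    proof (rule nn_integral_mono)
      fix s
      show "ennreal ((norm (G s w - G s v))\<^sup>2) \<le> 2 * ennreal ((norm (G s w))\<^sup>2) + 2 * ennreal ((norm (G s v))\<^sup>2)"
        using ennreal_leI[OF norm_diff_square_le[of "G s w" "G s v"]] by (simp add: ennreal_mult')
    qed
    also have "\<dots> = 2 * (\<integral>\<^sup>+s. ennreal ((norm (G s w))\<^sup>2) \<partial>lborel) + 2 * (\<integral>\<^sup>+s. ennreal ((norm (G s v))\<^sup>2) \<partial>lborel)"
      by (simp add: nn_integral_add nn_integral_cmult)
    also have "\<dots> \<le> 2 * ennreal (D1\<^sup>2 * b1 * (2 * Tc * y)) + 2 * ennreal (D1\<^sup>2 * b1 * (2 * Tc * y))"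
      using assms by (intro add_mono mult_left_mono G) auto
    also have "\<dots> = ennreal (2 * (D1\<^sup>2 * b1 * (2 * Tc * y)) + 2 * (D1\<^sup>2 * b1 * (2 * Tc * y)))"
    proof -
      have "2 * ennreal z + 2 * ennreal z = ennreal (2 * z + 2 * z)" if "0 \<le> z" for z
        using that by (subst ennreal_plus) (auto simp: ennreal_mult')
      then show ?thesis using Tc y b_nonneg by simp
    qed
    also have "\<dots> \<le> ennreal ((Tc * (2 * D2\<^sup>2 * b2 + 9 * D1\<^sup>2 * b1) + 1) * y)"
      using Tc y b_nonneg by (intro ennreal_leI) (simp add: algebra_simps add_increasing2 add_increasing)
    finally show ?thesis unfolding target .
  qed
qed

sublocale G: hoelder_family T \<alpha> C \<theta> K k lborel G hoelder_const
proof
  show "case_prod G \<in> borel_measurable (lborel \<Otimes>\<^sub>M borel)"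
    by measurable
qed (use hoelder_const nn_integral_G_diff_square in auto)

end

section \<open>Convergence of the kernel sums\<close>

lemma interval_partition_nth:
  assumes "is_partition T \<pi>"
  shows "interval_partition T ((!) \<pi>) (length \<pi> - 1)"
proof
  have ne: "\<pi> \<noteq> []" using assms by (simp add: is_partition_def)
  show "\<pi> ! 0 = 0" using assms ne by (simp add: is_partition_def hd_conv_nth)
  show "\<pi> ! (length \<pi> - 1) = T" using assms ne by (simp add: is_partition_def last_conv_nth)
  show "\<pi> ! i < \<pi> ! Suc i" if "i < length \<pi> - 1" for i
    using assms that by (auto simp: is_partition_def sorted_wrt_iff_nth_less)
qed

lemma mesh_ge: "i < length \<pi> - 1 \<Longrightarrow> \<pi> ! Suc i - \<pi> ! i \<le> mesh \<pi>"
  unfolding mesh_def by (intro Max_ge) auto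

lemma filterlim_mesh: "filterlim mesh (at_right 0) (mesh_to_0 T)" if "0 < T"
proof -
  have pos: "0 < mesh \<pi>" if \<pi>: "is_partition T \<pi>" for \<pi>
  proof -
    interpret interval_partition T "(!) \<pi>" "length \<pi> - 1" by (rule interval_partition_nth[OF \<pi>])
    have "length \<pi> - 1 \<noteq> 0" using p_0 p_n \<open>0 < T\<close> by (metis less_irrefl)
    then show ?thesis using mesh_ge[of 0 \<pi>] p_less[of 0] by auto
  qed
  show ?thesis
    unfolding filterlim_at_right_to_0 filterlim_def le_filter_def eventually_filtermap
  proof (intro allI impI)
    fix P :: "real \<Rightarrow> bool" assume "eventually P (at_right 0)"
    then obtain b where "0 < b" "\<And>y. 0 < y \<Longrightarrow> y < b \<Longrightarrow> P y"
      unfolding eventually_at_right_field by auto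
    then show "eventually (\<lambda>\<pi>. P (mesh \<pi>)) (mesh_to_0 T)"
      unfolding eventually_mesh_to_0 using pos by blast
  qed
qed

text \<open>The function in L2 that represents \<open>step_approx ind f \<pi>\<close>: it is
  \<open>K*\<close> of the step function with the values of \<open>f\<close> at the left
  ends.\<close>

definition kernel_sum :: "(real \<Rightarrow> real \<Rightarrow> real) \<Rightarrow> real list \<Rightarrow> (real \<Rightarrow> 'e::real_vector) \<Rightarrow> real \<Rightarrow> 'e" where
  "kernel_sum K \<pi> f t = (\<Sum>i<length \<pi> - 1. (K (\<pi> ! Suc i) t - K (\<pi> ! i) t) *\<^sub>R f (\<pi> ! i))"

context hoelder_integrand
begin

text \<open>\<open>F\<close> is \<open>(K* \<otimes> K*) \<psi>\<close>, computed by applying \<open>K*\<close> to the first variable and then to the second.\<close>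

definition F :: "real \<Rightarrow> real \<Rightarrow> 'e" where
  "F s t = Kstar T (G s) t"

lemma kernel_sum_G_error:
  assumes \<pi>: "is_partition T \<pi>"
  shows "(\<integral>\<^sup>+t. \<integral>\<^sup>+s. ennreal ((norm (kernel_sum K \<pi> (G s) t - F s t))\<^sup>2) \<partial>lborel \<partial>lborel)
    \<le> ennreal (hoelder_const\<^sup>2 * err_const T * mesh_mod (mesh \<pi>))"
proof -
  interpret P: interval_partition T "(!) \<pi>" "length \<pi> - 1" by (rule interval_partition_nth[OF \<pi>])
  have n: "length \<pi> - 1 \<noteq> 0" using P.p_0 P.p_n T_pos by (metis less_irrefl)
  interpret Q: hoelder_family_partition T \<alpha> C \<theta> K k lborel G hoelder_const "(!) \<pi>" "length \<pi> - 1" "mesh \<pi>"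
    by unfold_locales (use mesh_ge[of _ \<pi>] P.p_less[of 0] n in \<open>force+\<close>)
  have "Q.step_sum T f t = kernel_sum K \<pi> f t" for f :: "real \<Rightarrow> 'e" and t
    unfolding Q.step_sum_def kernel_sum_def
  proof (rule sum.cong)
    fix i assume "i \<in> {..<length \<pi> - 1}"
    then have "min T (\<pi> ! i) = \<pi> ! i" "min T (\<pi> ! Suc i) = \<pi> ! Suc i"
      using P.p_range[of i] P.p_range[of "Suc i"] by (auto intro!: min_absorb2)
    then show "(K (min T (\<pi> ! Suc i)) t - K (min T (\<pi> ! i)) t) *\<^sub>R f (\<pi> ! i) = (K (\<pi> ! Suc i) t - K (\<pi> ! i) t) *\<^sub>R f (\<pi> ! i)"
      by simp
  qed simp
  then show ?thesis using Q.L2_error[of T] T_pos unfolding F_def by simp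
qed

section \<open>Convergence for a single path\<close>

definition "K_mod v \<delta> = (C / \<theta>)\<^sup>2 * (v powr (1 - (2 * \<alpha> + 2 * \<theta>)) / (1 - (2 * \<alpha> + 2 * \<theta>))) * \<delta> powr (2 * \<theta>)
   + C\<^sup>2 * (b1 * v powr - (2 * \<alpha>) * \<delta> powr (1 - 2 * \<alpha>))"

text \<open>Below \<open>v\<close> the increment bound for \<open>K\<close> applies, and its square
  is integrable since \<open>2 * \<alpha> + 2 * \<theta> < 1\<close>. Between \<open>v\<close> and
  \<open>c\<close> only \<open>K c\<close> is left and the interval is short. The bound depends on
  \<open>v\<close>, which is harmless because paths are treated for one \<open>v\<close> at a
  time.\<close>

lemma nn_integral_K_diff_square:
  assumes "0 < v" "v < c" "c \<le> T" "c - v \<le> \<delta>"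
  shows "(\<integral>\<^sup>+t. ennreal ((K c t - K v t)\<^sup>2) \<partial>lborel) \<le> ennreal (K_mod v \<delta>)"
proof -
  define a where "a = (C / \<theta>)\<^sup>2 * \<delta> powr (2 * \<theta>)"
  define q where "q = 2 * \<alpha> + 2 * \<theta>"
  have q: "q < 1" unfolding q_def using theta by auto
  have "(\<integral>\<^sup>+t. ennreal ((K c t - K v t)\<^sup>2) \<partial>lborel)
     \<le> (\<integral>\<^sup>+t. ennreal a * (ennreal ((v - t) powr - q) * indicator {0..v} t) + ennreal ((K c t)\<^sup>2) * indicator {v..c} t \<partial>lborel)"
  proof (rule nn_integral_mono)
    fix t
    consider "t \<le> 0" | "0 < t" "t < v" | "v \<le> t" "t \<le> c" | "c < t" by linarith
    then show "ennreal ((K c t - K v t)\<^sup>2)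
       \<le> ennreal a * (ennreal ((v - t) powr - q) * indicator {0..v} t) + ennreal ((K c t)\<^sup>2) * indicator {v..c} t"
    proof cases
      case 2
      then have "\<bar>K c t - K v t\<bar> \<le> C / \<theta> * (v - t) powr (- \<alpha> - \<theta>) * (c - v) powr \<theta>"
        using assms by (intro K_increment_le) auto
      also have "\<dots> \<le> C / \<theta> * (v - t) powr (- \<alpha> - \<theta>) * \<delta> powr \<theta>"
        using assms C_pos alpha theta by (intro mult_left_mono powr_mono2) auto
      finally have "\<bar>K c t - K v t\<bar>\<^sup>2 \<le> (C / \<theta> * (v - t) powr (- \<alpha> - \<theta>) * \<delta> powr \<theta>)\<^sup>2"
        by (intro power_mono) auto
      also have "\<dots> = a * (v - t) powr (2 * (- \<alpha> - \<theta>))"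
        unfolding a_def power_mult_distrib powr_square by simp
      also have "2 * (- \<alpha> - \<theta>) = - q" unfolding q_def by simp
      finally show ?thesis using 2 assms unfolding a_def
        by (auto simp: ennreal_mult'[symmetric] intro!: ennreal_leI)
    next
      case 3
      then have "K v t = 0" by (intro K_eq_0) auto
      then show ?thesis using 3 by (auto intro!: add_increasing)
    qed (use K_eq_0[of t] assms in auto)
  qed
  also have "\<dots> = ennreal a * (\<integral>\<^sup>+t\<in>{0..v}. ennreal ((v - t) powr - q) \<partial>lborel) + (\<integral>\<^sup>+t\<in>{v..c}. ennreal ((K c t)\<^sup>2) \<partial>lborel)"
    by (simp add: nn_integral_add nn_integral_cmult)
  also have "\<dots> \<le> ennreal a * ennreal ((v - 0) powr (1 - q) / (1 - q))
      + ennreal (C\<^sup>2 * (b1 * c powr - (2 * \<alpha>) * (c - v) powr (1 - 2 * \<alpha>)))"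
    unfolding b1_def using assms q
    by (intro add_mono mult_left_mono nn_integral_K_square) (auto simp: nn_integral_powr_left)
  also have "\<dots> \<le> ennreal a * ennreal ((v - 0) powr (1 - q) / (1 - q))
      + ennreal (C\<^sup>2 * (b1 * v powr - (2 * \<alpha>) * \<delta> powr (1 - 2 * \<alpha>)))"
    using assms b_nonneg alpha
    by (intro add_left_mono ennreal_leI mult_left_mono mult_mono powr_mono2 powr_mono2') auto
  also have "\<dots> = ennreal (K_mod v \<delta>)"
    unfolding K_mod_def a_def q_def using b_nonneg theta by (simp add: ennreal_mult'[symmetric] ennreal_plus[symmetric] ac_simps del: ennreal_plus)
  finally show ?thesis .
qed

definition "path_mod v \<delta> = 2 * ((B * T powr \<alpha>)\<^sup>2 * err_const v * mesh_mod \<delta>) + 2 * (B\<^sup>2 * K_mod v \<delta>)"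

lemma path_mod_tendsto: "(path_mod v \<longlongrightarrow> 0) (at_right 0)"
proof -
  have pw: "((\<lambda>x. x powr a) \<longlongrightarrow> 0) (at_right 0)" if "0 < a" for a :: real
    using that by (intro tendsto_eq_intros) (auto intro!: eventually_mono[OF eventually_at_right_less])
  have "(K_mod v \<longlongrightarrow> (C / \<theta>)\<^sup>2 * (v powr (1 - (2 * \<alpha> + 2 * \<theta>)) / (1 - (2 * \<alpha> + 2 * \<theta>))) * 0
   + C\<^sup>2 * (b1 * v powr - (2 * \<alpha>) * 0)) (at_right 0)"
    unfolding K_mod_def using alpha theta by (intro tendsto_intros pw) auto
  then have "(path_mod v \<longlongrightarrow> 2 * ((B * T powr \<alpha>)\<^sup>2 * err_const v * 0) + 2 * (B\<^sup>2 * 0)) (at_right 0)"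
    unfolding path_mod_def by (intro tendsto_intros mesh_mod_tendsto) auto
  then show ?thesis by simp
qed

text \<open>The path with its indicator is not Hoelder. Therefore \<open>L2_error\<close> is applied
  to \<open>\<phi> _ v\<close> itself with the sum stopped at \<open>v\<close>, over a one-point
  measure space, and the unstopped sum is compared with the stopped one separately.\<close>

lemma kernel_sum_path_error:
  assumes \<pi>: "is_partition T \<pi>" and v: "0 < v" "v \<le> T"
  shows "(\<integral>\<^sup>+t. ennreal ((norm (kernel_sum K \<pi> (\<lambda>u. indicator {0..<v} u *\<^sub>R \<phi> u v) t - G t v))\<^sup>2) \<partial>lborel)
    \<le> ennreal (path_mod v (mesh \<pi>))"
proof -
  interpret P: interval_partition T "(!) \<pi>" "length \<pi> - 1" by (rule interval_partition_nth[OF \<pi>])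
  have n: "length \<pi> - 1 \<noteq> 0" using P.p_0 P.p_n T_pos by (metis less_irrefl)
  have mesh: "0 < mesh \<pi>" using mesh_ge[of 0 \<pi>] P.p_less[of 0] n by force
  interpret unit: finite_measure "count_space (UNIV :: unit set)"
    by (rule finite_measure_count_space) simp
  interpret U: hoelder_family_partition T \<alpha> C \<theta> K k "count_space (UNIV :: unit set)" "\<lambda>_ r. \<phi> r v" "B * T powr \<alpha>"
      "(!) \<pi>" "length \<pi> - 1" "mesh \<pi>"
  proof
    show "(\<lambda>(_, r). \<phi> r v) \<in> borel_measurable (count_space (UNIV :: unit set) \<Otimes>\<^sub>M borel)"
      by measurable
    show "0 < B * T powr \<alpha>" using B_pos T_pos by simp
    fix u w assume uw: "0 \<le> u" "u < w" "w \<le> T"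
    have "norm (\<phi> w v - \<phi> u v) \<le> B * (w - u) powr \<theta> * 1"
      using phi_hoelder_1[of w v u] uw by simp
    \<comment> \<open>The path satisfies an unweighted Hoelder bound; the weight demanded by the
      family is inserted at the cost of \<open>T powr \<alpha>\<close>.\<close>
    also have "\<dots> \<le> B * (w - u) powr \<theta> * (T powr \<alpha> * w powr - \<alpha>)"
      using uw B_pos alpha by (intro mult_left_mono powr_minus_ge) auto
    finally have "(norm (\<phi> w v - \<phi> u v))\<^sup>2 \<le> (B * T powr \<alpha> * w powr - \<alpha> * (w - u) powr \<theta>)\<^sup>2"
      by (intro power_mono) (auto simp: ac_simps)
    then show "(\<integral>\<^sup>+s. ennreal ((norm (\<phi> w v - \<phi> u v))\<^sup>2) \<partial>count_space (UNIV :: unit set))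
      \<le> ennreal ((B * T powr \<alpha> * w powr - \<alpha> * (w - u) powr \<theta>)\<^sup>2)"
      by (simp add: nn_integral_count_space_finite ennreal_leI)
  next
    show "\<pi> ! Suc i - \<pi> ! i \<le> mesh \<pi>" if "i < length \<pi> - 1" for i using mesh_ge[OF that] .
  qed (rule mesh)
  define S where "S = U.step_sum v (\<lambda>u. \<phi> u v)"
  define f where "f u = indicator {0..<v} u *\<^sub>R \<phi> u v" for u
  have S: "(\<integral>\<^sup>+t. ennreal ((norm (S t - G t v))\<^sup>2) \<partial>lborel) \<le> ennreal ((B * T powr \<alpha>)\<^sup>2 * err_const v * mesh_mod (mesh \<pi>))"
    using U.L2_error[OF v] unfolding S_def G_def by (simp add: nn_integral_count_space_finite)
  have [measurable]: "S \<in> borel_measurable borel" unfolding S_def U.step_sum_def[abs_def] by measurable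
  have [measurable]: "kernel_sum K \<pi> f \<in> borel_measurable borel" unfolding kernel_sum_def[abs_def] by measurable
  have jump: "(\<integral>\<^sup>+t. ennreal ((norm (kernel_sum K \<pi> f t - S t))\<^sup>2) \<partial>lborel) \<le> ennreal (B\<^sup>2 * K_mod v (mesh \<pi>))"
  proof -
    \<comment> \<open>\<open>S\<close> belongs to the partition refined by \<open>v\<close>: the two sums differ only in the cell containing \<open>v\<close>.\<close>
    define J where "J i t = (if \<pi> ! i < v \<and> v < \<pi> ! Suc i then (K (\<pi> ! Suc i) t - K v t) *\<^sub>R \<phi> (\<pi> ! i) v else 0)" for i t
    have J: "kernel_sum K \<pi> f t - S t = (\<Sum>i<length \<pi> - 1. J i t)" for t
      unfolding kernel_sum_def S_def U.step_sum_def sum_subtractf[symmetric]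
    proof (rule sum.cong)
      fix i assume "i \<in> {..<length \<pi> - 1}"
      then show "(K (\<pi> ! Suc i) t - K (\<pi> ! i) t) *\<^sub>R f (\<pi> ! i)
         - (K (min v (\<pi> ! Suc i)) t - K (min v (\<pi> ! i)) t) *\<^sub>R \<phi> (\<pi> ! i) v = J i t"
        using P.p_less[of i] P.p_range[of i] unfolding f_def J_def
        by (auto simp: min_def indicator_def algebra_simps)
    qed simp
    show ?thesis
    proof (cases "\<exists>i<length \<pi> - 1. \<pi> ! i < v \<and> v < \<pi> ! Suc i")
      case False
      then have "J i t = 0" if "i < length \<pi> - 1" for i t unfolding J_def using that by auto
      then show ?thesis unfolding J by simp
    next
      case True
      then obtain i where i: "i < length \<pi> - 1" "\<pi> ! i < v" "v < \<pi> ! Suc i" by auto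
      have "kernel_sum K \<pi> f t - S t = (\<Sum>j<length \<pi> - 1. if j = i then J i t else 0)" for t
        unfolding J using P.cell_disjoint[OF i(1) _ _ less_imp_le[OF i(2)] i(3)]
        by (intro sum.cong) (auto simp: J_def)
      then have "kernel_sum K \<pi> f t - S t = (K (\<pi> ! Suc i) t - K v t) *\<^sub>R \<phi> (\<pi> ! i) v" for t
        using i unfolding J_def by simp
      then have "(\<integral>\<^sup>+t. ennreal ((norm (kernel_sum K \<pi> f t - S t))\<^sup>2) \<partial>lborel)
        \<le> (\<integral>\<^sup>+t. ennreal (B\<^sup>2) * ennreal ((K (\<pi> ! Suc i) t - K v t)\<^sup>2) \<partial>lborel)"
        using phi_le by (intro nn_integral_mono) (auto simp: power_mult_distrib ennreal_mult'[symmetric] mult.commute[of "B\<^sup>2"] intro!: ennreal_leI mult_left_mono power_mono)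
      also have "\<dots> = ennreal (B\<^sup>2) * (\<integral>\<^sup>+t. ennreal ((K (\<pi> ! Suc i) t - K v t)\<^sup>2) \<partial>lborel)"
        by (rule nn_integral_cmult) measurable
      also have "\<dots> \<le> ennreal (B\<^sup>2) * ennreal (K_mod v (mesh \<pi>))"
        using i v P.p_range[of "Suc i"] mesh_ge[OF i(1)] by (intro mult_left_mono nn_integral_K_diff_square) auto
      finally show ?thesis by (simp add: ennreal_mult'[symmetric])
    qed
  qed
  have "(\<integral>\<^sup>+t. ennreal ((norm (kernel_sum K \<pi> f t - G t v))\<^sup>2) \<partial>lborel)
    \<le> (\<integral>\<^sup>+t. 2 * ennreal ((norm (S t - G t v))\<^sup>2) + 2 * ennreal ((norm (kernel_sum K \<pi> f t - S t))\<^sup>2) \<partial>lborel)"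
  proof (rule nn_integral_mono)
    fix t
    have "(norm (kernel_sum K \<pi> f t - G t v))\<^sup>2 \<le> 2 * (norm (S t - G t v))\<^sup>2 + 2 * (norm (kernel_sum K \<pi> f t - S t))\<^sup>2"
      using norm_diff_square_le[of "S t - G t v" "S t - kernel_sum K \<pi> f t"] by (simp add: norm_minus_commute)
    then have "ennreal ((norm (kernel_sum K \<pi> f t - G t v))\<^sup>2) \<le> ennreal (2 * (norm (S t - G t v))\<^sup>2 + 2 * (norm (kernel_sum K \<pi> f t - S t))\<^sup>2)"
      by (rule ennreal_leI)
    then show "ennreal ((norm (kernel_sum K \<pi> f t - G t v))\<^sup>2)
      \<le> 2 * ennreal ((norm (S t - G t v))\<^sup>2) + 2 * ennreal ((norm (kernel_sum K \<pi> f t - S t))\<^sup>2)"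
      by (simp add: ennreal_mult')
  qed
  also have "\<dots> = 2 * (\<integral>\<^sup>+t. ennreal ((norm (S t - G t v))\<^sup>2) \<partial>lborel) + 2 * (\<integral>\<^sup>+t. ennreal ((norm (kernel_sum K \<pi> f t - S t))\<^sup>2) \<partial>lborel)"
    by (simp add: nn_integral_add nn_integral_cmult)
  also have "\<dots> \<le> 2 * ennreal ((B * T powr \<alpha>)\<^sup>2 * err_const v * mesh_mod (mesh \<pi>)) + 2 * ennreal (B\<^sup>2 * K_mod v (mesh \<pi>))"
    by (intro add_mono mult_left_mono S jump) auto
  also have "\<dots> = ennreal (path_mod v (mesh \<pi>))"
  proof -
    have "0 \<le> err_const v" unfolding err_const_def using alpha by auto
    moreover have "0 \<le> mesh_mod (mesh \<pi>)" unfolding mesh_mod_def by simp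
    moreover have "0 \<le> K_mod v (mesh \<pi>)" unfolding K_mod_def using b_nonneg theta by auto
    ultimately show ?thesis unfolding path_mod_def
      by (subst ennreal_plus) (auto simp: ennreal_mult')
  qed
  finally show ?thesis unfolding f_def .
qed

end

section \<open>Borel versions of the kernel\<close>

lemma AE_lborel_ex_in_interval:
  fixes a b :: real
  assumes "AE t in lborel. P t" "a < b"
  shows "\<exists>t. a < t \<and> t < b \<and> P t"
proof (rule ccontr)
  assume none: "\<not> ?thesis"
  have "AE t in lborel. t \<notin> {a<..<b}"
    using assms(1) by eventually_elim (use none in auto)
  then have "{a<..<b} \<in> null_sets lborel"
    by (subst AE_iff_null_sets) auto
  then show False using assms(2) by auto
qed

text \<open>
  Kernels are only Lebesgue measurable on the square, so that their sections in \<open>s\<close> need not be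
  measurable. Since \<open>t \<mapsto> K t s\<close> is continuous on \<open>(s, T]\<close>, it is determined by countably many
  sections \<open>s \<mapsto> K t s\<close>, and outside a null set of \<open>s\<close> it agrees with a jointly Borel function.
\<close>

lemma borel_version:
  fixes K :: "real \<Rightarrow> real \<Rightarrow> real"
  assumes T: "0 < T"
    and K: "set_borel_measurable lebesgue ({0..T} \<times> {0..T}) (\<lambda>(t, s). K t s)"
    and K_diff: "\<And>s t. 0 < s \<Longrightarrow> s < t \<Longrightarrow> t \<le> T \<Longrightarrow> (\<lambda>x. K x s) differentiable (at t within {0..T})"
  obtains N where "N \<in> null_sets lborel"
    "(\<lambda>(t, s). if 0 < s \<and> s < t \<and> t \<le> T \<and> s \<notin> N then K t s else 0) \<in> borel_measurable borel"
    "(\<lambda>(t, s). if 0 < s \<and> s < t \<and> t \<le> T \<and> s \<notin> N then dK T K t s else 0) \<in> borel_measurable borel"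
proof -
  define f where "f x = indicator ({0..T} \<times> {0..T}) x *\<^sub>R K (fst x) (snd x)" for x
  have "f \<in> borel_measurable lebesgue"
    using K unfolding f_def[abs_def] set_borel_measurable_def by (simp add: case_prod_beta)
  then obtain f' where f'[measurable]: "f' \<in> borel_measurable lborel" and eq: "AE x in lborel. f x = f' x"
    using completion_ex_borel_measurable_real by blast
  define good where "good t \<longleftrightarrow> (AE s in lborel. f (t, s) = f' (t, s))" for t
  have "AE x in lborel \<Otimes>\<^sub>M lborel. f x = f' x" by (subst lborel_prod) (rule eq)
  then have good: "AE t in lborel. good t"
    unfolding good_def by (rule lborel_pair.AE_pair)
  \<comment> \<open>One good point is chosen in every interval of a grid of width
    \<open>1 / Suc n\<close>. It exists because almost every \<open>t\<close> is good.\<close>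
  define d where "d n j = (SOME d. real_of_int (j - 1) / real (Suc n) < d \<and> d < real_of_int j / real (Suc n) \<and> good d)" for n j
  have "real_of_int (j - 1) / real (Suc n) < d n j \<and> d n j < real_of_int j / real (Suc n) \<and> good (d n j)" for n j
    unfolding d_def
    by (rule someI_ex, rule AE_lborel_ex_in_interval[OF good]) (simp add: divide_strict_right_mono)
  then have d: "\<And>n j. real_of_int (j - 1) / real (Suc n) < d n j"
      "\<And>n j. d n j < real_of_int j / real (Suc n)" "\<And>n j. good (d n j)"
    by blast+
  \<comment> \<open>Only countably many sections are involved, so a single null set of
    \<open>s\<close> serves all of them.\<close>
  have "AE s in lborel. \<forall>n j. f (d n j, s) = f' (d n j, s)"
    using d(3) unfolding good_def by (simp add: AE_all_countable)
  then obtain N where N: "{s. \<not> (\<forall>n j. f (d n j, s) = f' (d n j, s))} \<subseteq> N" "N \<in> null_sets lborel"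
    by (auto elim!: AE_E simp: null_sets_def)
  have [measurable]: "N \<in> sets borel" using N(2) by auto
  \<comment> \<open>A good point within \<open>2 / Suc n\<close> to the left of \<open>t\<close>:
    the grid interval indexed by the floor of \<open>Suc n * t\<close> ends at or before
    \<open>t\<close>. Approach from the left keeps the points in the domain even at
    \<open>t = T\<close>.\<close>
  define q where "q n t = d n \<lfloor>real (Suc n) * t\<rfloor>" for n t
  have q_less: "q n t < t" for n t
  proof -
    have "q n t < real_of_int \<lfloor>real (Suc n) * t\<rfloor> / real (Suc n)" unfolding q_def by (rule d(2))
    also have "\<dots> \<le> t" by (simp add: divide_le_eq mult.commute)
    finally show ?thesis .
  qed
  have q_greater: "t - 2 / real (Suc n) < q n t" for n t
  proof -
    have "t - 2 / real (Suc n) = (real (Suc n) * t - 2) / real (Suc n)" by (simp add: diff_divide_distrib)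
    also have "\<dots> \<le> real_of_int (\<lfloor>real (Suc n) * t\<rfloor> - 1) / real (Suc n)"
      by (intro divide_right_mono) (simp_all, linarith)
    also have "\<dots> < q n t" unfolding q_def by (rule d(1))
    finally show ?thesis .
  qed
  have q_lim: "(\<lambda>n. q n t) \<longlonglongrightarrow> t" for t
  proof (rule tendsto_sandwich[where f = "\<lambda>n. t - 2 / real (Suc n)" and h = "\<lambda>_. t"])
    have "(\<lambda>n. t - 2 * (1 / real (Suc n))) \<longlonglongrightarrow> t - 2 * 0"
      by (intro tendsto_intros LIMSEQ_Suc lim_1_over_n)
    then show "(\<lambda>n. t - 2 / real (Suc n)) \<longlonglongrightarrow> t" by simp
  qed (simp_all add: less_imp_le q_less q_greater del: of_nat_Suc)
  have [measurable]: "q n \<in> borel_measurable borel" for n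
  proof -
    have "(\<lambda>t. \<lfloor>real (Suc n) * t\<rfloor>) \<in> measurable borel (count_space UNIV)" by measurable
    from measurable_compose[OF this, of "d n" borel] show ?thesis unfolding q_def by simp
  qed
  define c where "c t s \<longleftrightarrow> 0 < s \<and> s < t \<and> t \<le> T \<and> s \<notin> N" for t s
  define K' where "K' x = (if c (fst x) (snd x) then K (fst x) (snd x) else 0)" for x
  have c_meas: "{x. c (fst x) (snd x)} \<in> sets (borel :: (real \<times> real) measure)"
  proof -
    have "{x \<in> space (borel :: (real \<times> real) measure). 0 < snd x \<and> snd x < fst x \<and> fst x \<le> T \<and> snd x \<notin> N} \<in> sets borel"
      unfolding borel_prod[symmetric] by measurable
    then show ?thesis unfolding c_def by simp
  qed
  have K_lim: "(\<lambda>n. f' (q n t, s)) \<longlonglongrightarrow> K t s" if "c t s" for t s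
  proof -
    have c: "0 < s" "s < t" "t \<le> T" "s \<notin> N" using that unfolding c_def by auto
    have "eventually (\<lambda>n. s < q n t) sequentially"
      using order_tendstoD(1)[OF q_lim[of t] c(2)] .
    then have ev: "eventually (\<lambda>n. K (q n t) s = f' (q n t, s)) sequentially"
    proof eventually_elim
      fix n assume "s < q n t"
      moreover have "f (q n t, s) = f' (q n t, s)" using N(1) c(4) unfolding q_def by auto
      ultimately show "K (q n t) s = f' (q n t, s)" using c q_less[of n t] unfolding f_def by simp
    qed
    have "continuous (at t within {0..T}) (\<lambda>x. K x s)"
      using K_diff[OF c(1-3)] by (rule differentiable_imp_continuous_within)
    then have "((\<lambda>x. K x s) \<longlongrightarrow> K t s) (at t within {0..T})" by (simp add: continuous_within)
    moreover have "filterlim (\<lambda>n. q n t) (at t within {0..T}) sequentially"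
      unfolding filterlim_at
    proof (intro conjI q_lim)
      show "\<forall>\<^sub>F n in sequentially. q n t \<in> {0..T} \<and> q n t \<noteq> t"
        using order_tendstoD(1)[OF q_lim[of t] c(2)]
      proof eventually_elim
        fix n assume "s < q n t"
        then show "q n t \<in> {0..T} \<and> q n t \<noteq> t" using c q_less[of n t] by auto
      qed
    qed
    ultimately have "(\<lambda>n. K (q n t) s) \<longlonglongrightarrow> K t s" by (rule filterlim_compose)
    then show ?thesis using ev by (rule Lim_transform_eventually)
  qed
  have K'[measurable]: "K' \<in> borel_measurable borel"
  proof (rule borel_measurable_LIMSEQ_real)
    show "(\<lambda>n. if c (fst x) (snd x) then f' (q n (fst x), snd x) else 0) \<longlonglongrightarrow> K' x" for x
      unfolding K'_def using K_lim[of "fst x" "snd x"] by auto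
    show "(\<lambda>x. if c (fst x) (snd x) then f' (q n (fst x), snd x) else 0) \<in> borel_measurable borel" for n
    proof (rule measurable_If)
      have "(\<lambda>x :: real \<times> real. (q n (fst x), snd x)) \<in> measurable (borel \<Otimes>\<^sub>M borel) (borel \<Otimes>\<^sub>M borel)"
        by measurable
      then have "(\<lambda>x :: real \<times> real. (q n (fst x), snd x)) \<in> borel_measurable (borel :: (real \<times> real) measure)"
        by (simp add: borel_prod)
      from measurable_compose[OF this, of f'] f' show "(\<lambda>x. f' (q n (fst x), snd x)) \<in> borel_measurable borel"
        by simp
    qed (use c_meas in auto)
  qed
  \<comment> \<open>The difference quotients use steps to the left, so that they also give the
    one-sided derivative at \<open>t = T\<close>.\<close>
  have dK_lim: "(\<lambda>n. (K (t - 1 / real (Suc n)) s - K t s) / ((t - 1 / real (Suc n)) - t)) \<longlonglongrightarrow> dK T K t s" if "c t s" for t s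
  proof -
    have c: "0 < s" "s < t" "t \<le> T" using that unfolding c_def by auto
    have "((\<lambda>x. K x s) has_vector_derivative dK T K t s) (at t within {0..T})"
      using K_diff[OF c] unfolding dK_def vector_derivative_works .
    then have D: "((\<lambda>y. (K y s - K t s) / (y - t)) \<longlongrightarrow> dK T K t s) (at t within {0..T})"
      by (simp add: has_real_derivative_iff_has_vector_derivative[symmetric] has_field_derivative_iff)
    have lim: "(\<lambda>n. t - 1 / real (Suc n)) \<longlonglongrightarrow> t"
    proof -
      have "(\<lambda>n. t - 1 / real (Suc n)) \<longlonglongrightarrow> t - 0"
        by (intro tendsto_intros LIMSEQ_Suc lim_1_over_n)
      then show ?thesis by simp
    qed
    have "filterlim (\<lambda>n. t - 1 / real (Suc n)) (at t within {0..T}) sequentially"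
      unfolding filterlim_at
    proof (intro conjI lim)
      show "\<forall>\<^sub>F n in sequentially. t - 1 / real (Suc n) \<in> {0..T} \<and> t - 1 / real (Suc n) \<noteq> t"
        using order_tendstoD(1)[OF lim c(2)]
      proof eventually_elim
        fix n assume "s < t - 1 / real (Suc n)"
        moreover have "t - 1 / real (Suc n) < t" by simp
        ultimately show "t - 1 / real (Suc n) \<in> {0..T} \<and> t - 1 / real (Suc n) \<noteq> t"
          unfolding atLeastAtMost_iff using c by linarith
      qed
    qed
    from filterlim_compose[OF D this] show ?thesis .
  qed
  define k' where "k' x = (if c (fst x) (snd x) then dK T K (fst x) (snd x) else 0)" for x
  have k': "k' \<in> borel_measurable borel"
  proof (rule borel_measurable_LIMSEQ_real)
    show "(\<lambda>n. if c (fst x) (snd x) then (K' (fst x - 1 / real (Suc n), snd x) - K' x) / ((fst x - 1 / real (Suc n)) - fst x) else 0) \<longlonglongrightarrow> k' x" for x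
    proof (cases "c (fst x) (snd x)")
      case True
      obtain t s where x: "x = (t, s)" by (cases x)
      have c: "c t s" using True x by simp
      have lim: "(\<lambda>n. t - 1 / real (Suc n)) \<longlonglongrightarrow> t - 0"
        by (intro tendsto_intros LIMSEQ_Suc lim_1_over_n)
      have "\<forall>\<^sub>F n in sequentially. s < t - 1 / real (Suc n)"
        using order_tendstoD(1)[OF lim, of s] c unfolding c_def by simp
      then have ev: "\<forall>\<^sub>F n in sequentially. (K (t - 1 / real (Suc n)) s - K t s) / ((t - 1 / real (Suc n)) - t)
        = (K' (t - 1 / real (Suc n), s) - K' x) / ((t - 1 / real (Suc n)) - t)"
      proof eventually_elim
        fix n assume *: "s < t - 1 / real (Suc n)"
        have "0 < 1 / real (Suc n)" by simp
        then have "c (t - 1 / real (Suc n)) s" using c * unfolding c_def by linarith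
        then show "(K (t - 1 / real (Suc n)) s - K t s) / ((t - 1 / real (Suc n)) - t)
          = (K' (t - 1 / real (Suc n), s) - K' x) / ((t - 1 / real (Suc n)) - t)"
          unfolding K'_def using c x by simp
      qed
      show ?thesis
        using Lim_transform_eventually[OF dK_lim[OF c] ev] c x unfolding k'_def by simp
    qed (simp add: k'_def)
    show "(\<lambda>x. if c (fst x) (snd x) then (K' (fst x - 1 / real (Suc n), snd x) - K' x) / ((fst x - 1 / real (Suc n)) - fst x) else 0) \<in> borel_measurable borel" for n
    proof (rule measurable_If)
      have "(\<lambda>x :: real \<times> real. (fst x - 1 / real (Suc n), snd x)) \<in> measurable (borel \<Otimes>\<^sub>M borel) (borel \<Otimes>\<^sub>M borel)"
        by measurable
      then have "(\<lambda>x :: real \<times> real. (fst x - 1 / real (Suc n), snd x)) \<in> borel_measurable (borel :: (real \<times> real) measure)"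
        by (simp add: borel_prod)
      from measurable_compose[OF this K'] have "(\<lambda>x. K' (fst x - 1 / real (Suc n), snd x)) \<in> borel_measurable borel" .
      moreover have "(fst :: real \<times> real \<Rightarrow> real) \<in> borel_measurable borel"
        by (intro borel_measurable_continuous_onI continuous_intros)
      ultimately show "(\<lambda>x. (K' (fst x - 1 / real (Suc n), snd x) - K' x) / ((fst x - 1 / real (Suc n)) - fst x)) \<in> borel_measurable borel"
        using K' by measurable
    qed (use c_meas in auto)
  qed
  show ?thesis
    by (rule that[OF N(2)]) (use K' k' in \<open>simp_all add: K'_def[abs_def] k'_def[abs_def] c_def case_prod_beta cong: if_cong\<close>)
qed

text \<open>Increments of \<open>K\<close> are recovered from the derivative by the fundamental
  theorem for the gauge integral, since the derivative need not be continuous. Away from the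
  diagonal it is bounded and, for \<open>s\<close> outside \<open>N\<close>, Borel in
  \<open>r\<close>, so the gauge integral is also the Lebesgue integral. For \<open>s\<close> in
  \<open>N\<close> both sides are 0.\<close>

lemma singular_kernel_version:
  fixes K :: "real \<Rightarrow> real \<Rightarrow> real"
  assumes T: "0 < T"
    and K: "set_borel_measurable lebesgue ({0..T} \<times> {0..T}) (\<lambda>(t, s). K t s)"
    and K_diff: "\<And>s t. 0 < s \<Longrightarrow> s < t \<Longrightarrow> t \<le> T \<Longrightarrow> (\<lambda>x. K x s) differentiable (at t within {0..T})"
    and K_bound: "\<And>s t. 0 < s \<Longrightarrow> s < t \<Longrightarrow> t \<le> T \<Longrightarrow> \<bar>K t s\<bar> \<le> C * s powr - \<alpha> * (t - s) powr - \<alpha>"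
    and dK_bound: "\<And>s t. 0 < s \<Longrightarrow> s < t \<Longrightarrow> t \<le> T \<Longrightarrow> \<bar>dK T K t s\<bar> \<le> C * (t - s) powr (- \<alpha> - 1)"
    and const: "0 < \<alpha>" "\<alpha> < 1 / 4" "0 < C" "\<alpha> < \<theta>" "\<theta> < 1 / 2 - \<alpha>"
  obtains N where "N \<in> null_sets lborel"
    "singular_kernel T \<alpha> C \<theta> (\<lambda>t s. if 0 < s \<and> s < t \<and> t \<le> T \<and> s \<notin> N then K t s else 0)
      (\<lambda>t s. if 0 < s \<and> s < t \<and> t \<le> T \<and> s \<notin> N then dK T K t s else 0)"
proof -
  obtain N where N: "N \<in> null_sets lborel"
    and K': "(\<lambda>(t, s). if 0 < s \<and> s < t \<and> t \<le> T \<and> s \<notin> N then K t s else 0) \<in> borel_measurable borel"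
    and k': "(\<lambda>(t, s). if 0 < s \<and> s < t \<and> t \<le> T \<and> s \<notin> N then dK T K t s else 0) \<in> borel_measurable borel"
    using borel_version[OF T K K_diff] by blast
  show ?thesis
  proof (rule that[OF N], unfold_locales)
    fix a b s :: real assume s: "0 < s" "s < a" "a \<le> b" "b \<le> T"
    define g where "g r = (if 0 < s \<and> s < r \<and> r \<le> T \<and> s \<notin> N then dK T K r s else 0)" for r
    have [measurable]: "g \<in> borel_measurable borel"
      unfolding g_def using measurable_compose[OF _ k', of "\<lambda>r. (r, s)" borel] by simp
    show "(\<integral>r. indicator {a..b} r * (if 0 < s \<and> s < r \<and> r \<le> T \<and> s \<notin> N then dK T K r s else 0) \<partial>lborel)
      = (if 0 < s \<and> s < b \<and> b \<le> T \<and> s \<notin> N then K b s else 0) - (if 0 < s \<and> s < a \<and> a \<le> T \<and> s \<notin> N then K a s else 0)"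
    proof (cases "s \<in> N")
      case False
      have "((\<lambda>r. dK T K r s) has_integral K b s - K a s) {a..b}"
      proof (rule fundamental_theorem_of_calculus[OF s(3)])
        fix x assume x: "x \<in> {a..b}"
        then have "((\<lambda>r. K r s) has_vector_derivative dK T K x s) (at x within {0..T})"
          using K_diff[of s x] s unfolding dK_def vector_derivative_works by auto
        then show "((\<lambda>r. K r s) has_vector_derivative dK T K x s) (at x within {a..b})"
          by (rule has_vector_derivative_within_subset) (use s in auto)
      qed
      then have "(g has_integral K b s - K a s) {a..b}"
        by (rule has_integral_eq[rotated]) (use s False in \<open>auto simp: g_def\<close>)
      then have *: "((\<lambda>r. indicator {a..b} r * g r) has_integral K b s - K a s) UNIV"
      proof (subst (asm) has_integral_restrict_UNIV[symmetric])
        have eq: "(\<lambda>r. if r \<in> {a..b} then g r else 0) = (\<lambda>r. indicator {a..b} r * g r)"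
          by (auto simp: indicator_def)
        show "((\<lambda>r. if r \<in> {a..b} then g r else 0) has_integral K b s - K a s) UNIV \<Longrightarrow> ?thesis"
          unfolding eq .
      qed
      have int: "integrable lborel (\<lambda>r. indicator {a..b} r * g r)"
      proof (rule integrable_indicator_bounded)
        fix r assume r: "r \<in> {a..b}"
        then have "\<bar>dK T K r s\<bar> \<le> C * (r - s) powr (- \<alpha> - 1)" using s by (intro dK_bound) auto
        also have "\<dots> \<le> C * (a - s) powr (- \<alpha> - 1)"
          using r s const by (intro mult_left_mono powr_mono2') auto
        finally show "\<bar>g r\<bar> \<le> C * (a - s) powr (- \<alpha> - 1)" unfolding g_def using const by auto
      qed measurable
      have "integral\<^sup>L lborel (\<lambda>r. indicator {a..b} r * g r) = K b s - K a s"
        using has_integral_unique[OF has_integral_integral_lborel[OF int] *] .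
      then show ?thesis using s False unfolding g_def by simp
    qed simp
  qed (use T const K' k' K_bound dK_bound in auto)
qed

section \<open>Square integrable functions and isometries\<close>

lemma borel_measurable_lebesgue_AE_eq:
  fixes f g :: "'a::euclidean_space \<Rightarrow> 'b::topological_space"
  assumes g: "g \<in> borel_measurable borel" and eq: "AE x in lborel. f x = g x"
  shows "f \<in> borel_measurable lebesgue"
proof (rule borel_measurableI)
  fix S :: "'b set" assume "open S"
  have g': "g \<in> borel_measurable lebesgue" using g by (simp add: measurable_completion)
  have "AE x in lebesgue. f x = g x" using eq by (rule AE_completion)
  then have "AE x in lebesgue. x \<in> g -` S \<inter> space lebesgue \<longleftrightarrow> x \<in> f -` S \<inter> space lebesgue"
    by eventually_elim auto
  then show "f -` S \<inter> space lebesgue \<in> sets lebesgue"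
    by (rule completion.in_sets_AE) (use measurable_sets[OF g' borel_open[OF \<open>open S\<close>]] in auto)
qed

text \<open>Nothing is assumed of \<open>f\<close> beyond agreement with a Borel function outside a
  null set; measurability comes from completeness of Lebesgue measure. The integrals in
  \<open>cov\<close>, \<open>AK\<close>, \<open>BK\<close> and in the norm formula are moved to
  Borel integrands in this way.\<close>

lemma lebesgue_AE_eq:
  fixes f g :: "'a::euclidean_space \<Rightarrow> 'b::{banach, second_countable_topology}"
  assumes g: "g \<in> borel_measurable borel" and eq: "AE x in lborel. f x = g x"
  shows "integral\<^sup>L lebesgue f = integral\<^sup>L lborel g" "integrable lebesgue f \<longleftrightarrow> integrable lborel g"
proof -
  have f: "f \<in> borel_measurable lebesgue" by (rule borel_measurable_lebesgue_AE_eq[OF assms])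
  have g': "g \<in> borel_measurable lebesgue" "g \<in> borel_measurable lborel" using g by (simp_all add: measurable_completion)
  have eq': "AE x in lebesgue. f x = g x" using eq by (rule AE_completion)
  show "integral\<^sup>L lebesgue f = integral\<^sup>L lborel g"
    using integral_cong_AE[OF f g'(1) eq'] integral_completion[OF g'(2)] by simp
  show "integrable lebesgue f \<longleftrightarrow> integrable lborel g"
    using integrable_cong_AE[OF f g'(1) eq'] integrable_completion[OF g'(2)] by simp
qed

definition L2 :: "'a measure \<Rightarrow> ('a \<Rightarrow> 'e::euclidean_space) \<Rightarrow> bool" where
  "L2 M f \<longleftrightarrow> f \<in> borel_measurable M \<and> integrable M (\<lambda>x. (norm (f x))\<^sup>2)"

lemma L2_measurable[measurable_dest]: "L2 M f \<Longrightarrow> f \<in> borel_measurable M"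
  by (simp add: L2_def)

lemma L2_inner_integrable:
  assumes "L2 M f" "L2 M g"
  shows "integrable M (\<lambda>x. inner (f x) (g x))"
proof (rule Bochner_Integration.integrable_bound)
  have [measurable]: "f \<in> borel_measurable M" "g \<in> borel_measurable M" using assms by (auto simp: L2_def)
  show "(\<lambda>x. inner (f x) (g x)) \<in> borel_measurable M" by measurable
  show "integrable M (\<lambda>x. (norm (f x))\<^sup>2 + (norm (g x))\<^sup>2)"
    using assms by (auto simp: L2_def)
  show "AE x in M. norm (inner (f x) (g x)) \<le> norm ((norm (f x))\<^sup>2 + (norm (g x))\<^sup>2)"
  proof (rule AE_I2)
    fix x
    have "\<bar>inner (f x) (g x)\<bar> \<le> norm (f x) * norm (g x)" by (rule Cauchy_Schwarz_ineq2)
    also have "\<dots> \<le> (norm (f x))\<^sup>2 + (norm (g x))\<^sup>2"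
      using sum_squares_bound[of "norm (f x)" "norm (g x)"] mult_nonneg_nonneg[OF norm_ge_zero[of "f x"] norm_ge_zero[of "g x"]]
      unfolding mult.assoc by linarith
    finally show "norm (inner (f x) (g x)) \<le> norm ((norm (f x))\<^sup>2 + (norm (g x))\<^sup>2)" by simp
  qed
qed

lemma L2_add: "L2 M f \<Longrightarrow> L2 M g \<Longrightarrow> L2 M (\<lambda>x. f x + g x)"
proof -
  assume f: "L2 M f" and g: "L2 M g"
  have "integrable M (\<lambda>x. (norm (f x))\<^sup>2 + 2 * inner (f x) (g x) + (norm (g x))\<^sup>2)"
    using L2_inner_integrable[OF f g] f g by (auto simp: L2_def)
  moreover have "(norm (f x))\<^sup>2 + 2 * inner (f x) (g x) + (norm (g x))\<^sup>2 = (norm (f x + g x))\<^sup>2" for x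
    by (simp add: power2_norm_eq_inner inner_add inner_commute algebra_simps)
  ultimately show ?thesis using f g by (auto simp: L2_def)
qed

lemma L2_scaleR: "L2 M f \<Longrightarrow> L2 M (\<lambda>x. c *\<^sub>R f x)"
  by (auto simp: L2_def power_mult_distrib)

lemma L2_diff: "L2 M f \<Longrightarrow> L2 M g \<Longrightarrow> L2 M (\<lambda>x. f x - g x)"
  using L2_add[of M f "\<lambda>x. (-1) *\<^sub>R g x"] L2_scaleR[of M g "-1"] by simp

lemma L2_sum: "(\<And>i. i \<in> I \<Longrightarrow> L2 M (f i)) \<Longrightarrow> L2 M (\<lambda>x. \<Sum>i\<in>I. f i x)"
proof (induction I rule: infinite_finite_induct)
  case (insert i I)
  then show ?case by (simp add: L2_add)
qed (simp_all add: L2_def)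

lemma L2_of_nn_integral_le:
  assumes [measurable]: "f \<in> borel_measurable M" and le: "(\<integral>\<^sup>+x. ennreal ((norm (f x))\<^sup>2) \<partial>M) \<le> ennreal c"
  shows "L2 M f" and "0 \<le> c \<Longrightarrow> (\<integral>x. (norm (f x))\<^sup>2 \<partial>M) \<le> c"
proof -
  have int: "integrable M (\<lambda>x. (norm (f x))\<^sup>2)"
    by (rule integrableI_bounded) (use le in \<open>auto intro: le_less_trans\<close>)
  then show "L2 M f" by (simp add: L2_def)
  show "(\<integral>x. (norm (f x))\<^sup>2 \<partial>M) \<le> c" if "0 \<le> c"
    using le that nn_integral_eq_integral[OF int] by simp
qed

lemma L2_triangle:
  assumes "L2 M f" "L2 M g" "L2 M u"
  shows "(\<integral>x. (norm (f x - g x))\<^sup>2 \<partial>M) \<le> 2 * (\<integral>x. (norm (f x - u x))\<^sup>2 \<partial>M) + 2 * (\<integral>x. (norm (g x - u x))\<^sup>2 \<partial>M)"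
proof -
  have int: "integrable M (\<lambda>x. (norm (f x - u x))\<^sup>2)" "integrable M (\<lambda>x. (norm (g x - u x))\<^sup>2)" "integrable M (\<lambda>x. (norm (f x - g x))\<^sup>2)"
    using L2_diff[OF assms(1,3)] L2_diff[OF assms(2,3)] L2_diff[OF assms(1,2)] by (auto simp: L2_def)
  have "(\<integral>x. (norm (f x - g x))\<^sup>2 \<partial>M) \<le> (\<integral>x. 2 * (norm (f x - u x))\<^sup>2 + 2 * (norm (g x - u x))\<^sup>2 \<partial>M)"
  proof (rule integral_mono)
    show "(norm (f x - g x))\<^sup>2 \<le> 2 * (norm (f x - u x))\<^sup>2 + 2 * (norm (g x - u x))\<^sup>2" for x
      using norm_diff_square_le[of "f x - u x" "g x - u x"] by simp
  qed (use int in auto)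
  then show ?thesis using int by simp
qed

lemma L2_inner_le:
  assumes "L2 M f" "L2 M g"
  shows "\<bar>\<integral>x. inner (f x) (g x) \<partial>M\<bar> \<le> sqrt (\<integral>x. (norm (f x))\<^sup>2 \<partial>M) * sqrt (\<integral>x. (norm (g x))\<^sup>2 \<partial>M)"
proof -
  have [measurable]: "f \<in> borel_measurable M" "g \<in> borel_measurable M" using assms by (auto simp: L2_def)
  have f: "(\<integral>\<^sup>+x. (ennreal (norm (f x)))\<^sup>2 \<partial>M) = ennreal (\<integral>x. (norm (f x))\<^sup>2 \<partial>M)"
   and g: "(\<integral>\<^sup>+x. (ennreal (norm (g x)))\<^sup>2 \<partial>M) = ennreal (\<integral>x. (norm (g x))\<^sup>2 \<partial>M)"
    using assms by (auto simp: L2_def ennreal_power nn_integral_eq_integral)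
  have "ennreal \<bar>\<integral>x. inner (f x) (g x) \<partial>M\<bar> \<le> (\<integral>\<^sup>+x. ennreal \<bar>inner (f x) (g x)\<bar> \<partial>M)"
    using integral_norm_bound_ennreal[OF L2_inner_integrable[OF assms]] by simp
  also have "\<dots> \<le> (\<integral>\<^sup>+x. ennreal (norm (f x)) * ennreal (norm (g x)) \<partial>M)"
    by (intro nn_integral_mono) (auto simp: ennreal_mult'[symmetric] intro!: ennreal_leI Cauchy_Schwarz_ineq2)
  finally have "(ennreal \<bar>\<integral>x. inner (f x) (g x) \<partial>M\<bar>)\<^sup>2 \<le> (\<integral>\<^sup>+x. ennreal (norm (f x)) * ennreal (norm (g x)) \<partial>M)\<^sup>2"
    by (rule power_mono) simp
  also have "\<dots> \<le> (\<integral>\<^sup>+x. (ennreal (norm (f x)))\<^sup>2 \<partial>M) * (\<integral>\<^sup>+x. (ennreal (norm (g x)))\<^sup>2 \<partial>M)"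
    by (rule Cauchy_Schwarz_nn_integral) auto
  finally have "\<bar>\<integral>x. inner (f x) (g x) \<partial>M\<bar>\<^sup>2 \<le> (\<integral>x. (norm (f x))\<^sup>2 \<partial>M) * (\<integral>x. (norm (g x))\<^sup>2 \<partial>M)"
    unfolding f g by (simp add: ennreal_power ennreal_mult'[symmetric])
  then show ?thesis by (simp add: real_sqrt_mult[symmetric] real_le_rsqrt)
qed

text \<open>Expansion around the limits gives three terms, each of which contains a factor tending
  to 0 and is bounded by Cauchy-Schwarz.\<close>

lemma L2_inner_tendsto:
  fixes f g :: "'p \<Rightarrow> 'a \<Rightarrow> 'e::euclidean_space"
  assumes ev: "eventually (\<lambda>p. L2 M (f p) \<and> L2 M (g p)) F" and uw: "L2 M u" "L2 M w"
    and f: "((\<lambda>p. \<integral>x. (norm (f p x - u x))\<^sup>2 \<partial>M) \<longlongrightarrow> 0) F"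
    and g: "((\<lambda>p. \<integral>x. (norm (g p x - w x))\<^sup>2 \<partial>M) \<longlongrightarrow> 0) F"
  shows "((\<lambda>p. \<integral>x. inner (f p x) (g p x) \<partial>M) \<longlongrightarrow> (\<integral>x. inner (u x) (w x) \<partial>M)) F"
proof -
  define a where "a p = sqrt (\<integral>x. (norm (f p x - u x))\<^sup>2 \<partial>M)" for p
  define b where "b p = sqrt (\<integral>x. (norm (g p x - w x))\<^sup>2 \<partial>M)" for p
  define nu where "nu = sqrt (\<integral>x. (norm (u x))\<^sup>2 \<partial>M)"
  define nw where "nw = sqrt (\<integral>x. (norm (w x))\<^sup>2 \<partial>M)"
  have a: "(a \<longlongrightarrow> 0) F" and b: "(b \<longlongrightarrow> 0) F"
    unfolding a_def b_def using tendsto_real_sqrt[OF f] tendsto_real_sqrt[OF g] by simp_all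
  have bound: "eventually (\<lambda>p. norm ((\<integral>x. inner (f p x) (g p x) \<partial>M) - (\<integral>x. inner (u x) (w x) \<partial>M)) \<le> a p * b p + a p * nw + nu * b p) F"
    using ev
  proof eventually_elim
    fix p assume "L2 M (f p) \<and> L2 M (g p)"
    then have p: "L2 M (f p)" "L2 M (g p)" by auto
    note d = L2_diff[OF p(1) uw(1)] L2_diff[OF p(2) uw(2)]
    have "(\<integral>x. inner (f p x) (g p x) \<partial>M) - (\<integral>x. inner (u x) (w x) \<partial>M)
       = (\<integral>x. inner (f p x) (g p x) - inner (u x) (w x) \<partial>M)"
      using L2_inner_integrable p uw by (intro Bochner_Integration.integral_diff[symmetric]) auto
    also have "\<dots> = (\<integral>x. inner (f p x - u x) (g p x - w x) + inner (f p x - u x) (w x) + inner (u x) (g p x - w x) \<partial>M)"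
      by (intro Bochner_Integration.integral_cong) (auto simp: inner_diff)
    also have "\<dots> = (\<integral>x. inner (f p x - u x) (g p x - w x) \<partial>M) + (\<integral>x. inner (f p x - u x) (w x) \<partial>M) + (\<integral>x. inner (u x) (g p x - w x) \<partial>M)"
      using L2_inner_integrable[OF d] L2_inner_integrable[OF d(1) uw(2)] L2_inner_integrable[OF uw(1) d(2)] by simp
    finally show "norm ((\<integral>x. inner (f p x) (g p x) \<partial>M) - (\<integral>x. inner (u x) (w x) \<partial>M)) \<le> a p * b p + a p * nw + nu * b p"
      unfolding a_def b_def nu_def nw_def
      using L2_inner_le[OF d] L2_inner_le[OF d(1) uw(2)] L2_inner_le[OF uw(1) d(2)] by simp
  qed
  have "((\<lambda>p. a p * b p + a p * nw + nu * b p) \<longlongrightarrow> 0 * 0 + 0 * nw + nu * 0) F"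
    by (intro tendsto_intros a b)
  then have "((\<lambda>p. (\<integral>x. inner (f p x) (g p x) \<partial>M) - (\<integral>x. inner (u x) (w x) \<partial>M)) \<longlongrightarrow> 0) F"
    using Lim_null_comparison[OF bound] by simp
  then show ?thesis by (simp add: Lim_null[symmetric])
qed

text \<open>Refinement of partitions by mesh is a filter and not a sequence, so completeness is put
  into the form of a Cauchy criterion along a filter.\<close>

lemma cauchy_filter_tendsto:
  fixes f :: "'p \<Rightarrow> 'h::{metric_space, complete_space}"
  assumes "F \<noteq> bot"
    and C: "\<And>e. 0 < e \<Longrightarrow> \<exists>P. eventually P F \<and> (\<forall>p q. P p \<and> P q \<longrightarrow> dist (f p) (f q) < e)"
  obtains l where "(f \<longlongrightarrow> l) F"
proof -
  have "cauchy_filter (filtermap f F)"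
    unfolding cauchy_filter_metric_filtermap using C by blast
  moreover have "complete (UNIV :: 'h set)"
    unfolding complete_def using Cauchy_convergent by (auto simp: convergent_def)
  moreover have "filtermap f F \<noteq> bot" using assms(1) by (simp add: filtermap_bot_iff)
  ultimately obtain l where "filtermap f F \<le> nhds l"
    unfolding complete_uniform by auto
  then show ?thesis using that by (simp add: filterlim_def)
qed

text \<open>Equal inner products give equal squared norms of differences, so convergence of
  \<open>rep\<close> in L2 makes \<open>step\<close> Cauchy. Only the two Gram matrices are
  compared; the limit \<open>u\<close> lives in L2 alone.\<close>

lemma isometry_tendsto:
  fixes step :: "'p \<Rightarrow> 'h::{real_inner, banach}" and rep :: "'p \<Rightarrow> 'a \<Rightarrow> 'e::euclidean_space"
  assumes F: "F \<noteq> bot" and P: "eventually P F"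
    and inner: "\<And>p q. P p \<Longrightarrow> P q \<Longrightarrow> inner (step p) (step q) = (\<integral>x. inner (rep p x) (rep q x) \<partial>M)"
    and rep: "\<And>p. P p \<Longrightarrow> L2 M (rep p)" and u: "L2 M u"
    and lim: "((\<lambda>p. \<integral>x. (norm (rep p x - u x))\<^sup>2 \<partial>M) \<longlongrightarrow> 0) F"
  obtains h where "(step \<longlongrightarrow> h) F"
proof (rule cauchy_filter_tendsto[OF F])
  fix e :: real assume e: "0 < e"
  define Q where "Q p \<longleftrightarrow> P p \<and> (\<integral>x. (norm (rep p x - u x))\<^sup>2 \<partial>M) < e\<^sup>2 / 4" for p
  have "eventually Q F"
    unfolding Q_def using P order_tendstoD(2)[OF lim, of "e\<^sup>2 / 4"] e by (auto intro: eventually_conj)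
  moreover have "dist (step p) (step q) < e" if "Q p" "Q q" for p q
  proof -
    have pq: "P p" "P q" using that by (auto simp: Q_def)
    note r = rep[OF pq(1)] rep[OF pq(2)]
    have "(norm (step p - step q))\<^sup>2 = inner (step p) (step p) - inner (step p) (step q) - inner (step q) (step p) + inner (step q) (step q)"
      by (simp add: power2_norm_eq_inner inner_diff)
    also have "\<dots> = (\<integral>x. inner (rep p x) (rep p x) - inner (rep p x) (rep q x) - inner (rep q x) (rep p x) + inner (rep q x) (rep q x) \<partial>M)"
      using pq by (simp add: inner L2_inner_integrable r)
    also have "\<dots> = (\<integral>x. (norm (rep p x - rep q x))\<^sup>2 \<partial>M)"
      by (intro Bochner_Integration.integral_cong) (auto simp: power2_norm_eq_inner inner_diff)
    also have "\<dots> \<le> 2 * (\<integral>x. (norm (rep p x - u x))\<^sup>2 \<partial>M) + 2 * (\<integral>x. (norm (rep q x - u x))\<^sup>2 \<partial>M)"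
      by (rule L2_triangle[OF r u])
    also have "\<dots> < e\<^sup>2" using that by (auto simp: Q_def)
    finally show ?thesis using e by (auto simp: dist_norm intro: power_less_imp_less_base)
  qed
  ultimately show "\<exists>P. eventually P F \<and> (\<forall>p q. P p \<and> P q \<longrightarrow> dist (step p) (step q) < e)"
    by blast
qed

section \<open>Realization in Hilbert spaces\<close>

lemma product_integral:
  fixes f g :: "real \<Rightarrow> real"
  assumes f: "integrable lborel f" and g: "integrable lborel g"
  shows "integrable (lborel \<Otimes>\<^sub>M lborel) (\<lambda>(s, t). f s * g t)"
    and "(\<integral>x. (case x of (s, t) \<Rightarrow> f s * g t) \<partial>(lborel \<Otimes>\<^sub>M lborel)) = integral\<^sup>L lborel f * integral\<^sup>L lborel g"
proof -
  have [measurable]: "f \<in> borel_measurable borel" "g \<in> borel_measurable borel" using f g by auto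
  show int: "integrable (lborel \<Otimes>\<^sub>M lborel) (\<lambda>(s, t). f s * g t)"
  proof (rule lborel_pair.Fubini_integrable)
    show "integrable lborel (\<lambda>x. \<integral>y. norm (case (x, y) of (s, t) \<Rightarrow> f s * g t) \<partial>lborel)"
      using f by (simp add: abs_mult)
  qed (use g in \<open>auto intro!: AE_I2\<close>)
  have "(\<integral>x. (case x of (s, t) \<Rightarrow> f s * g t) \<partial>(lborel \<Otimes>\<^sub>M lborel)) = (\<integral>s. (\<integral>t. f s * g t \<partial>lborel) \<partial>lborel)"
    using lborel_pair.integral_fst'[OF int] by simp
  then show "(\<integral>x. (case x of (s, t) \<Rightarrow> f s * g t) \<partial>(lborel \<Otimes>\<^sub>M lborel)) = integral\<^sup>L lborel f * integral\<^sup>L lborel g"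
    by simp
qed

lemma integral_double_sum:
  fixes f :: "nat \<Rightarrow> nat \<Rightarrow> 'a \<Rightarrow> real"
  assumes "\<And>i j. i < n \<Longrightarrow> j < m \<Longrightarrow> integrable M (f i j)"
  shows "(\<Sum>i<n. \<Sum>j<m. \<integral>x. f i j x \<partial>M) = (\<integral>x. (\<Sum>i<n. \<Sum>j<m. f i j x) \<partial>M)"
proof -
  have "(\<integral>x. (\<Sum>i<n. \<Sum>j<m. f i j x) \<partial>M) = (\<Sum>i<n. \<integral>x. (\<Sum>j<m. f i j x) \<partial>M)"
    by (rule Bochner_Integration.integral_sum) (use assms in auto)
  also have "\<dots> = (\<Sum>i<n. \<Sum>j<m. \<integral>x. f i j x \<partial>M)"
    by (intro sum.cong refl Bochner_Integration.integral_sum) (use assms in auto)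
  finally show ?thesis ..
qed

lemma column_component: "column j A $ i = A $ i $ j"
  by (simp add: column_def)

text \<open>The norm on matrices is the Frobenius norm; summation over columns corresponds to
  writing a matrix function as a sum of column paths tensored with basis directions.\<close>

lemma sum_inner_column:
  fixes A B :: "real ^ 'd ^ 'd"
  shows "(\<Sum>j\<in>UNIV. inner (column j A) (column j B)) = inner A B"
  unfolding inner_vec_def column_component inner_real_def by (rule sum.swap)

lemma norm_column_le: "(norm (column j A))\<^sup>2 \<le> (norm A)\<^sup>2" for A :: "real ^ 'd ^ 'd"
proof -
  have "(norm (column j A))\<^sup>2 = inner (column j A) (column j A)" by (simp add: power2_norm_eq_inner)
  also have "\<dots> \<le> (\<Sum>j\<in>UNIV. inner (column j A) (column j A))" by (rule member_le_sum) auto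
  also have "\<dots> = (norm A)\<^sup>2" by (simp add: sum_inner_column power2_norm_eq_inner)
  finally show ?thesis .
qed

lemma column_diff: "column j (A - B) = column j A - column j B" for A :: "real ^ 'n ^ 'm"
  by (simp add: vec_eq_iff column_component)

lemma borel_measurable_column[measurable (raw)]:
  fixes f :: "'a \<Rightarrow> real ^ 'd ^ 'd"
  assumes "f \<in> borel_measurable M"
  shows "(\<lambda>x. column j (f x)) \<in> borel_measurable M"
proof -
  have "continuous_on UNIV (\<lambda>A :: real ^ 'd ^ 'd. column j A)"
    unfolding column_def by (intro continuous_intros)
  from measurable_compose[OF assms borel_measurable_continuous_onI[OF this]] show ?thesis by simp
qed

lemma kernel_sum_column: "kernel_sum K \<pi> (\<lambda>u. column j (A u)) t = column j (kernel_sum K \<pi> A t)"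
  for A :: "real \<Rightarrow> real ^ 'n ^ 'm"
  unfolding kernel_sum_def by (simp add: vec_eq_iff column_component)

lemma eventually_is_partition: "eventually (is_partition T) (mesh_to_0 T)"
  unfolding eventually_mesh_to_0 by (intro exI[of _ 1]) auto

lemma partition_nth:
  assumes "is_partition T \<pi>" "i < length \<pi> - 1"
  shows "\<pi> ! i \<in> {0..T}" "\<pi> ! Suc i \<in> {0..T}"
proof -
  interpret interval_partition T "(!) \<pi>" "length \<pi> - 1" by (rule interval_partition_nth[OF assms(1)])
  show "\<pi> ! i \<in> {0..T}" "\<pi> ! Suc i \<in> {0..T}" using p_range[of i] p_range[of "Suc i"] assms(2) by auto
qed

section \<open>Square integrability of the kernel sums and of \<open>F\<close>\<close>

context hoelder_integrand
begin

lemma F_measurable[measurable (raw)]: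
  assumes [measurable]: "f \<in> borel_measurable M" "g \<in> borel_measurable M"
  shows "(\<lambda>x. F (f x) (g x)) \<in> borel_measurable M"
proof -
  have "(\<lambda>x. (\<integral>r. ((if r \<le> T then 1 else 0) * k r (g x)) *\<^sub>R (G (f x) r - G (f x) (g x)) \<partial>lborel)) \<in> borel_measurable M"
    by (rule lborel.borel_measurable_lebesgue_integral) measurable
  also have "(\<lambda>x. (\<integral>r. ((if r \<le> T then 1 else 0) * k r (g x)) *\<^sub>R (G (f x) r - G (f x) (g x)) \<partial>lborel))
    = (\<lambda>x. (\<integral>r. (indicator {..T} r * k r (g x)) *\<^sub>R (G (f x) r - G (f x) (g x)) \<partial>lborel))"
    by (simp only: indicator_def of_bool_def atMost_iff)
  finally have [measurable]: "(\<lambda>x. (\<integral>r. (indicator {..T} r * k r (g x)) *\<^sub>R (G (f x) r - G (f x) (g x)) \<partial>lborel)) \<in> borel_measurable M" .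
  show ?thesis unfolding F_def Kstar_def by measurable
qed

lemma kernel_sum_measurable[measurable (raw)]:
  assumes [measurable]: "f \<in> borel_measurable M" "\<And>i. i < length \<pi> - 1 \<Longrightarrow> (\<lambda>x. h x (\<pi> ! i)) \<in> borel_measurable M"
  shows "(\<lambda>x. kernel_sum K \<pi> (h x :: real \<Rightarrow> 'b::euclidean_space) (f x)) \<in> borel_measurable M"
  unfolding kernel_sum_def by (rule borel_measurable_sum) (use assms in measurable)

lemma K_L2:
  assumes "t \<in> {0..T}"
  shows "L2 lborel (K t)"
proof (cases "t = 0")
  case True
  then have "K t = (\<lambda>_. 0)" using K_eq_0[of _ t] by (auto simp: fun_eq_iff)
  then show ?thesis by (simp add: L2_def)
next
  case False
  have "(\<integral>\<^sup>+r. ennreal ((norm (K t r))\<^sup>2) \<partial>lborel) = (\<integral>\<^sup>+r\<in>{0..t}. ennreal ((K t r)\<^sup>2) \<partial>lborel)"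
    by (intro nn_integral_cong) (use K_eq_0[of _ t] in \<open>auto simp: indicator_def\<close>)
  also have "\<dots> \<le> ennreal (C\<^sup>2 * ((2 / (1 - 2 * \<alpha>) + 2 / (1 - 2 * \<alpha>)) * t powr - (2 * \<alpha>) * (t - 0) powr (1 - 2 * \<alpha>)))"
    by (rule nn_integral_K_square) (use False assms in auto)
  finally show ?thesis by (rule L2_of_nn_integral_le(1)[rotated]) measurable
qed

lemma K_diff_L2: "a \<in> {0..T} \<Longrightarrow> b \<in> {0..T} \<Longrightarrow> L2 lborel (\<lambda>t. K b t - K a t)"
  by (intro L2_diff K_L2)

lemma K_diff_mult_integrable:
  assumes "a \<in> {0..T}" "b \<in> {0..T}" "c \<in> {0..T}" "d \<in> {0..T}"
  shows "integrable lborel (\<lambda>t. (K b t - K a t) * (K d t - K c t))"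
  using L2_inner_integrable[OF K_diff_L2[OF assms(1,2)] K_diff_L2[OF assms(3,4)]] by simp

lemma kernel_sum_L2:
  assumes "is_partition T \<pi>"
  shows "L2 lborel (kernel_sum K \<pi> (f :: real \<Rightarrow> 'b::euclidean_space))"
  unfolding kernel_sum_def[abs_def]
proof (rule L2_sum)
  fix i assume i: "i \<in> {..<length \<pi> - 1}"
  have "L2 lborel (\<lambda>t. K (\<pi> ! Suc i) t - K (\<pi> ! i) t)"
    using partition_nth[OF assms, of i] i by (intro K_diff_L2) auto
  then show "L2 lborel (\<lambda>t. (K (\<pi> ! Suc i) t - K (\<pi> ! i) t) *\<^sub>R f (\<pi> ! i))"
    by (auto simp: L2_def power_mult_distrib)
qed

lemma G_L2:
  assumes "v \<in> {0..T}"
  shows "L2 lborel (\<lambda>s. G s v)"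
  by (rule L2_of_nn_integral_le(1)[OF _ nn_integral_G_square_UNIV]) (use assms in \<open>measurable, auto\<close>)

lemma kernel_sum_G_L2:
  assumes \<pi>: "is_partition T \<pi>"
  shows "L2 (lborel \<Otimes>\<^sub>M lborel) (\<lambda>(s, t). kernel_sum K \<pi> (G s) t)"
proof -
  have "L2 (lborel \<Otimes>\<^sub>M lborel) (\<lambda>x. \<Sum>i<length \<pi> - 1. (K (\<pi> ! Suc i) (snd x) - K (\<pi> ! i) (snd x)) *\<^sub>R G (fst x) (\<pi> ! i))"
  proof (rule L2_sum)
    fix i assume "i \<in> {..<length \<pi> - 1}"
    then have i: "\<pi> ! i \<in> {0..T}" "\<pi> ! Suc i \<in> {0..T}" using partition_nth[OF \<pi>, of i] by auto
    have "integrable (lborel \<Otimes>\<^sub>M lborel) (\<lambda>(s, t). (norm (G s (\<pi> ! i)))\<^sup>2 * (norm (K (\<pi> ! Suc i) t - K (\<pi> ! i) t))\<^sup>2)"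
      using G_L2[OF i(1)] K_diff_L2[OF i] unfolding L2_def by (intro product_integral(1)) auto
    then show "L2 (lborel \<Otimes>\<^sub>M lborel) (\<lambda>x. (K (\<pi> ! Suc i) (snd x) - K (\<pi> ! i) (snd x)) *\<^sub>R G (fst x) (\<pi> ! i))"
      unfolding L2_def by (auto simp: case_prod_beta' power_mult_distrib mult.commute)
  qed
  then show ?thesis unfolding kernel_sum_def by (simp add: case_prod_beta')
qed

lemma kernel_sum_F_L2_error:
  assumes \<pi>: "is_partition T \<pi>"
  shows "L2 (lborel \<Otimes>\<^sub>M lborel) (\<lambda>(s, t). kernel_sum K \<pi> (G s) t - F s t)" (is ?L2)
    and "(\<integral>x. (norm (case x of (s, t) \<Rightarrow> kernel_sum K \<pi> (G s) t - F s t))\<^sup>2 \<partial>(lborel \<Otimes>\<^sub>M lborel))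
       \<le> hoelder_const\<^sup>2 * err_const T * mesh_mod (mesh \<pi>)" (is ?le)
proof -
  have m: "(\<lambda>(s, t). kernel_sum K \<pi> (G s) t - F s t) \<in> borel_measurable (lborel \<Otimes>\<^sub>M lborel)"
    by measurable
  have "(\<integral>\<^sup>+x. ennreal ((norm (case x of (s, t) \<Rightarrow> kernel_sum K \<pi> (G s) t - F s t))\<^sup>2) \<partial>(lborel \<Otimes>\<^sub>M lborel))
     = (\<integral>\<^sup>+t. \<integral>\<^sup>+s. ennreal ((norm (kernel_sum K \<pi> (G s) t - F s t))\<^sup>2) \<partial>lborel \<partial>lborel)"
  proof -
    have "(\<lambda>x. ennreal ((norm (case x of (s, t) \<Rightarrow> kernel_sum K \<pi> (G s) t - F s t))\<^sup>2)) \<in> borel_measurable (lborel \<Otimes>\<^sub>M lborel)"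
      using m by measurable
    from lborel_pair.nn_integral_snd[OF this] show ?thesis by simp
  qed
  also have "\<dots> \<le> ennreal (hoelder_const\<^sup>2 * err_const T * mesh_mod (mesh \<pi>))"
    by (rule kernel_sum_G_error[OF \<pi>])
  finally have le: "(\<integral>\<^sup>+x. ennreal ((norm (case x of (s, t) \<Rightarrow> kernel_sum K \<pi> (G s) t - F s t))\<^sup>2) \<partial>(lborel \<Otimes>\<^sub>M lborel)) \<le> \<dots>" .
  have "0 \<le> hoelder_const\<^sup>2 * err_const T * mesh_mod (mesh \<pi>)"
    unfolding err_const_def mesh_mod_def using alpha by auto
  then show ?L2 ?le using L2_of_nn_integral_le[OF m le] by auto
qed

text \<open>\<open>F\<close> differs from the kernel sum of one partition, whichever it is, by a
  square integrable error, and that kernel sum is itself square integrable as a finite sum of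
  products in separate variables.\<close>

lemma F_L2: "L2 (lborel \<Otimes>\<^sub>M lborel) (\<lambda>(s, t). F s t)"
proof -
  obtain \<pi> where "is_partition T \<pi>"
    using eventually_is_partition[of T] mesh_to_0_neq_bot[OF T_pos] eventually_happens by blast
  then have "L2 (lborel \<Otimes>\<^sub>M lborel) (\<lambda>x. (case x of (s, t) \<Rightarrow> kernel_sum K \<pi> (G s) t) - (case x of (s, t) \<Rightarrow> kernel_sum K \<pi> (G s) t - F s t))"
    by (intro L2_diff kernel_sum_G_L2 kernel_sum_F_L2_error)
  then show ?thesis by (simp add: case_prod_beta')
qed

lemma kernel_sum_F_tendsto:
  "((\<lambda>\<pi>. \<integral>x. (norm ((case x of (s, t) \<Rightarrow> kernel_sum K \<pi> (G s) t) - (case x of (s, t) \<Rightarrow> F s t)))\<^sup>2 \<partial>(lborel \<Otimes>\<^sub>M lborel)) \<longlongrightarrow> 0) (mesh_to_0 T)"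
proof (rule tendsto_sandwich[OF _ _ tendsto_const])
  show "((\<lambda>\<pi>. hoelder_const\<^sup>2 * err_const T * mesh_mod (mesh \<pi>)) \<longlongrightarrow> 0) (mesh_to_0 T)"
    using tendsto_mult_right_zero[OF filterlim_compose[OF mesh_mod_tendsto filterlim_mesh[OF T_pos]]] by simp
  show "\<forall>\<^sub>F \<pi> in mesh_to_0 T. (\<integral>x. (norm ((case x of (s, t) \<Rightarrow> kernel_sum K \<pi> (G s) t) - (case x of (s, t) \<Rightarrow> F s t)))\<^sup>2 \<partial>(lborel \<Otimes>\<^sub>M lborel))
      \<le> hoelder_const\<^sup>2 * err_const T * mesh_mod (mesh \<pi>)"
    using eventually_is_partition
    by eventually_elim (use kernel_sum_F_L2_error(2) in \<open>simp add: case_prod_beta\<close>)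
qed simp

end

text \<open>The covariance is expressed by the Borel kernel and an integral over the whole line,
  which is possible because \<open>K t\<close> vanishes outside the open interval from 0 to
  \<open>t\<close>. \<open>\<psi>\<close> is tied to \<open>\<phi>\<close> only on the
  square.\<close>

locale hilbert_realization = hoelder_integrand T \<alpha> C \<theta> K k \<phi> B
  for T \<alpha> C \<theta> K k B and \<phi> :: "real \<Rightarrow> real \<Rightarrow> real ^ 'd::finite ^ 'd" +
  fixes ind :: "real \<Rightarrow> 'd \<Rightarrow> 'h::{real_inner,banach}"
    and tens :: "'h \<Rightarrow> 'h \<Rightarrow> 'g::{real_inner,banach}"
    and \<psi> :: "real \<Rightarrow> real \<Rightarrow> real ^ 'd ^ 'd"
  assumes ind_inner: "\<And>t s u v. t \<in> {0..T} \<Longrightarrow> s \<in> {0..T} \<Longrightarrow>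
      inner (ind t u) (ind s v) = (if u = v then \<integral>r. K t r * K s r \<partial>lborel else 0)"
    and tens: "tensor_embedding (H1_space T ind) tens"
    and psi: "\<And>u v. u \<in> {0..T} \<Longrightarrow> v \<in> {0..T} \<Longrightarrow> \<psi> u v = indicator {0..<v} u *\<^sub>R \<phi> u v"
begin

lemma inner_ind_elem:
  assumes "a \<in> {0..T}" "b \<in> {0..T}" "c \<in> {0..T}" "d \<in> {0..T}"
  shows "inner (ind_elem ind a b u) (ind_elem ind c d v)
    = (if u = v then \<integral>r. (K b r - K a r) * (K d r - K c r) \<partial>lborel else 0)"
proof -
  have int: "integrable lborel (\<lambda>r. K t r * K s r)" if "t \<in> {0..T}" "s \<in> {0..T}" for t s
    using L2_inner_integrable[OF K_L2[OF that(1)] K_L2[OF that(2)]] by simp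
  have "(K b r - K a r) * (K d r - K c r) = K b r * K d r - K b r * K c r - (K a r * K d r - K a r * K c r)" for r
    by (simp add: algebra_simps)
  then show ?thesis
    unfolding ind_elem_def using assms by (simp add: inner_diff ind_inner int)
qed

lemma ind_elem_in_H1:
  assumes "a \<in> {0..T}" "b \<in> {0..T}"
  shows "ind_elem ind a b u \<in> span {ind t u |t u. t \<in> {0..T}}" "ind_elem ind a b u \<in> H1_space T ind"
proof -
  show 1: "ind_elem ind a b u \<in> span {ind t u |t u. t \<in> {0..T}}"
    unfolding ind_elem_def using assms by (intro span_diff span_base) auto
  then show "ind_elem ind a b u \<in> H1_space T ind"
    unfolding H1_space_def using closure_subset by blast
qed

text \<open>The Gram matrix of \<open>ind\<close> is that of the functions \<open>K t\<close> times
  basis vectors in L2, so bilinear expansion shows that \<open>kernel_sum\<close> represents step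
  elements isometrically. Two partitions occur because the Cauchy criterion compares different
  ones.\<close>

lemma inner_step_approx:
  assumes \<pi>: "is_partition T \<pi>" and \<pi>': "is_partition T \<pi>'"
  shows "inner (step_approx ind f \<pi>) (step_approx ind f' \<pi>') = (\<integral>t. inner (kernel_sum K \<pi> f t) (kernel_sum K \<pi>' f' t) \<partial>lborel)"
proof -
  define I where "I i j = (\<integral>r. (K (\<pi> ! Suc i) r - K (\<pi> ! i) r) * (K (\<pi>' ! Suc j) r - K (\<pi>' ! j) r) \<partial>lborel)" for i j
  have "inner (step_approx ind f \<pi>) (step_approx ind f' \<pi>')
    = (\<Sum>i<length \<pi> - 1. \<Sum>k\<in>UNIV. \<Sum>j<length \<pi>' - 1. \<Sum>l\<in>UNIV. (f (\<pi> ! i) $ k) * ((f' (\<pi>' ! j) $ l) *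
        inner (ind_elem ind (\<pi> ! i) (\<pi> ! Suc i) k) (ind_elem ind (\<pi>' ! j) (\<pi>' ! Suc j) l)))"
    unfolding step_approx_def
    by (simp only: inner_sum_left, simp only: inner_sum_right inner_scaleR_left inner_scaleR_right ac_simps)
  also have "\<dots> = (\<Sum>i<length \<pi> - 1. \<Sum>k\<in>UNIV. \<Sum>j<length \<pi>' - 1. \<Sum>l\<in>UNIV. if k = l then (f (\<pi> ! i) $ k) * (f' (\<pi>' ! j) $ k) * I i j else 0)"
    unfolding I_def using partition_nth[OF \<pi>] partition_nth[OF \<pi>']
    by (intro sum.cong refl) (simp add: inner_ind_elem)
  also have "\<dots> = (\<Sum>i<length \<pi> - 1. \<Sum>j<length \<pi>' - 1. inner (f (\<pi> ! i)) (f' (\<pi>' ! j)) * I i j)"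
    by (simp add: inner_vec_def sum_distrib_right sum.swap[of _ UNIV])
  also have "\<dots> = (\<Sum>i<length \<pi> - 1. \<Sum>j<length \<pi>' - 1. \<integral>t. inner (f (\<pi> ! i)) (f' (\<pi>' ! j)) *
      ((K (\<pi> ! Suc i) t - K (\<pi> ! i) t) * (K (\<pi>' ! Suc j) t - K (\<pi>' ! j) t)) \<partial>lborel)"
    unfolding I_def by simp
  also have "\<dots> = (\<integral>t. (\<Sum>i<length \<pi> - 1. \<Sum>j<length \<pi>' - 1. inner (f (\<pi> ! i)) (f' (\<pi>' ! j)) *
      ((K (\<pi> ! Suc i) t - K (\<pi> ! i) t) * (K (\<pi>' ! Suc j) t - K (\<pi>' ! j) t))) \<partial>lborel)"
    by (rule integral_double_sum)
      (intro integrable_mult_right K_diff_mult_integrable partition_nth[OF \<pi>] partition_nth[OF \<pi>'])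
  also have "\<dots> = (\<integral>t. inner (kernel_sum K \<pi> f t) (kernel_sum K \<pi>' f' t) \<partial>lborel)"
    unfolding kernel_sum_def
    by (simp only: inner_sum_left, simp only: inner_sum_right inner_scaleR_left inner_scaleR_right ac_simps)
  finally show ?thesis .
qed

lemma step_approx_in_span:
  assumes \<pi>: "is_partition T \<pi>"
  shows "step_approx ind f \<pi> \<in> span {ind t u |t u. t \<in> {0..T}}"
  unfolding step_approx_def using partition_nth[OF \<pi>]
  by (intro span_sum span_scale ind_elem_in_H1) auto

lemma kernel_sum_path_tendsto:
  assumes v: "v \<in> {0..T}"
  shows "((\<lambda>\<pi>. \<integral>t. (norm (kernel_sum K \<pi> (\<lambda>u. column j (\<psi> u v)) t - column j (G t v)))\<^sup>2 \<partial>lborel) \<longlongrightarrow> 0) (mesh_to_0 T)"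
proof -
  have cong: "kernel_sum K \<pi> (\<lambda>u. column j (\<psi> u v)) t - column j (G t v)
      = column j (kernel_sum K \<pi> (\<lambda>u. indicator {0..<v} u *\<^sub>R \<phi> u v) t - G t v)" if \<pi>: "is_partition T \<pi>" for \<pi> t
  proof -
    have "kernel_sum K \<pi> (\<lambda>u. \<psi> u v) t = kernel_sum K \<pi> (\<lambda>u. indicator {0..<v} u *\<^sub>R \<phi> u v) t"
      unfolding kernel_sum_def using partition_nth[OF \<pi>] v by (intro sum.cong) (auto simp: psi)
    then show ?thesis by (simp add: kernel_sum_column column_diff)
  qed
  show ?thesis
  \<comment> \<open>The path error bound is available for \<open>0 < v\<close> only; at
    \<open>v = 0\<close> the integrand and \<open>G\<close> both vanish.\<close>
  proof (cases "v = 0")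
    case True
    have 1: "G t v = 0" for t using G_eq_0[of v t] G_eq_0'[of t v] True by (cases "t \<le> 0") auto
    have 2: "kernel_sum K \<pi> (\<lambda>u. indicator {0..<v} u *\<^sub>R \<phi> u v) t = 0" for \<pi> t
      unfolding kernel_sum_def using True by simp
    have 3: "column j (0 :: real ^ 'd ^ 'd) = 0" by (simp add: vec_eq_iff column_component)
    have "\<forall>\<^sub>F \<pi> in mesh_to_0 T. 0 = (\<integral>t. (norm (kernel_sum K \<pi> (\<lambda>u. column j (\<psi> u v)) t - column j (G t v)))\<^sup>2 \<partial>lborel)"
      using eventually_is_partition by eventually_elim (simp only: cong, simp add: 1 2 3)
    then show ?thesis by (rule Lim_transform_eventually[OF tendsto_const])
  next
    case False
    then have v': "0 < v" "v \<le> T" using v by auto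
    show ?thesis
    proof (rule tendsto_sandwich[OF _ _ tendsto_const])
      show "((\<lambda>\<pi>. path_mod v (mesh \<pi>)) \<longlongrightarrow> 0) (mesh_to_0 T)"
        by (rule filterlim_compose[OF path_mod_tendsto filterlim_mesh[OF T_pos]])
      show "\<forall>\<^sub>F \<pi> in mesh_to_0 T. (\<integral>t. (norm (kernel_sum K \<pi> (\<lambda>u. column j (\<psi> u v)) t - column j (G t v)))\<^sup>2 \<partial>lborel) \<le> path_mod v (mesh \<pi>)"
        using eventually_is_partition
      proof eventually_elim
        fix \<pi> assume \<pi>: "is_partition T \<pi>"
        define w where "w t = kernel_sum K \<pi> (\<lambda>u. indicator {0..<v} u *\<^sub>R \<phi> u v) t - G t v" for t
        have [measurable]: "w \<in> borel_measurable borel" unfolding w_def by measurable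
        have le: "(\<integral>\<^sup>+t. ennreal ((norm (column j (w t)))\<^sup>2) \<partial>lborel) \<le> ennreal (path_mod v (mesh \<pi>))"
        proof (rule order_trans)
          show "(\<integral>\<^sup>+t. ennreal ((norm (column j (w t)))\<^sup>2) \<partial>lborel) \<le> (\<integral>\<^sup>+t. ennreal ((norm (w t))\<^sup>2) \<partial>lborel)"
            by (intro nn_integral_mono ennreal_leI norm_column_le)
          show "\<dots> \<le> ennreal (path_mod v (mesh \<pi>))"
            unfolding w_def by (rule kernel_sum_path_error[OF \<pi> v'])
        qed
        have "0 \<le> path_mod v (mesh \<pi>)"
          unfolding path_mod_def K_mod_def err_const_def mesh_mod_def using alpha theta b_nonneg by auto
        then show "(\<integral>t. (norm (kernel_sum K \<pi> (\<lambda>u. column j (\<psi> u v)) t - column j (G t v)))\<^sup>2 \<partial>lborel) \<le> path_mod v (mesh \<pi>)"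
          unfolding cong[OF \<pi>] w_def[symmetric] by (intro L2_of_nn_integral_le(2)[OF _ le]) auto
      qed
    qed simp
  qed
qed

lemma G_column_L2: "v \<in> {0..T} \<Longrightarrow> L2 lborel (\<lambda>t. column j (G t v))"
proof -
  assume v: "v \<in> {0..T}"
  have "integrable lborel (\<lambda>t. (norm (column j (G t v)))\<^sup>2)"
    by (rule Bochner_Integration.integrable_bound[where f = "\<lambda>t. (norm (G t v))\<^sup>2"])
      (use G_L2[OF v] norm_column_le in \<open>auto simp: L2_def\<close>)
  then show ?thesis by (auto simp: L2_def)
qed

definition path_vec :: "real \<Rightarrow> 'd \<Rightarrow> 'h" where
  "path_vec v j = path_elem T ind (\<lambda>u. column j (\<psi> u v))"

text \<open>\<open>path_elem\<close> is a \<open>Lim\<close> and acquires its meaning only here.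
  Convergence follows from \<open>isometry_tendsto\<close>, with the columns of \<open>G _ v\<close>
  as limits in L2.\<close>

lemma path_vec_tendsto:
  assumes v: "v \<in> {0..T}"
  shows "(step_approx ind (\<lambda>u. column j (\<psi> u v)) \<longlongrightarrow> path_vec v j) (mesh_to_0 T)"
    and "path_vec v j \<in> H1_space T ind"
proof -
  obtain h where h: "(step_approx ind (\<lambda>u. column j (\<psi> u v)) \<longlongrightarrow> h) (mesh_to_0 T)"
    by (rule isometry_tendsto[OF mesh_to_0_neq_bot[OF T_pos] eventually_is_partition inner_step_approx kernel_sum_L2
          G_column_L2[OF v] kernel_sum_path_tendsto[OF v]])
  then show *: "(step_approx ind (\<lambda>u. column j (\<psi> u v)) \<longlongrightarrow> path_vec v j) (mesh_to_0 T)"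
    unfolding path_vec_def path_elem_def using tendsto_Lim[OF mesh_to_0_neq_bot[OF T_pos] h] by simp
  show "path_vec v j \<in> H1_space T ind"
    unfolding H1_space_def
  proof (rule Lim_in_closed_set[OF closed_closure _ mesh_to_0_neq_bot[OF T_pos] *])
    show "\<forall>\<^sub>F \<pi> in mesh_to_0 T. step_approx ind (\<lambda>u. column j (\<psi> u v)) \<pi> \<in> closure (span {ind t u |t u. t \<in> {0..T}})"
      using eventually_is_partition by eventually_elim (use step_approx_in_span closure_subset in blast)
  qed
qed

lemma inner_path_vec:
  assumes v: "v \<in> {0..T}" and w: "w \<in> {0..T}"
  shows "inner (path_vec v j) (path_vec w l) = (\<integral>s. inner (column j (G s v)) (column l (G s w)) \<partial>lborel)"
proof (rule tendsto_unique[OF mesh_to_0_neq_bot[OF T_pos]])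
  show "((\<lambda>\<pi>. inner (step_approx ind (\<lambda>u. column j (\<psi> u v)) \<pi>) (step_approx ind (\<lambda>u. column l (\<psi> u w)) \<pi>))
      \<longlongrightarrow> inner (path_vec v j) (path_vec w l)) (mesh_to_0 T)"
    by (intro tendsto_inner path_vec_tendsto v w)
  have "((\<lambda>\<pi>. \<integral>t. inner (kernel_sum K \<pi> (\<lambda>u. column j (\<psi> u v)) t) (kernel_sum K \<pi> (\<lambda>u. column l (\<psi> u w)) t) \<partial>lborel)
      \<longlongrightarrow> (\<integral>s. inner (column j (G s v)) (column l (G s w)) \<partial>lborel)) (mesh_to_0 T)"
  proof (rule L2_inner_tendsto)
    show "\<forall>\<^sub>F \<pi> in mesh_to_0 T. L2 lborel (kernel_sum K \<pi> (\<lambda>u. column j (\<psi> u v))) \<and> L2 lborel (kernel_sum K \<pi> (\<lambda>u. column l (\<psi> u w)))"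
      using eventually_is_partition by eventually_elim (simp add: kernel_sum_L2)
  qed (intro G_column_L2 kernel_sum_path_tendsto v w)+
  then show "((\<lambda>\<pi>. inner (step_approx ind (\<lambda>u. column j (\<psi> u v)) \<pi>) (step_approx ind (\<lambda>u. column l (\<psi> u w)) \<pi>))
      \<longlongrightarrow> (\<integral>s. inner (column j (G s v)) (column l (G s w)) \<partial>lborel)) (mesh_to_0 T)"
    by (rule Lim_transform_eventually) (use eventually_is_partition in eventually_elim, simp add: inner_step_approx)
qed

lemma inner_tens:
  assumes "a \<in> H1_space T ind" "b \<in> H1_space T ind" "c \<in> H1_space T ind" "d \<in> H1_space T ind"
  shows "inner (tens a b) (tens c d) = inner a c * inner b d"
  using tens assms unfolding tensor_embedding_def by blast

lemma psi_partition_eq: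
  "psi_partition T ind tens \<psi> \<pi> = (\<Sum>i<length \<pi> - 1. \<Sum>j\<in>UNIV. tens (path_vec (\<pi> ! i) j) (ind_elem ind (\<pi> ! i) (\<pi> ! Suc i) j))"
  unfolding psi_partition_def strip_elem_def path_vec_def ..

text \<open>The inner product of two elementary tensors factors into one of paths, an integral over
  \<open>s\<close> of columns of \<open>G\<close>, and one of indicators, an integral over
  \<open>t\<close> of increments of \<open>K\<close>. Only equal column indices contribute, their
  sum is the Frobenius product, and Fubini joins the two integrals. Thus the kernel sums of
  \<open>G\<close> represent \<open>psi_partition\<close> isometrically.\<close>

lemma inner_psi_partition:
  assumes \<pi>: "is_partition T \<pi>" and \<pi>': "is_partition T \<pi>'"
  shows "inner (psi_partition T ind tens \<psi> \<pi>) (psi_partition T ind tens \<psi> \<pi>')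
    = (\<integral>x. inner (case x of (s, t) \<Rightarrow> kernel_sum K \<pi> (G s) t) (case x of (s, t) \<Rightarrow> kernel_sum K \<pi>' (G s) t) \<partial>(lborel \<Otimes>\<^sub>M lborel))"
proof -
  define c where "c i j t = (K (\<pi> ! Suc i) t - K (\<pi> ! i) t) * (K (\<pi>' ! Suc j) t - K (\<pi>' ! j) t)" for i j t
  define e where "e i j s = inner (G s (\<pi> ! i)) (G s (\<pi>' ! j))" for i j s
  have c: "integrable lborel (c i j)" and e: "integrable lborel (e i j)"
    and e_eq: "integral\<^sup>L lborel (e i j) = (\<Sum>l\<in>UNIV. \<integral>s. inner (column l (G s (\<pi> ! i))) (column l (G s (\<pi>' ! j))) \<partial>lborel)"
    if "i < length \<pi> - 1" "j < length \<pi>' - 1" for i j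
  proof -
    note r = partition_nth[OF \<pi> that(1)] partition_nth[OF \<pi>' that(2)]
    show "integrable lborel (c i j)" unfolding c_def by (intro K_diff_mult_integrable r)
    show "integrable lborel (e i j)" unfolding e_def by (intro L2_inner_integrable G_L2 r)
    show "integral\<^sup>L lborel (e i j) = (\<Sum>l\<in>UNIV. \<integral>s. inner (column l (G s (\<pi> ! i))) (column l (G s (\<pi>' ! j))) \<partial>lborel)"
      unfolding e_def sum_inner_column[symmetric]
      by (intro Bochner_Integration.integral_sum L2_inner_integrable G_column_L2 r)
  qed
  have "inner (psi_partition T ind tens \<psi> \<pi>) (psi_partition T ind tens \<psi> \<pi>')
    = (\<Sum>i<length \<pi> - 1. \<Sum>l\<in>UNIV. \<Sum>j<length \<pi>' - 1. \<Sum>m\<in>UNIV.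
        if l = m then (\<integral>s. inner (column l (G s (\<pi> ! i))) (column l (G s (\<pi>' ! j))) \<partial>lborel) * integral\<^sup>L lborel (c i j) else 0)"
    unfolding psi_partition_eq
  proof (simp only: inner_sum_left, simp only: inner_sum_right, intro sum.cong refl)
    fix i l j m assume "i \<in> {..<length \<pi> - 1}" "j \<in> {..<length \<pi>' - 1}"
    then have r: "\<pi> ! i \<in> {0..T}" "\<pi> ! Suc i \<in> {0..T}" "\<pi>' ! j \<in> {0..T}" "\<pi>' ! Suc j \<in> {0..T}"
      using partition_nth[OF \<pi>, of i] partition_nth[OF \<pi>', of j] by auto
    show "inner (tens (path_vec (\<pi> ! i) l) (ind_elem ind (\<pi> ! i) (\<pi> ! Suc i) l)) (tens (path_vec (\<pi>' ! j) m) (ind_elem ind (\<pi>' ! j) (\<pi>' ! Suc j) m))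
      = (if l = m then (\<integral>s. inner (column l (G s (\<pi> ! i))) (column l (G s (\<pi>' ! j))) \<partial>lborel) * integral\<^sup>L lborel (c i j) else 0)"
      by (subst inner_tens) (use r in \<open>auto simp: path_vec_tendsto(2) ind_elem_in_H1(2) inner_path_vec inner_ind_elem c_def[abs_def]\<close>)
  qed
  also have "\<dots> = (\<Sum>i<length \<pi> - 1. \<Sum>j<length \<pi>' - 1. (\<Sum>l\<in>UNIV. \<integral>s. inner (column l (G s (\<pi> ! i))) (column l (G s (\<pi>' ! j))) \<partial>lborel) * integral\<^sup>L lborel (c i j))"
    by (simp add: sum_distrib_right sum.swap[of _ UNIV])
  also have "\<dots> = (\<Sum>i<length \<pi> - 1. \<Sum>j<length \<pi>' - 1. integral\<^sup>L lborel (e i j) * integral\<^sup>L lborel (c i j))"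
    by (intro sum.cong refl) (simp add: e_eq)
  also have "\<dots> = (\<Sum>i<length \<pi> - 1. \<Sum>j<length \<pi>' - 1. (\<integral>x. (case x of (s, t) \<Rightarrow> e i j s * c i j t) \<partial>(lborel \<Otimes>\<^sub>M lborel)))"
    by (intro sum.cong refl) (simp add: product_integral c e)
  also have "\<dots> = (\<integral>x. (\<Sum>i<length \<pi> - 1. \<Sum>j<length \<pi>' - 1. (case x of (s, t) \<Rightarrow> e i j s * c i j t)) \<partial>(lborel \<Otimes>\<^sub>M lborel))"
    by (rule integral_double_sum) (intro product_integral(1) e c)
  also have "\<dots> = (\<integral>x. inner (case x of (s, t) \<Rightarrow> kernel_sum K \<pi> (G s) t) (case x of (s, t) \<Rightarrow> kernel_sum K \<pi>' (G s) t) \<partial>(lborel \<Otimes>\<^sub>M lborel))"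
    unfolding kernel_sum_def c_def e_def case_prod_beta
    by (simp only: inner_sum_left, simp only: inner_sum_right inner_scaleR_left inner_scaleR_right ac_simps)
  finally show ?thesis .
qed

text \<open>The isometry argument used for paths is repeated over the product measure, with limit
  \<open>F\<close>. The norm formula is the limit of the inner product of
  \<open>psi_partition\<close> with itself.\<close>

theorem psi_partition_tendsto:
  obtains \<Psi> where "\<Psi> \<in> tensor_space (H1_space T ind) tens"
    "(psi_partition T ind tens \<psi> \<longlongrightarrow> \<Psi>) (mesh_to_0 T)"
    "(norm \<Psi>)\<^sup>2 = (\<integral>x. (case x of (s, t) \<Rightarrow> (norm (F s t))\<^sup>2) \<partial>(lborel \<Otimes>\<^sub>M lborel))"
proof -
  obtain \<Psi> where lim: "(psi_partition T ind tens \<psi> \<longlongrightarrow> \<Psi>) (mesh_to_0 T)"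
    by (rule isometry_tendsto[OF mesh_to_0_neq_bot[OF T_pos] eventually_is_partition inner_psi_partition kernel_sum_G_L2
          F_L2 kernel_sum_F_tendsto])
  have mem: "\<Psi> \<in> tensor_space (H1_space T ind) tens"
    unfolding tensor_space_def
  proof (rule Lim_in_closed_set[OF closed_closure _ mesh_to_0_neq_bot[OF T_pos] lim])
    show "\<forall>\<^sub>F \<pi> in mesh_to_0 T. psi_partition T ind tens \<psi> \<pi> \<in> closure (span {tens a b |a b. a \<in> H1_space T ind \<and> b \<in> H1_space T ind})"
      using eventually_is_partition
    proof eventually_elim
      fix \<pi> assume \<pi>: "is_partition T \<pi>"
      have "psi_partition T ind tens \<psi> \<pi> \<in> span {tens a b |a b. a \<in> H1_space T ind \<and> b \<in> H1_space T ind}"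
        unfolding psi_partition_eq
      proof (intro span_sum span_base)
        fix i j assume "i \<in> {..<length \<pi> - 1}"
        then show "tens (path_vec (\<pi> ! i) j) (ind_elem ind (\<pi> ! i) (\<pi> ! Suc i) j) \<in> {tens a b |a b. a \<in> H1_space T ind \<and> b \<in> H1_space T ind}"
          using partition_nth[OF \<pi>, of i] path_vec_tendsto(2) ind_elem_in_H1(2) by blast
      qed
      then show "psi_partition T ind tens \<psi> \<pi> \<in> closure (span {tens a b |a b. a \<in> H1_space T ind \<and> b \<in> H1_space T ind})"
        using closure_subset by blast
    qed
  qed
  have "inner \<Psi> \<Psi> = (\<integral>x. inner (case x of (s, t) \<Rightarrow> F s t) (case x of (s, t) \<Rightarrow> F s t) \<partial>(lborel \<Otimes>\<^sub>M lborel))"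
  proof (rule tendsto_unique[OF mesh_to_0_neq_bot[OF T_pos]])
    show "((\<lambda>\<pi>. inner (psi_partition T ind tens \<psi> \<pi>) (psi_partition T ind tens \<psi> \<pi>)) \<longlongrightarrow> inner \<Psi> \<Psi>) (mesh_to_0 T)"
      by (intro tendsto_inner lim)
    have "((\<lambda>\<pi>. \<integral>x. inner (case x of (s, t) \<Rightarrow> kernel_sum K \<pi> (G s) t) (case x of (s, t) \<Rightarrow> kernel_sum K \<pi> (G s) t) \<partial>(lborel \<Otimes>\<^sub>M lborel))
       \<longlongrightarrow> (\<integral>x. inner (case x of (s, t) \<Rightarrow> F s t) (case x of (s, t) \<Rightarrow> F s t) \<partial>(lborel \<Otimes>\<^sub>M lborel))) (mesh_to_0 T)"
    proof (rule L2_inner_tendsto)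
      show "\<forall>\<^sub>F \<pi> in mesh_to_0 T. L2 (lborel \<Otimes>\<^sub>M lborel) (\<lambda>(s, t). kernel_sum K \<pi> (G s) t) \<and> L2 (lborel \<Otimes>\<^sub>M lborel) (\<lambda>(s, t). kernel_sum K \<pi> (G s) t)"
        using eventually_is_partition by eventually_elim (simp add: kernel_sum_G_L2)
    qed (rule F_L2 kernel_sum_F_tendsto)+
    then show "((\<lambda>\<pi>. inner (psi_partition T ind tens \<psi> \<pi>) (psi_partition T ind tens \<psi> \<pi>))
       \<longlongrightarrow> (\<integral>x. inner (case x of (s, t) \<Rightarrow> F s t) (case x of (s, t) \<Rightarrow> F s t) \<partial>(lborel \<Otimes>\<^sub>M lborel))) (mesh_to_0 T)"
      by (rule Lim_transform_eventually) (use eventually_is_partition in eventually_elim, simp add: inner_psi_partition)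
  qed
  then have "(norm \<Psi>)\<^sup>2 = (\<integral>x. (case x of (s, t) \<Rightarrow> (norm (F s t))\<^sup>2) \<partial>(lborel \<Otimes>\<^sub>M lborel))"
    by (simp add: power2_norm_eq_inner case_prod_beta)
  with mem lim show ?thesis by (rule that)
qed

end

section \<open>The tensor operator\<close>

context hoelder_integrand
begin

text \<open>For \<open>s < t\<close> the increments of \<open>G s\<close> from \<open>t\<close> obey
  a Hoelder bound whose constant explodes as \<open>t\<close> approaches \<open>s\<close>. For
  \<open>t < s\<close> the path vanishes up to \<open>s\<close>; beyond it \<open>k r t\<close> is
  bounded and \<open>G s r\<close> has only the integrable singularity
  \<open>(r - s) powr - \<alpha>\<close>.\<close>

lemma G_increment_integrable:
  assumes "0 < s" "s < T" "0 < t" "s \<noteq> t"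
  shows "integrable lborel (\<lambda>r. k r t *\<^sub>R (G s r - G s t))"
proof (cases "s < t")
  case True
  have "integrable lborel (\<lambda>r. k r t *\<^sub>R (indicator {..T} r *\<^sub>R (G s r - G s t)))"
  proof (rule k_mult_integrable(1))
    fix r assume "t < r"
    then show "norm (indicator {..T} r *\<^sub>R (G s r - G s t)) \<le> \<bar>D2\<bar> * (s powr - \<alpha> * (t - s) powr (- \<alpha> - \<theta>)) * (r - t) powr \<theta>"
    proof (cases "r \<le> T")
      case le: True
      have "norm (G s r - G s t) \<le> D2 * (s powr - \<alpha> * (t - s) powr (- \<alpha> - \<theta>) * (r - t) powr \<theta>)"
        using assms True \<open>t < r\<close> le by (intro norm_G_diff_le) auto
      also have "\<dots> \<le> \<bar>D2\<bar> * (s powr - \<alpha> * (t - s) powr (- \<alpha> - \<theta>) * (r - t) powr \<theta>)"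
        by (intro mult_right_mono) auto
      finally show ?thesis using le by (simp add: mult.assoc)
    qed simp
  qed (use assms in auto)
  moreover have "k r t *\<^sub>R (indicator {..T} r *\<^sub>R (G s r - G s t)) = k r t *\<^sub>R (G s r - G s t)" for r
    using k_eq_0[of t r] by (auto simp: indicator_def)
  ultimately show ?thesis by (simp only:)
next
  case False
  then have ts: "t < s" using assms by simp
  define c where "c = C * (s - t) powr (- \<alpha> - 1) * (\<bar>D1\<bar> * s powr - \<alpha>)"
  have c: "0 \<le> c" unfolding c_def using C_pos by simp
  show ?thesis
  proof (rule integrableI_bounded)
    have "(\<integral>\<^sup>+r. ennreal (norm (k r t *\<^sub>R (G s r - G s t))) \<partial>lborel)
       \<le> (\<integral>\<^sup>+r. ennreal c * (ennreal ((r - s) powr - \<alpha>) * indicator {s..T} r) \<partial>lborel)"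
    proof (rule nn_integral_mono)
      fix r
      have t0: "G s t = 0" using ts by (intro G_eq_0) auto
      show "ennreal (norm (k r t *\<^sub>R (G s r - G s t))) \<le> ennreal c * (ennreal ((r - s) powr - \<alpha>) * indicator {s..T} r)"
      proof (cases "s < r \<and> r \<le> T")
        case True
        have "\<bar>k r t\<bar> \<le> C * (r - t) powr (- \<alpha> - 1)" using True ts assms by (intro k_le) auto
        also have "\<dots> \<le> C * (s - t) powr (- \<alpha> - 1)"
          using True ts C_pos alpha by (intro mult_left_mono powr_mono2') auto
        finally have 1: "\<bar>k r t\<bar> \<le> C * (s - t) powr (- \<alpha> - 1)" .
        have "norm (G s r) \<le> D1 * (s powr - \<alpha> * (r - s) powr - \<alpha>)"
          using True assms by (intro norm_G_le) auto
        also have "\<dots> \<le> \<bar>D1\<bar> * (s powr - \<alpha> * (r - s) powr - \<alpha>)"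
          by (intro mult_right_mono) auto
        finally have "\<bar>k r t\<bar> * norm (G s r) \<le> (C * (s - t) powr (- \<alpha> - 1)) * (\<bar>D1\<bar> * (s powr - \<alpha> * (r - s) powr - \<alpha>))"
          using 1 C_pos by (intro mult_mono) auto
        also have "\<dots> = c * (r - s) powr - \<alpha>" unfolding c_def by (simp add: ac_simps)
        finally show ?thesis using True t0 c by (auto simp: ennreal_mult'[symmetric] intro!: ennreal_leI)
      next
        case False
        then have "k r t *\<^sub>R (G s r - G s t) = 0"
          using t0 G_eq_0[of r s] k_eq_0[of t r] by (cases "r \<le> s") auto
        then show ?thesis by (simp only: norm_zero ennreal_0 zero_le)
      qed
    qed
    also have "\<dots> = ennreal c * ennreal ((T - s) powr (1 - \<alpha>) / (1 - \<alpha>))"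
      using assms alpha by (subst nn_integral_cmult) (auto simp: nn_integral_powr_right)
    also have "\<dots> < \<infinity>" by (simp add: ennreal_mult_less_top)
    finally show "(\<integral>\<^sup>+r. ennreal (norm (k r t *\<^sub>R (G s r - G s t))) \<partial>lborel) < \<infinity>" .
  qed measurable
qed

lemma F_eq_0: "\<not> (0 < s \<and> s < T \<and> 0 < t \<and> t < T) \<Longrightarrow> F s t = 0"
proof -
  assume *: "\<not> (0 < s \<and> s < T \<and> 0 < t \<and> t < T)"
  show ?thesis
  proof (cases "0 < t \<and> t < T")
    case True
    have "G s r = 0" for r
    proof (cases "s \<le> 0")
      case False
      then have "k u s = 0" "K u s = 0" for u using * True k_eq_0[of s u] K_eq_0[of s u] by auto
      then show ?thesis unfolding G_def Kstar_def by simp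
    qed (rule G_eq_0')
    then show ?thesis unfolding F_def Kstar_def by simp
  next
    case False
    then have "k u t = 0" "K u t = 0" for u using k_eq_0[of t u] K_eq_0[of t u] by auto
    then show ?thesis unfolding F_def Kstar_def by simp
  qed
qed

text \<open>The integrand \<open>\<psi>\<close> as a Borel function on the plane.\<close>

definition \<phi>\<^sub>0 :: "real \<Rightarrow> real \<Rightarrow> 'e" where
  "\<phi>\<^sub>0 u v = (if 0 \<le> u \<and> u < v then \<phi> u v else 0)"

lemma phi0_measurable[measurable (raw)]:
  assumes [measurable]: "f \<in> borel_measurable M" "g \<in> borel_measurable M"
  shows "(\<lambda>x. \<phi>\<^sub>0 (f x) (g x)) \<in> borel_measurable M"
  unfolding \<phi>\<^sub>0_def by measurable

definition A\<^sub>0 :: "real \<Rightarrow> real \<Rightarrow> 'e" where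
  "A\<^sub>0 s v = (\<integral>r. k r s *\<^sub>R (\<phi>\<^sub>0 r v - \<phi>\<^sub>0 s v) \<partial>lborel)"

text \<open>Beyond \<open>v\<close> the cut-off function is 0, so continuing the integral from
  \<open>v\<close> to \<open>T\<close> contributes
  \<open>- (K T s - K v s) *\<^sub>R \<phi> s v\<close>. This is exactly what turns the boundary
  factor \<open>K v s\<close> of \<open>Kstar v\<close> into \<open>K T s\<close>.\<close>

lemma G_conv_phi0:
  assumes s: "0 < s" "s < T" and v: "v \<le> T"
  shows "integrable lborel (\<lambda>r. k r s *\<^sub>R (\<phi>\<^sub>0 r v - \<phi>\<^sub>0 s v))" (is ?int)
    and "G s v = K T s *\<^sub>R \<phi>\<^sub>0 s v + A\<^sub>0 s v" (is ?eq)
proof -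
  have "?int \<and> ?eq"
  proof (cases "s < v")
    case True
    have eq: "AE r in lborel. (indicator {..v} r * k r s) *\<^sub>R (\<phi> r v - \<phi> s v) - (indicator {v..T} r * k r s) *\<^sub>R \<phi> s v
      = k r s *\<^sub>R (\<phi>\<^sub>0 r v - \<phi>\<^sub>0 s v)"
      using AE_lborel_singleton[of v]
    proof eventually_elim
      fix r assume "r \<noteq> v"
      then show "(indicator {..v} r * k r s) *\<^sub>R (\<phi> r v - \<phi> s v) - (indicator {v..T} r * k r s) *\<^sub>R \<phi> s v
        = k r s *\<^sub>R (\<phi>\<^sub>0 r v - \<phi>\<^sub>0 s v)"
        using s True k_eq_0[of s r] by (cases "s < r \<and> r \<le> T") (auto simp: \<phi>\<^sub>0_def indicator_def)
    qed
    have i0: "integrable lborel (\<lambda>r. (indicator {v..T} r * k r s) *\<^sub>R \<phi> s v)"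
      using k_ind_integrable[of s v T] True by (intro integrable_scaleR_left) auto
    have i1: "integrable lborel (\<lambda>r. (indicator {..v} r * k r s) *\<^sub>R (\<phi> r v - \<phi> s v) - (indicator {v..T} r * k r s) *\<^sub>R \<phi> s v)"
      by (intro Bochner_Integration.integrable_diff G_integrable i0)
    have ?int by (rule integrable_cong_AE_imp[OF i1 _ eq]) measurable
    moreover have "A\<^sub>0 s v = (\<integral>r. (indicator {..v} r * k r s) *\<^sub>R (\<phi> r v - \<phi> s v) - (indicator {v..T} r * k r s) *\<^sub>R \<phi> s v \<partial>lborel)"
      unfolding A\<^sub>0_def by (intro integral_cong_AE) (use eq in \<open>auto simp: eq_commute\<close>)
    then have "A\<^sub>0 s v = (\<integral>r. (indicator {..v} r * k r s) *\<^sub>R (\<phi> r v - \<phi> s v) \<partial>lborel) - (K T s - K v s) *\<^sub>R \<phi> s v"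
      using k_ind_integrable[of s v T] True s v by (simp add: G_integrable i0 K_diff_eq)
    ultimately show ?thesis
      using s True unfolding G_def Kstar_def \<phi>\<^sub>0_def by (simp add: algebra_simps)
  next
    case False
    then have eq: "k r s *\<^sub>R (\<phi>\<^sub>0 r v - \<phi>\<^sub>0 s v) = 0" for r
      using k_eq_0[of s r] by (auto simp: \<phi>\<^sub>0_def)
    have "\<phi>\<^sub>0 s v = 0" using False by (simp add: \<phi>\<^sub>0_def)
    then show ?thesis using G_eq_0[of v s] False unfolding A\<^sub>0_def eq by simp
  qed
  then show ?int ?eq by auto
qed

text \<open>For \<open>s < t\<close> the Hoelder bound in the second argument applies. For
  \<open>t < s\<close> the increment is 0 until \<open>r\<close> passes \<open>s\<close>, at a
  positive distance from the singularity of \<open>k\<close>.\<close>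

lemma phi0_increment_integrable:
  assumes "0 < s" "0 < t" "s \<noteq> t"
  shows "integrable lborel (\<lambda>r. k r t *\<^sub>R (\<phi>\<^sub>0 s r - \<phi>\<^sub>0 s t))"
proof (cases "s < t")
  case True
  show ?thesis
  proof (rule k_mult_integrable(1))
    fix r assume "t < r"
    then show "norm (\<phi>\<^sub>0 s r - \<phi>\<^sub>0 s t) \<le> B * (r - t) powr \<theta>"
      using phi_hoelder_2[of s r t] True assms by (auto simp: \<phi>\<^sub>0_def)
  qed (use B_pos assms in auto)
next
  case False
  then have ts: "t < s" using assms by simp
  show ?thesis
  proof (rule Bochner_Integration.integrable_bound)
    show "integrable lborel (\<lambda>r. B * (indicator {s..T} r * k r t))"
      by (intro integrable_mult_right k_ind_integrable ts)
    show "AE r in lborel. norm (k r t *\<^sub>R (\<phi>\<^sub>0 s r - \<phi>\<^sub>0 s t)) \<le> norm (B * (indicator {s..T} r * k r t))"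
    proof (rule AE_I2)
      fix r
      show "norm (k r t *\<^sub>R (\<phi>\<^sub>0 s r - \<phi>\<^sub>0 s t)) \<le> norm (B * (indicator {s..T} r * k r t))"
        using phi_le[of s r] B_pos ts k_eq_0[of t r] assms mult_left_mono[OF phi_le[of s r], of "\<bar>k r t\<bar>"]
        by (cases "s < r \<and> r \<le> T") (auto simp: \<phi>\<^sub>0_def abs_mult mult.commute)
    qed
  qed measurable
qed

text \<open>\<open>F s\<close> is \<open>K*\<close> of \<open>G s\<close>, and \<open>G s\<close>
  splits into \<open>K T s *\<^sub>R \<phi>\<^sub>0 s _\<close> and \<open>A\<^sub>0 s _\<close>;
  expansion gives the four terms of the tensor operator. The split under the integral rests on
  integrability of both increments, which is established off the diagonal, where
  \<open>\<phi>\<^sub>0\<close> jumps.\<close>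

lemma F_conv_phi0:
  assumes s: "0 < s" "s < T" and t: "0 < t" "t < T" and st: "s \<noteq> t"
  shows "F s t = (K T t * K T s) *\<^sub>R \<phi>\<^sub>0 s t + K T t *\<^sub>R A\<^sub>0 s t
     + K T s *\<^sub>R (\<integral>r. k r t *\<^sub>R (\<phi>\<^sub>0 s r - \<phi>\<^sub>0 s t) \<partial>lborel) + (\<integral>r. k r t *\<^sub>R (A\<^sub>0 s r - A\<^sub>0 s t) \<partial>lborel)"
proof -
  note i1 = phi0_increment_integrable[OF s(1) t(1) st]
  note i2 = G_increment_integrable[OF s t(1) st]
  have eq: "k r t *\<^sub>R (A\<^sub>0 s r - A\<^sub>0 s t) = k r t *\<^sub>R (G s r - G s t) - K T s *\<^sub>R (k r t *\<^sub>R (\<phi>\<^sub>0 s r - \<phi>\<^sub>0 s t))" for r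
  proof (cases "r \<le> T")
    case True
    have A: "A\<^sub>0 s r = G s r - K T s *\<^sub>R \<phi>\<^sub>0 s r" "A\<^sub>0 s t = G s t - K T s *\<^sub>R \<phi>\<^sub>0 s t"
      using G_conv_phi0(2)[OF s, of r] G_conv_phi0(2)[OF s, of t] True t by auto
    show ?thesis unfolding A by (simp add: algebra_simps)
  qed (use k_eq_0[of t r] in auto)
  have "(\<integral>r. k r t *\<^sub>R (A\<^sub>0 s r - A\<^sub>0 s t) \<partial>lborel)
    = (\<integral>r. k r t *\<^sub>R (G s r - G s t) \<partial>lborel) - K T s *\<^sub>R (\<integral>r. k r t *\<^sub>R (\<phi>\<^sub>0 s r - \<phi>\<^sub>0 s t) \<partial>lborel)"
    unfolding eq integral_scaleR_right[symmetric]
    by (intro Bochner_Integration.integral_diff integrable_scaleR_right i1 i2)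
  moreover have "F s t = K T t *\<^sub>R G s t + (\<integral>r. k r t *\<^sub>R (G s r - G s t) \<partial>lborel)"
  proof -
    have ind: "indicator {..T} r * k r t = k r t" for r using k_eq_0[of t r] by (auto simp: indicator_def)
    show ?thesis unfolding F_def Kstar_def ind ..
  qed
  moreover have "G s t = K T s *\<^sub>R \<phi>\<^sub>0 s t + A\<^sub>0 s t" using G_conv_phi0(2)[OF s, of t] t by simp
  ultimately show ?thesis by (simp add: scaleR_add_right)
qed

context
  fixes Ko :: "real \<Rightarrow> real \<Rightarrow> real" and N :: "real set" and \<psi> :: "real \<Rightarrow> real \<Rightarrow> 'e"
  assumes N: "N \<in> null_sets lborel"
    and K_eq: "\<And>t s. K t s = (if 0 < s \<and> s < t \<and> t \<le> T \<and> s \<notin> N then Ko t s else 0)"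
    and k_eq: "\<And>t s. k t s = (if 0 < s \<and> s < t \<and> t \<le> T \<and> s \<notin> N then dK T Ko t s else 0)"
    and psi: "\<And>u v. u \<in> {0..T} \<Longrightarrow> v \<in> {0..T} \<Longrightarrow> \<psi> u v = indicator {0..<v} u *\<^sub>R \<phi> u v"
begin

lemma psi_eq_phi0: "u \<in> {0..T} \<Longrightarrow> v \<in> {0..T} \<Longrightarrow> \<psi> u v = \<phi>\<^sub>0 u v"
  by (simp add: psi \<phi>\<^sub>0_def indicator_def)

text \<open>For \<open>s\<close> outside \<open>N\<close>, \<open>k\<close> and the derivative agree
  on the range of integration except at the end point \<open>r = s\<close>, and \<open>k\<close>
  vanishes elsewhere.\<close>

lemma set_integral_dK:
  fixes f g :: "real \<Rightarrow> 'e"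
  assumes s: "0 < s" "s < T" "s \<notin> N" and g[measurable]: "g \<in> borel_measurable borel"
    and eq: "\<And>r. r \<in> {s..T} \<Longrightarrow> f r = g r"
  shows "(LINT r:{s..T}|lebesgue. dK T Ko r s *\<^sub>R f r) = (\<integral>r. k r s *\<^sub>R g r \<partial>lborel)"
  unfolding set_lebesgue_integral_def
proof (rule lebesgue_AE_eq(1))
  show "AE r in lborel. indicator {s..T} r *\<^sub>R (dK T Ko r s *\<^sub>R f r) = k r s *\<^sub>R g r"
    using AE_lborel_singleton[of s]
    by eventually_elim (use s eq in \<open>auto simp: k_eq indicator_def\<close>)
qed measurable

lemma Kstar2_eq_F:
  assumes s: "0 < s" "s < T" "s \<notin> N" and t: "0 < t" "t < T" "t \<notin> N" and st: "s \<noteq> t"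
  shows "Kstar2 T Ko \<psi> s t = F s t"
proof -
  have 1: "AK T Ko (\<lambda>r. \<psi> r t) s = A\<^sub>0 s t"
    unfolding AK_def A\<^sub>0_def using s t by (intro set_integral_dK) (auto simp: psi_eq_phi0)
  have 2: "AK T Ko (\<lambda>r. \<psi> s r) t = (\<integral>r. k r t *\<^sub>R (\<phi>\<^sub>0 s r - \<phi>\<^sub>0 s t) \<partial>lborel)"
    unfolding AK_def using s t by (intro set_integral_dK) (auto simp: psi_eq_phi0)
  have 3: "BK T Ko \<psi> s t = (\<integral>r. k r t *\<^sub>R (A\<^sub>0 s r - A\<^sub>0 s t) \<partial>lborel)"
    unfolding BK_def
  proof (rule set_integral_dK[OF t])
    show "(\<lambda>r. A\<^sub>0 s r - A\<^sub>0 s t) \<in> borel_measurable borel"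
      unfolding A\<^sub>0_def by measurable
    fix r2 assume r2: "r2 \<in> {t..T}"
    \<comment> \<open>The rectangular increment is a difference of two increments in the first
      argument, at second arguments \<open>r2\<close> and \<open>t\<close>. Each is integrable by
      itself, so the inner integral of \<open>BK\<close> is an increment of
      \<open>A\<^sub>0\<close>.\<close>
    have "(LINT r1:{s..T}|lebesgue. dK T Ko r1 s *\<^sub>R rect_incr \<psi> s r1 t r2)
      = (\<integral>r. k r s *\<^sub>R ((\<phi>\<^sub>0 r r2 - \<phi>\<^sub>0 s r2) - (\<phi>\<^sub>0 r t - \<phi>\<^sub>0 s t)) \<partial>lborel)"
      using s t r2 by (intro set_integral_dK) (auto simp: rect_incr_def psi_eq_phi0)
    also have "\<dots> = A\<^sub>0 s r2 - A\<^sub>0 s t"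
      unfolding A\<^sub>0_def scaleR_diff_right[of _ "\<phi>\<^sub>0 _ r2 - \<phi>\<^sub>0 s r2"]
      using s t r2 by (intro Bochner_Integration.integral_diff G_conv_phi0) auto
    finally show "(LINT r1:{s..T}|lebesgue. dK T Ko r1 s *\<^sub>R rect_incr \<psi> s r1 t r2) = A\<^sub>0 s r2 - A\<^sub>0 s t" .
  qed
  have "K T s = Ko T s" "K T t = Ko T t" using s t by (auto simp: K_eq)
  then show ?thesis
    unfolding Kstar2_def 1 2 3 F_conv_phi0[OF s(1,2) t(1,2) st] using s t by (simp add: psi_eq_phi0)
qed

lemma Kstar2_AE:
  "AE x in lborel. indicator ({0..T} \<times> {0..T}) x *\<^sub>R (case x of (s, t) \<Rightarrow> (norm (Kstar2 T Ko \<psi> s t))\<^sup>2)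
     = (case x of (s, t) \<Rightarrow> (norm (F s t))\<^sup>2)"
proof -
  \<comment> \<open>The pointwise identity is available off the lines through \<open>N\<close>, 0
    and \<open>T\<close> in either variable and off the diagonal; these form a null set in the
    plane.\<close>
  define Z where "Z = N \<union> {0, T}"
  have Z: "Z \<in> null_sets lborel" unfolding Z_def by (rule null_sets.Un[OF N finite_imp_null_set_lborel]) simp
  then have [measurable]: "Z \<in> sets borel" by auto
  have "AE x in lborel \<Otimes>\<^sub>M lborel. fst x \<notin> Z \<and> snd x \<notin> Z \<and> fst x \<noteq> snd x"
  proof (rule lborel_pair.AE_pair_measure)
    show "AE x in lborel. AE y in lborel. fst (x, y) \<notin> Z \<and> snd (x, y) \<notin> Z \<and> fst (x, y) \<noteq> snd (x, y)"
      using AE_not_in[OF Z]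
    proof eventually_elim
      fix x assume "x \<notin> Z"
      show "AE y in lborel. fst (x, y) \<notin> Z \<and> snd (x, y) \<notin> Z \<and> fst (x, y) \<noteq> snd (x, y)"
        using AE_not_in[OF Z] AE_lborel_singleton[of x]
        by eventually_elim (use \<open>x \<notin> Z\<close> in auto)
    qed
  qed measurable
  then have "AE x in lborel. fst x \<notin> Z \<and> snd x \<notin> Z \<and> fst x \<noteq> snd x" by (subst (asm) lborel_prod)
  then show ?thesis
  proof eventually_elim
    fix x :: "real \<times> real" assume x: "fst x \<notin> Z \<and> snd x \<notin> Z \<and> fst x \<noteq> snd x"
    obtain s t where st: "x = (s, t)" by (cases x)
    show "indicator ({0..T} \<times> {0..T}) x *\<^sub>R (case x of (s, t) \<Rightarrow> (norm (Kstar2 T Ko \<psi> s t))\<^sup>2)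
     = (case x of (s, t) \<Rightarrow> (norm (F s t))\<^sup>2)"
    proof (cases "0 < s \<and> s < T \<and> 0 < t \<and> t < T")
      case True
      then show ?thesis using x Kstar2_eq_F[of s t] unfolding st Z_def by (simp add: indicator_def)
    next
      case False
      then have "(s, t) \<notin> {0..T} \<times> {0..T}" using x unfolding st Z_def by auto
      then show ?thesis using F_eq_0[OF False] unfolding st by simp
    qed
  qed
qed

lemma Kstar2_integral:
  "set_integrable lebesgue ({0..T} \<times> {0..T}) (\<lambda>(s, t). (norm (Kstar2 T Ko \<psi> s t))\<^sup>2)"
  "(LINT (s, t):{0..T} \<times> {0..T}|lebesgue. (norm (Kstar2 T Ko \<psi> s t))\<^sup>2)
     = (\<integral>x. (case x of (s, t) \<Rightarrow> (norm (F s t))\<^sup>2) \<partial>(lborel \<Otimes>\<^sub>M lborel))"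
proof -
  have meas: "(\<lambda>(s, t). (norm (F s t))\<^sup>2) \<in> borel_measurable borel"
    unfolding borel_prod[symmetric] by measurable
  have int: "integrable lborel (\<lambda>(s, t). (norm (F s t))\<^sup>2)"
    using F_L2 unfolding L2_def by (simp add: lborel_prod case_prod_beta')
  show "set_integrable lebesgue ({0..T} \<times> {0..T}) (\<lambda>(s, t). (norm (Kstar2 T Ko \<psi> s t))\<^sup>2)"
    unfolding set_integrable_def using lebesgue_AE_eq(2)[OF meas Kstar2_AE] int by blast
  show "(LINT (s, t):{0..T} \<times> {0..T}|lebesgue. (norm (Kstar2 T Ko \<psi> s t))\<^sup>2)
     = (\<integral>x. (case x of (s, t) \<Rightarrow> (norm (F s t))\<^sup>2) \<partial>(lborel \<Otimes>\<^sub>M lborel))"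
    unfolding set_lebesgue_integral_def using lebesgue_AE_eq(1)[OF meas Kstar2_AE] by (simp add: lborel_prod)
qed

end

end

section \<open>Covariance of the Borel version, change of exponents, extension off the
  square\<close>

lemma cov_eq:
  assumes N: "N \<in> null_sets lborel"
    and K': "(\<lambda>(t, s). if 0 < s \<and> s < t \<and> t \<le> T \<and> s \<notin> N then K t s else 0) \<in> borel_measurable borel"
    and K0: "\<And>t s. t \<in> {0..T} \<Longrightarrow> s \<in> {0..T} \<Longrightarrow> t \<le> s \<Longrightarrow> K t s = 0"
    and t: "t \<in> {0..T}" and s: "s \<in> {0..T}"
  shows "cov K t s = (\<integral>r. (if 0 < r \<and> r < t \<and> t \<le> T \<and> r \<notin> N then K t r else 0) *
      (if 0 < r \<and> r < s \<and> s \<le> T \<and> r \<notin> N then K s r else 0) \<partial>lborel)"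
  unfolding cov_def set_lebesgue_integral_def
proof (rule lebesgue_AE_eq(1))
  have "(\<lambda>r. if 0 < r \<and> r < t \<and> t \<le> T \<and> r \<notin> N then K t r else 0) \<in> borel_measurable borel" for t
    using measurable_compose[OF _ K', of "\<lambda>r. (t, r)" borel] by simp
  then show "(\<lambda>r. (if 0 < r \<and> r < t \<and> t \<le> T \<and> r \<notin> N then K t r else 0) *
      (if 0 < r \<and> r < s \<and> s \<le> T \<and> r \<notin> N then K s r else 0)) \<in> borel_measurable borel"
    by (intro borel_measurable_times)
  show "AE r in lborel. indicator {0..min t s} r *\<^sub>R (K s r * K t r)
    = (if 0 < r \<and> r < t \<and> t \<le> T \<and> r \<notin> N then K t r else 0) * (if 0 < r \<and> r < s \<and> s \<le> T \<and> r \<notin> N then K s r else 0)"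
    using AE_not_in[OF N] AE_lborel_singleton[of 0]
  proof eventually_elim
    fix r :: real assume r: "r \<notin> N" "r \<noteq> 0"
    show "indicator {0..min t s} r *\<^sub>R (K s r * K t r)
      = (if 0 < r \<and> r < t \<and> t \<le> T \<and> r \<notin> N then K t r else 0) * (if 0 < r \<and> r < s \<and> s \<le> T \<and> r \<notin> N then K s r else 0)"
    proof (cases "0 < r \<and> r < t \<and> r < s")
      case True
      then show ?thesis using r t s by (simp add: mult.commute)
    next
      case False
      then have "indicator {0..min t s} r *\<^sub>R (K s r * K t r) = 0"
        using r t s K0[of s r] K0[of t r] by (cases "0 < r \<and> r \<le> t \<and> r \<le> s") (auto simp: indicator_def)
      then show ?thesis using False by auto
    qed
  qed
qed

text \<open>Lets the kernel bounds be stated with a larger exponent, so that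
  \<open>\<alpha> = 0\<close> can be replaced by a positive one.\<close>

lemma powr_neg_le:
  fixes x a b T :: real
  assumes "0 < x" "x \<le> T" "a \<le> b"
  shows "x powr - a \<le> T powr (b - a) * x powr - b"
proof -
  have "x powr - a = x powr (b - a) * x powr - b" by (simp add: powr_add[symmetric])
  also have "\<dots> \<le> T powr (b - a) * x powr - b"
    using assms by (intro mult_right_mono powr_mono2) auto
  finally show ?thesis .
qed

text \<open>Clamping is 1-Lipschitz and its values differ by at most \<open>T\<close>, so the
  exponent \<open>l\<close> can be lowered to \<open>\<theta>\<close> at the cost of a power of
  \<open>T\<close>.\<close>

lemma clamp_powr_le:
  fixes x y T l \<theta> :: real
  assumes "0 < T" "0 \<le> \<theta>" "\<theta> \<le> l"
  shows "\<bar>max 0 (min T x) - max 0 (min T y)\<bar> powr l \<le> T powr (l - \<theta>) * \<bar>x - y\<bar> powr \<theta>"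
proof (cases "max 0 (min T x) = max 0 (min T y)")
  case False
  define d where "d = \<bar>max 0 (min T x) - max 0 (min T y)\<bar>"
  have d: "0 < d" "d \<le> T" "d \<le> \<bar>x - y\<bar>" unfolding d_def using False assms(1) by (auto simp: max_def min_def)
  have "d powr l = d powr (l - \<theta>) * d powr \<theta>" by (simp add: powr_add[symmetric])
  also have "\<dots> \<le> T powr (l - \<theta>) * \<bar>x - y\<bar> powr \<theta>"
    using d assms by (intro mult_mono powr_mono2) auto
  finally show ?thesis unfolding d_def .
qed simp

text \<open>Clamping keeps the arguments in the square and carries the Hoelder bounds over to the
  plane. The mixed bound uses the clamp estimate in both variables, hence \<open>d\<^sup>2\<close>.
  Boundedness follows by going to the origin along the two coordinate directions.\<close>

lemma strongly_hoelder_bicont_extend: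
  fixes \<phi> :: "real \<Rightarrow> real \<Rightarrow> 'e::banach"
  assumes \<phi>: "strongly_hoelder_bicont T l \<phi>" and T: "0 < T" and l: "0 < \<theta>" "\<theta> \<le> l"
  defines "c \<equiv> \<lambda>x. max 0 (min T x)"
  obtains B where "0 < B" "\<And>u v. norm (\<phi> (c u) (c v)) \<le> B"
    "\<And>u u' v. norm (\<phi> (c u') (c v) - \<phi> (c u) (c v)) \<le> B * \<bar>u' - u\<bar> powr \<theta>"
    "\<And>u v v'. norm (\<phi> (c u) (c v') - \<phi> (c u) (c v)) \<le> B * \<bar>v' - v\<bar> powr \<theta>"
    "\<And>u u' v v'. norm (\<phi> (c u) (c v) + \<phi> (c u') (c v') - \<phi> (c u) (c v') - \<phi> (c u') (c v))
       \<le> B * \<bar>u' - u\<bar> powr \<theta> * \<bar>v' - v\<bar> powr \<theta>"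
proof -
  obtain D where D: "\<forall>u1\<in>{0..T}. \<forall>u2\<in>{0..T}. \<forall>v1\<in>{0..T}. \<forall>v2\<in>{0..T}.
        (\<forall>v\<in>{0..T}. norm (\<phi> u2 v - \<phi> u1 v) \<le> D * \<bar>u2 - u1\<bar> powr l) \<and>
        (\<forall>u\<in>{0..T}. norm (\<phi> u v2 - \<phi> u v1) \<le> D * \<bar>v2 - v1\<bar> powr l) \<and>
        norm (rect_incr \<phi> u1 u2 v1 v2) \<le> D * \<bar>u2 - u1\<bar> powr l * \<bar>v2 - v1\<bar> powr l"
    using \<phi> unfolding strongly_hoelder_bicont_def by blast
  have c: "c x \<in> {0..T}" for x unfolding c_def using T by auto
  have cc: "\<bar>c x - c y\<bar> powr l \<le> T powr (l - \<theta>) * \<bar>x - y\<bar> powr \<theta>" for x y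
    unfolding c_def using T l by (intro clamp_powr_le) auto
  define d where "d = T powr (l - \<theta>)"
  have d: "0 \<le> d" unfolding d_def by simp
  have 1: "norm (\<phi> (c u') (c v) - \<phi> (c u) (c v)) \<le> \<bar>D\<bar> * d * \<bar>u' - u\<bar> powr \<theta>" for u u' v
  proof -
    have "norm (\<phi> (c u') (c v) - \<phi> (c u) (c v)) \<le> D * \<bar>c u' - c u\<bar> powr l" using D c by blast
    also have "\<dots> \<le> \<bar>D\<bar> * (d * \<bar>u' - u\<bar> powr \<theta>)"
      unfolding d_def by (intro mult_mono cc) auto
    finally show ?thesis by (simp add: mult.assoc)
  qed
  have 2: "norm (\<phi> (c u) (c v') - \<phi> (c u) (c v)) \<le> \<bar>D\<bar> * d * \<bar>v' - v\<bar> powr \<theta>" for u v v'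
  proof -
    have "norm (\<phi> (c u) (c v') - \<phi> (c u) (c v)) \<le> D * \<bar>c v' - c v\<bar> powr l" using D c by blast
    also have "\<dots> \<le> \<bar>D\<bar> * (d * \<bar>v' - v\<bar> powr \<theta>)"
      unfolding d_def by (intro mult_mono cc) auto
    finally show ?thesis by (simp add: mult.assoc)
  qed
  have 3: "norm (\<phi> (c u) (c v) + \<phi> (c u') (c v') - \<phi> (c u) (c v') - \<phi> (c u') (c v))
       \<le> \<bar>D\<bar> * d\<^sup>2 * \<bar>u' - u\<bar> powr \<theta> * \<bar>v' - v\<bar> powr \<theta>" for u u' v v'
  proof -
    have "norm (rect_incr \<phi> (c u) (c u') (c v) (c v')) \<le> D * \<bar>c u' - c u\<bar> powr l * \<bar>c v' - c v\<bar> powr l" using D c by blast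
    also have "\<dots> \<le> \<bar>D\<bar> * (d * \<bar>u' - u\<bar> powr \<theta>) * (d * \<bar>v' - v\<bar> powr \<theta>)"
      unfolding d_def by (intro mult_mono cc) auto
    finally show ?thesis by (simp add: rect_incr_def power2_eq_square ac_simps)
  qed
  have 4: "norm (\<phi> (c u) (c v)) \<le> norm (\<phi> 0 0) + 2 * (\<bar>D\<bar> * T powr l)" for u v
  proof -
    have z: "(0::real) \<in> {0..T}" using T by auto
    have b: "D * \<bar>c x - 0\<bar> powr l \<le> \<bar>D\<bar> * T powr l" for x
      using c[of x] l by (intro mult_mono powr_mono2) auto
    have "norm (\<phi> (c u) (c v) - \<phi> 0 (c v)) \<le> D * \<bar>c u - 0\<bar> powr l"
      "norm (\<phi> 0 (c v) - \<phi> 0 0) \<le> D * \<bar>c v - 0\<bar> powr l" using D c z by blast+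
    then have *: "norm (\<phi> (c u) (c v) - \<phi> 0 (c v)) \<le> \<bar>D\<bar> * T powr l" "norm (\<phi> 0 (c v) - \<phi> 0 0) \<le> \<bar>D\<bar> * T powr l"
      using b order_trans by blast+
    have "\<phi> (c u) (c v) = (\<phi> (c u) (c v) - \<phi> 0 (c v)) + (\<phi> 0 (c v) - \<phi> 0 0) + \<phi> 0 0" by simp
    also have "norm \<dots> \<le> \<bar>D\<bar> * T powr l + \<bar>D\<bar> * T powr l + norm (\<phi> 0 0)"
      by (intro norm_triangle_le add_mono * order_refl)
    finally show ?thesis by simp
  qed
  define B where "B = norm (\<phi> 0 0) + 2 * (\<bar>D\<bar> * T powr l) + \<bar>D\<bar> * d + \<bar>D\<bar> * d\<^sup>2 + 1"
  have nonneg: "0 \<le> norm (\<phi> 0 0)" "0 \<le> \<bar>D\<bar> * T powr l" "0 \<le> \<bar>D\<bar> * d" "0 \<le> \<bar>D\<bar> * d\<^sup>2" using d by auto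
  have B: "0 < B" "norm (\<phi> 0 0) + 2 * (\<bar>D\<bar> * T powr l) \<le> B" "\<bar>D\<bar> * d \<le> B" "\<bar>D\<bar> * d\<^sup>2 \<le> B"
    unfolding B_def using nonneg by linarith+
  show ?thesis
  proof (rule that[of B])
    show "norm (\<phi> (c u') (c v) - \<phi> (c u) (c v)) \<le> B * \<bar>u' - u\<bar> powr \<theta>" for u u' v
      by (rule order_trans[OF 1]) (intro mult_right_mono B, simp)
    show "norm (\<phi> (c u) (c v') - \<phi> (c u) (c v)) \<le> B * \<bar>v' - v\<bar> powr \<theta>" for u v v'
      by (rule order_trans[OF 2]) (intro mult_right_mono B, simp)
    show "norm (\<phi> (c u) (c v) + \<phi> (c u') (c v') - \<phi> (c u) (c v') - \<phi> (c u') (c v))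
       \<le> B * \<bar>u' - u\<bar> powr \<theta> * \<bar>v' - v\<bar> powr \<theta>" for u u' v v'
      by (rule order_trans[OF 3]) (intro mult_right_mono B, simp_all)
    show "norm (\<phi> (c u) (c v)) \<le> B" for u v by (rule order_trans[OF 4 B(2)])
  qed (rule B)
qed

theorem proposition3p10:
  fixes T C \<alpha> l :: real
    and K :: "real \<Rightarrow> real \<Rightarrow> real"
    and \<psi> \<psi>t :: "real \<Rightarrow> real \<Rightarrow> real ^ 'd ^ 'd"
    and ind :: "real \<Rightarrow> 'd::finite \<Rightarrow> 'h::{real_inner,banach}"
    and tens :: "'h \<Rightarrow> 'h \<Rightarrow> 'g::{real_inner,banach}"
  assumes T: "0 < T"
    and K: "volterra_kernel T K"
    and alpha: "0 \<le> \<alpha>" "\<alpha> < 1/4"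
    and K_bound: "\<And>s t. 0 < s \<Longrightarrow> s < t \<Longrightarrow> t \<le> T \<Longrightarrow>
        \<bar>K t s\<bar> \<le> C * s powr (-\<alpha>) * (t - s) powr (-\<alpha>)"
    and K_diff: "\<And>s t. 0 < s \<Longrightarrow> s < t \<Longrightarrow> t \<le> T \<Longrightarrow>
        (\<lambda>x. K x s) differentiable (at t within {0..T})"
    and dK_bound: "\<And>s t. 0 < s \<Longrightarrow> s < t \<Longrightarrow> t \<le> T \<Longrightarrow>
        \<bar>dK T K t s\<bar> \<le> C * (t - s) powr (-(\<alpha> + 1))"
    and H1: "H1_embedding T K ind"
    and H1_tensor: "tensor_embedding (H1_space T ind) tens"
    and lambda: "0 < l" "l \<le> 1" "\<alpha> < l"
    and psit: "strongly_hoelder_bicont T l \<psi>t"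
    and psi: "\<And>u v. u \<in> {0..T} \<Longrightarrow> v \<in> {0..T} \<Longrightarrow> \<psi> u v = indicator {0..<v} u *\<^sub>R \<psi>t u v"
  shows "(\<forall>v\<in>{0..T}. \<forall>j. \<exists>h\<in>H1_space T ind.
            (step_approx ind (\<lambda>u. column j (\<psi> u v)) \<longlongrightarrow> h) (mesh_to_0 T)) \<and>
         (\<exists>\<Psi>\<in>tensor_space (H1_space T ind) tens.
            set_integrable lebesgue ({0..T} \<times> {0..T}) (\<lambda>(s, t). (norm (Kstar2 T K \<psi> s t))\<^sup>2) \<and>
            (norm \<Psi>)\<^sup>2 =
              (LINT (s, t):{0..T} \<times> {0..T}|lebesgue. (norm (Kstar2 T K \<psi> s t))\<^sup>2) \<and>
            ((\<lambda>\<pi>. norm (psi_partition T ind tens \<psi> \<pi> - \<Psi>)) \<longlongrightarrow> 0) (mesh_to_0 T))"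
proof -
  \<comment> \<open>An exponent strictly between \<open>\<alpha>\<close> and the smaller of
    \<open>1/4\<close> and \<open>l\<close>; it is positive also when
    \<open>\<alpha> = 0\<close>.\<close>
  define a where "a = (\<alpha> + min (1/4) l) / 2"
  have a: "0 < a" "a < 1/4" "\<alpha> < a" "a < l" unfolding a_def using alpha lambda by auto
  \<comment> \<open>The midpoint between \<open>a\<close> and \<open>min l (1/2 - a)\<close>, which
    leaves room because \<open>a < l\<close> and \<open>a < 1/4\<close>. The bound by
    \<open>1/2 - a\<close> gives the square integrability in the L2 estimates, and
    \<open>\<theta> \<le> l\<close> permits lowering the Hoelder exponent.\<close>
  define \<theta> where "\<theta> = (a + min l (1/2 - a)) / 2"
  have \<theta>: "a < \<theta>" "\<theta> < 1/2 - a" "\<theta> \<le> l" unfolding \<theta>_def using a by auto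
  define p where "p = T powr (a - \<alpha>)"
  have p: "0 \<le> p" unfolding p_def by simp
  \<comment> \<open>One constant for both kernel bounds. Raising the exponent costs a factor
    \<open>p\<close> for each singular power, so \<open>p * p\<close> for \<open>K\<close> and
    \<open>p\<close> for its derivative; the added ones make it positive.\<close>
  define D where "D = (\<bar>C\<bar> + 1) * (p * p + p + 1)"
  have "0 < (\<bar>C\<bar> + 1) * (p * p + p + 1)" using p by (intro mult_pos_pos) (auto intro!: add_nonneg_pos)
  then have D: "0 < D" "\<bar>C\<bar> * (p * p) \<le> D" "\<bar>C\<bar> * p \<le> D"
    unfolding D_def using p by (auto intro!: mult_mono add_nonneg_nonneg)
  have K_le: "\<bar>K t s\<bar> \<le> D * s powr - a * (t - s) powr - a" if "0 < s" "s < t" "t \<le> T" for s t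
  proof -
    have "\<bar>K t s\<bar> \<le> C * s powr - \<alpha> * (t - s) powr - \<alpha>" by (rule K_bound[OF that])
    also have "\<dots> \<le> \<bar>C\<bar> * (p * s powr - a) * (p * (t - s) powr - a)"
      unfolding p_def using that a p_def p by (intro mult_mono powr_neg_le) auto
    also have "\<dots> = (\<bar>C\<bar> * (p * p)) * (s powr - a * (t - s) powr - a)" by simp
    also have "\<dots> \<le> D * (s powr - a * (t - s) powr - a)" by (intro mult_right_mono D) auto
    finally show ?thesis by (simp add: mult.assoc)
  qed
  have dK_le: "\<bar>dK T K t s\<bar> \<le> D * (t - s) powr (- a - 1)" if "0 < s" "s < t" "t \<le> T" for s t
  proof -
    have "\<bar>dK T K t s\<bar> \<le> C * (t - s) powr - (\<alpha> + 1)" by (rule dK_bound[OF that])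
    also have "\<dots> \<le> \<bar>C\<bar> * (T powr ((a + 1) - (\<alpha> + 1)) * (t - s) powr - (a + 1))"
      using that a by (intro mult_mono powr_neg_le) auto
    also have "\<dots> = (\<bar>C\<bar> * p) * (t - s) powr (- a - 1)" unfolding p_def by simp
    also have "\<dots> \<le> D * (t - s) powr (- a - 1)" by (intro mult_right_mono D) auto
    finally show ?thesis .
  qed
  have K_meas: "set_borel_measurable lebesgue ({0..T} \<times> {0..T}) (\<lambda>(t, s). K t s)"
    and K_0: "\<And>t s. t \<in> {0..T} \<Longrightarrow> s \<in> {0..T} \<Longrightarrow> t \<le> s \<Longrightarrow> K t s = 0"
    using K unfolding volterra_kernel_def by blast+
  obtain N where N: "N \<in> null_sets lborel" and
    kernel: "singular_kernel T a D \<theta> (\<lambda>t s. if 0 < s \<and> s < t \<and> t \<le> T \<and> s \<notin> N then K t s else 0)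
      (\<lambda>t s. if 0 < s \<and> s < t \<and> t \<le> T \<and> s \<notin> N then dK T K t s else 0)"
    using singular_kernel_version[OF T K_meas K_diff K_le dK_le a(1,2) D(1) \<theta>(1,2)] by blast
  define K' where "K' t s = (if 0 < s \<and> s < t \<and> t \<le> T \<and> s \<notin> N then K t s else 0)" for t s
  define k' where "k' t s = (if 0 < s \<and> s < t \<and> t \<le> T \<and> s \<notin> N then dK T K t s else 0)" for t s
  interpret singular_kernel T a D \<theta> K' k'
    using kernel unfolding K'_def[abs_def] k'_def[abs_def] .
  define c where "c x = max 0 (min T x)" for x
  have c: "c x = x" if "x \<in> {0..T}" for x using that unfolding c_def by auto
  define \<phi> where "\<phi> u v = \<psi>t (c u) (c v)" for u v
  obtain B where B: "0 < B" "\<And>u v. norm (\<phi> u v) \<le> B"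
    "\<And>u u' v. norm (\<phi> u' v - \<phi> u v) \<le> B * \<bar>u' - u\<bar> powr \<theta>"
    "\<And>u v v'. norm (\<phi> u v' - \<phi> u v) \<le> B * \<bar>v' - v\<bar> powr \<theta>"
    "\<And>u u' v v'. norm (\<phi> u v + \<phi> u' v' - \<phi> u v' - \<phi> u' v) \<le> B * \<bar>u' - u\<bar> powr \<theta> * \<bar>v' - v\<bar> powr \<theta>"
    unfolding \<phi>_def c_def
    by (rule strongly_hoelder_bicont_extend[OF psit T _ \<theta>(3)]) (use a \<theta> in auto)
  have psi': "\<psi> u v = indicator {0..<v} u *\<^sub>R \<phi> u v" if "u \<in> {0..T}" "v \<in> {0..T}" for u v
    using psi[OF that] that unfolding \<phi>_def by (simp add: c)
  interpret hilbert_realization T a D \<theta> K' k' B \<phi> ind tens \<psi>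
  proof unfold_locales
    fix t s :: real and u v :: 'd assume "t \<in> {0..T}" "s \<in> {0..T}"
    then show "inner (ind t u) (ind s v) = (if u = v then \<integral>r. K' t r * K' s r \<partial>lborel else 0)"
      using H1 cov_eq[OF N, of T K t s] K_0 K_borel unfolding H1_embedding_def K'_def by (simp add: case_prod_beta')
  qed (use B H1_tensor psi' in auto)
  obtain \<Psi> where \<Psi>: "\<Psi> \<in> tensor_space (H1_space T ind) tens"
    "(psi_partition T ind tens \<psi> \<longlongrightarrow> \<Psi>) (mesh_to_0 T)"
    "(norm \<Psi>)\<^sup>2 = (\<integral>x. (case x of (s, t) \<Rightarrow> (norm (F s t))\<^sup>2) \<partial>(lborel \<Otimes>\<^sub>M lborel))"
    by (rule psi_partition_tendsto)
  note Kstar2 = Kstar2_integral[OF N K'_def k'_def psi']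
  have "((\<lambda>\<pi>. norm (psi_partition T ind tens \<psi> \<pi> - \<Psi>)) \<longlongrightarrow> 0) (mesh_to_0 T)"
    using \<Psi>(2) by (rule tendsto_norm_zero[OF LIM_zero])
  then have "\<exists>\<Psi>\<in>tensor_space (H1_space T ind) tens.
      set_integrable lebesgue ({0..T} \<times> {0..T}) (\<lambda>(s, t). (norm (Kstar2 T K \<psi> s t))\<^sup>2) \<and>
      (norm \<Psi>)\<^sup>2 = (LINT (s, t):{0..T} \<times> {0..T}|lebesgue. (norm (Kstar2 T K \<psi> s t))\<^sup>2) \<and>
      ((\<lambda>\<pi>. norm (psi_partition T ind tens \<psi> \<pi> - \<Psi>)) \<longlongrightarrow> 0) (mesh_to_0 T)"
    using \<Psi>(3) Kstar2 by (intro bexI[OF _ \<Psi>(1)]) simp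
  moreover have "\<forall>v\<in>{0..T}. \<forall>j. \<exists>h\<in>H1_space T ind.
      (step_approx ind (\<lambda>u. column j (\<psi> u v)) \<longlongrightarrow> h) (mesh_to_0 T)"
    using path_vec_tendsto by blast
  ultimately show ?thesis by blast
qed

end
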